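(* Let $D = \bigotimes_{n=1}^{\infty} M_{2^n}$ (the $2^\infty$ UHF algebra), and let $\beta$ be the automorphism of $D$ of order $2$ given by $$\beta = \bigotimes_{n=1}^{\infty} \mathrm{Ad}\left( 1_{2^{n-1}+1} \oplus (-1_{2^{n-1}-1}) \right).$$ Then the action of $\mathbf{Z}_2 = \mathbf{Z}/2\mathbf{Z}$ generated by $\beta$ has the tracial Rokhlin property.
   Context: Here $1_m$ is the identity of $M_m$; the automorphism in the $n$-th tensor factor is conjugation by a diagonal unitary in $M_{2^n}$ in which $2^{n-1}+1$ diagonal entries are equal to $1$ and $2^{n-1}-1$ diagonal entries are equal to $-1$. Tracial Rokhlin property: let $A$ be a stably finite simple unital C*-algebra and let $\alpha \in \mathrm{Aut}(A)$ satisfy $\alpha^n = \mathrm{id}_A$. The action of $\mathbf{Z}_n$ generated by $\alpha$ has the tracial Rokhlin property if for every finite set $F \subset A$, every $\varepsilon > 0$, every $N \in \mathbf{N}$, and every nonzero positive element $x \in A$, there are mutually orthogonal projections $e_0, \dots, e_{n-1} \in A$ such that: (1) $\| \alpha(e_j) - e_{j+1} \| < \varepsilon$ for $0 \le j \le n-2$; (2) $\| e_j a - a e_j \| < \varepsilon$ for $0 \le j \le n-1$ and all $a \in F$; (3) with $e = \sum_{j=0}^{n-1} e_j$, the projection $1-e$ is Murray-von Neumann equivalent to a projection in the hereditary subalgebra of $A$ generated by $x$; (4) for every $0 \le j \le n-1$ there are $N$ mutually orthogonal projections $f_1, \dots, f_N \le e_j$, each Murray-von Neumann equivalent to $1-e$.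 (The case $e=1$ is allowed, and then (3) and (4) are vacuous.) *)

theory Defs
  imports "HOL-Analysis.Analysis" "Jordan_Normal_Form.Schur_Decomposition"
begin

subsection \<open>Square-summable families\<close>

typedef 'i ell2 = "{f :: 'i \<Rightarrow> complex. (\<lambda>i. (norm (f i))\<^sup>2) summable_on UNIV}"
  morphisms coord Abs_ell2
  by (rule exI[of _ "\<lambda>_. 0"]) simp

setup_lifting type_definition_ell2

lemma ell2_summable: "(\<lambda>i. (norm (coord f i))\<^sup>2) summable_on UNIV"
  using coord[of f] by simp

lemma ell2_eqI: "(\<And>i. coord f i = coord g i) \<Longrightarrow> f = g"
  by (simp add: coord_inject[symmetric] fun_eq_iff)

lemma square_summable_add:
  fixes f g :: "'i \<Rightarrow> complex"
  assumes "(\<lambda>i. (norm (f i))\<^sup>2) summable_on UNIV" "(\<lambda>i. (norm (g i))\<^sup>2) summable_on UNIV"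
  shows "(\<lambda>i. (norm (f i + g i))\<^sup>2) summable_on UNIV"
proof (rule summable_on_comparison_test)
  show "(\<lambda>i. 2 * (norm (f i))\<^sup>2 + 2 * (norm (g i))\<^sup>2) summable_on UNIV"
    by (intro summable_on_add summable_on_cmult_right assms)
  fix i
  have "(norm (f i + g i))\<^sup>2 \<le> (norm (f i) + norm (g i))\<^sup>2"
    by (intro power_mono norm_triangle_ineq) simp
  also have "\<dots> \<le> 2 * (norm (f i))\<^sup>2 + 2 * (norm (g i))\<^sup>2"
    using sum_squares_bound[of "norm (f i)" "norm (g i)"] by (simp add: power2_sum)
  finally show "(norm (f i + g i))\<^sup>2 \<le> 2 * (norm (f i))\<^sup>2 + 2 * (norm (g i))\<^sup>2" .
qed simp_all

instantiation ell2 :: (type) real_vector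
begin
lift_definition zero_ell2 :: "'a ell2" is "\<lambda>_. 0" by simp
lift_definition plus_ell2 :: "'a ell2 \<Rightarrow> 'a ell2 \<Rightarrow> 'a ell2" is "\<lambda>f g i. f i + g i"
  by (rule square_summable_add)
lift_definition uminus_ell2 :: "'a ell2 \<Rightarrow> 'a ell2" is "\<lambda>f i. - f i" by simp
lift_definition minus_ell2 :: "'a ell2 \<Rightarrow> 'a ell2 \<Rightarrow> 'a ell2" is "\<lambda>f g i. f i - g i"
  subgoal for f g using square_summable_add[of f "\<lambda>i. - g i"] by simp done
lift_definition scaleR_ell2 :: "real \<Rightarrow> 'a ell2 \<Rightarrow> 'a ell2" is "\<lambda>r f i. r *\<^sub>R f i"
  by (simp add: power_mult_distrib summable_on_cmult_right)
instance
  by standard (transfer; simp add: algebra_simps fun_eq_iff)+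
end

lemma inner_summable_on:
  fixes f g :: "'i \<Rightarrow> complex"
  assumes "(\<lambda>i. (norm (f i))\<^sup>2) summable_on A" "(\<lambda>i. (norm (g i))\<^sup>2) summable_on A"
  shows "(\<lambda>i. inner (f i) (g i)) summable_on A"
proof (rule abs_summable_summable, rule summable_on_comparison_test)
  show "(\<lambda>i. (norm (f i))\<^sup>2 + (norm (g i))\<^sup>2) summable_on A"
    by (intro summable_on_add assms)
  fix i
  have "norm (inner (f i) (g i)) \<le> norm (f i) * norm (g i)"
    using Cauchy_Schwarz_ineq2 by simp
  also have "\<dots> \<le> (norm (f i))\<^sup>2 + (norm (g i))\<^sup>2"
    using sum_squares_bound[of "norm (f i)" "norm (g i)"]
      mult_nonneg_nonneg[OF norm_ge_zero norm_ge_zero, of "f i" "g i"] by linarith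
  finally show "norm (inner (f i) (g i)) \<le> (norm (f i))\<^sup>2 + (norm (g i))\<^sup>2" .
qed simp_all

lemma inner_summable: "(\<lambda>i. inner (coord f i) (coord g i)) summable_on UNIV"
  by (intro inner_summable_on ell2_summable)

(* The real inner product below is the real part of the usual complex one. *)
instantiation ell2 :: (type) real_inner
begin
definition inner_ell2 :: "'a ell2 \<Rightarrow> 'a ell2 \<Rightarrow> real"
  where "inner_ell2 f g = (\<Sum>\<^sub>\<infinity>i. inner (coord f i) (coord g i))"
definition norm_ell2 :: "'a ell2 \<Rightarrow> real" where "norm_ell2 f = sqrt (inner f f)"
definition dist_ell2 :: "'a ell2 \<Rightarrow> 'a ell2 \<Rightarrow> real" where "dist_ell2 f g = norm (f - g)"
definition sgn_ell2 :: "'a ell2 \<Rightarrow> 'a ell2" where "sgn_ell2 f = f /\<^sub>R norm f"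
definition uniformity_ell2 :: "('a ell2 \<times> 'a ell2) filter"
  where "uniformity_ell2 = (INF e\<in>{0<..}. principal {(x, y). dist x y < e})"
definition open_ell2 :: "'a ell2 set \<Rightarrow> bool"
  where "open_ell2 U \<longleftrightarrow> (\<forall>x\<in>U. \<forall>\<^sub>F (x', y) in uniformity. x' = x \<longrightarrow> y \<in> U)"
instance
proof
  fix x y z :: "'a ell2" and r :: real
  show "inner x y = inner y x" by (simp add: inner_ell2_def inner_commute)
  show "inner (x + y) z = inner x z + inner y z"
    by (simp add: inner_ell2_def plus_ell2.rep_eq inner_add_left infsum_add inner_summable)
  show "inner (r *\<^sub>R x) y = r * inner x y"
    by (simp add: inner_ell2_def scaleR_ell2.rep_eq infsum_cmult_right inner_summable)
  show "0 \<le> inner x x" by (auto simp: inner_ell2_def intro!: infsum_nonneg)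
  show "(inner x x = 0) = (x = 0)"
  proof
    assume a: "inner x x = 0"
    show "x = 0"
    proof (rule ell2_eqI)
      fix i
      have "inner (coord x i) (coord x i) = 0"
        by (rule nonneg_infsum_le_0D[of _ UNIV])
          (use a in \<open>auto simp: inner_ell2_def inner_summable\<close>)
      then show "coord x i = coord 0 i" by (simp add: zero_ell2.rep_eq)
    qed
  qed (simp add: inner_ell2_def zero_ell2.rep_eq)
qed (rule dist_ell2_def sgn_ell2_def uniformity_ell2_def open_ell2_def norm_ell2_def)+
end

lemma norm_ell2_sq: "(norm f)\<^sup>2 = (\<Sum>\<^sub>\<infinity>i. (norm (coord f i))\<^sup>2)"
proof -
  have "(norm f)\<^sup>2 = inner f f" by (simp add: power2_norm_eq_inner)
  then show ?thesis by (simp add: inner_ell2_def power2_norm_eq_inner)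
qed

lemma sum_le_norm_ell2: "finite A \<Longrightarrow> (\<Sum>i\<in>A. (norm (coord f i))\<^sup>2) \<le> (norm f)\<^sup>2"
  unfolding norm_ell2_sq by (intro finite_sum_le_infsum ell2_summable) auto

lemma coord_le_norm: "norm (coord f i) \<le> norm f"
  by (rule power2_le_imp_le) (use sum_le_norm_ell2[of "{i}" f] in simp_all)

lemma ell2_boundI:
  assumes "\<And>A. finite A \<Longrightarrow> (\<Sum>i\<in>A. (norm (f i))\<^sup>2) \<le> B\<^sup>2" "B \<ge> 0"
  shows "(\<lambda>i. (norm (f i :: complex))\<^sup>2) summable_on UNIV" "norm (Abs_ell2 f) \<le> B"
proof -
  show s: "(\<lambda>i. (norm (f i))\<^sup>2) summable_on UNIV"
    by (rule nonneg_bdd_above_summable_on) (use assms in \<open>auto intro!: bdd_aboveI2\<close>)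
  have "(norm (Abs_ell2 f))\<^sup>2 = (\<Sum>\<^sub>\<infinity>i. (norm (f i))\<^sup>2)"
    using s by (simp add: norm_ell2_sq Abs_ell2_inverse)
  also have "\<dots> \<le> B\<^sup>2"
    by (rule infsum_le_finite_sums) (use s assms in auto)
  finally show "norm (Abs_ell2 f) \<le> B" using assms(2) by (rule power2_le_imp_le)
qed

instance ell2 :: (type) complete_space
proof
  fix X :: "nat \<Rightarrow> 'a ell2"
  assume C: "Cauchy X"
  have "\<exists>l. (\<lambda>n. coord (X n) i) \<longlonglongrightarrow> l" for i
  proof -
    have "Cauchy (\<lambda>n. coord (X n) i)"
      unfolding Cauchy_def
    proof (intro allI impI)
      fix e :: real assume "e > 0"
      then obtain M where M: "\<And>m n. m \<ge> M \<Longrightarrow> n \<ge> M \<Longrightarrow> dist (X m) (X n) < e"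
        using C unfolding Cauchy_def by meson
      have "dist (coord (X m) i) (coord (X n) i) \<le> dist (X m) (X n)" for m n
        using coord_le_norm[of "X m - X n" i] by (simp add: dist_norm minus_ell2.rep_eq)
      then show "\<exists>M. \<forall>m\<ge>M. \<forall>n\<ge>M. dist (coord (X m) i) (coord (X n) i) < e"
        using M by (meson le_less_trans)
    qed
    then show ?thesis using Cauchy_convergent_iff convergent_def by blast
  qed
  then obtain l where l: "\<And>i. (\<lambda>n. coord (X n) i) \<longlonglongrightarrow> l i" by metis
  have bound: "(\<Sum>i\<in>A. (norm (coord (X n) i - l i))\<^sup>2) \<le> e\<^sup>2"
    if M: "\<And>m n. m \<ge> M \<Longrightarrow> n \<ge> M \<Longrightarrow> dist (X m) (X n) < e" and n: "n \<ge> M" and "finite A" for M n e A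
  proof (rule LIMSEQ_le_const2)
    show "(\<lambda>m. \<Sum>i\<in>A. (norm (coord (X n) i - coord (X m) i))\<^sup>2) \<longlonglongrightarrow> (\<Sum>i\<in>A. (norm (coord (X n) i - l i))\<^sup>2)"
      by (intro tendsto_intros l)
    show "\<exists>N. \<forall>m\<ge>N. (\<Sum>i\<in>A. (norm (coord (X n) i - coord (X m) i))\<^sup>2) \<le> e\<^sup>2"
    proof (intro exI allI impI)
      fix m assume "m \<ge> M"
      have "(\<Sum>i\<in>A. (norm (coord (X n) i - coord (X m) i))\<^sup>2) \<le> (norm (X n - X m))\<^sup>2"
        using sum_le_norm_ell2[OF \<open>finite A\<close>, of "X n - X m"] by (simp add: minus_ell2.rep_eq)
      also have "\<dots> \<le> e\<^sup>2"
        using M[OF n \<open>m \<ge> M\<close>] by (intro power_mono) (auto simp: dist_norm)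
      finally show "(\<Sum>i\<in>A. (norm (coord (X n) i - coord (X m) i))\<^sup>2) \<le> e\<^sup>2" .
    qed
  qed
  obtain M where M: "\<And>m n. m \<ge> M \<Longrightarrow> n \<ge> M \<Longrightarrow> dist (X m) (X n) < 1"
    using C[unfolded Cauchy_def, rule_format, of 1] by auto
  have "(\<lambda>i. (norm (coord (X M) i - l i))\<^sup>2) summable_on UNIV"
    by (rule ell2_boundI(1)[of _ 1]) (use bound[OF M] in auto)
  then have "(\<lambda>i. (norm (coord (X M) i - (coord (X M) i - l i)))\<^sup>2) summable_on UNIV"
    using square_summable_add[OF ell2_summable[of "X M"], of "\<lambda>i. - (coord (X M) i - l i)"]
    by (simp add: norm_minus_commute)
  then have ls: "(\<lambda>i. (norm (l i))\<^sup>2) summable_on UNIV" by simp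
  have "X \<longlonglongrightarrow> Abs_ell2 l"
    unfolding lim_sequentially
  proof (intro allI impI)
    fix r :: real assume "r > 0"
    then obtain M where M: "\<And>m n. m \<ge> M \<Longrightarrow> n \<ge> M \<Longrightarrow> dist (X m) (X n) < r / 2"
      using C unfolding Cauchy_def by (meson half_gt_zero)
    have "dist (X n) (Abs_ell2 l) < r" if "n \<ge> M" for n
    proof -
      have e: "X n - Abs_ell2 l = Abs_ell2 (\<lambda>i. coord (X n) i - l i)"
        using ls by (simp add: minus_ell2_def Abs_ell2_inverse)
      have "norm (X n - Abs_ell2 l) \<le> r / 2"
        unfolding e by (rule ell2_boundI(2)) (use bound[OF M that] \<open>r > 0\<close> in auto)
      then show ?thesis using \<open>r > 0\<close> by (simp add: dist_norm)
    qed
    then show "\<exists>no. \<forall>n\<ge>no. dist (X n) (Abs_ell2 l) < r" by blast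
  qed
  then show "convergent X" by (auto simp: convergent_def)
qed

instance ell2 :: (type) banach ..

lift_definition cscale :: "complex \<Rightarrow> 'i ell2 \<Rightarrow> 'i ell2" is "\<lambda>c f i. c * f i"
  by (simp add: norm_mult power_mult_distrib summable_on_cmult_right)

lemma norm_cscale: "norm (cscale c f) = norm c * norm f"
proof -
  have "(norm (cscale c f))\<^sup>2 = (norm c * norm f)\<^sup>2"
    by (simp add: norm_ell2_sq cscale.rep_eq norm_mult power_mult_distrib infsum_cmult_right' )
  then show ?thesis by (simp add: power2_eq_iff_nonneg)
qed

lift_definition cscale_op :: "complex \<Rightarrow> 'i ell2 \<Rightarrow>\<^sub>L 'i ell2" is cscale
  by (rule bounded_linear_intro[where K = "norm c" for c])
    (auto simp: norm_cscale intro!: ell2_eqI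
      simp: cscale.rep_eq plus_ell2.rep_eq scaleR_ell2.rep_eq algebra_simps)

subsection \<open>Matrix algebras acting on tensor factors\<close>

(* Multi-indices label the product orthonormal basis of the infinite tensor product of the
   Hilbert spaces C^(2^k), k >= 1, along the first basis vectors, so this Hilbert space is
   multi_index ell2. Position 0 belongs to a one-dimensional factor and is always 0. *)
typedef multi_index = "{i :: nat \<Rightarrow> nat. (\<forall>n. i n < 2 ^ n) \<and> finite {n. i n \<noteq> 0}}"
  morphisms digit Abs_multi_index
  by (rule exI[of _ "\<lambda>_. 0"]) simp

setup_lifting type_definition_multi_index

lemma digit_less: "digit i k < 2 ^ k"
  using digit[of i] by simp

lift_definition upd :: "multi_index \<Rightarrow> nat \<Rightarrow> nat \<Rightarrow> multi_index"
  is "\<lambda>i k s. if s < 2 ^ k then i(k := s) else i"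
  subgoal for i k s
    by (auto intro: finite_subset[of _ "insert k {n. i n \<noteq> 0}"])
  done

lemma digit_upd: "s < 2 ^ k \<Longrightarrow> digit (upd i k s) = (digit i)(k := s)"
  by (simp add: upd.rep_eq)

lemma multi_index_eqI: "digit i = digit j \<Longrightarrow> i = j"
  by (simp add: digit_inject)

lemma upd_upd: "s < 2 ^ k \<Longrightarrow> r < 2 ^ k \<Longrightarrow> upd (upd i k s) k r = upd i k r"
  by (rule multi_index_eqI) (simp add: digit_upd)

lemma upd_same: "upd i k (digit i k) = i"
  by (rule multi_index_eqI) (simp add: digit_upd digit_less)

lemma inj_on_upd: "s < 2 ^ k \<Longrightarrow> inj_on (\<lambda>i. upd i k s) {i. digit i k = r}"
  by (rule inj_onI) (metis (mono_tags, lifting) digit_less mem_Collect_eq upd_same upd_upd)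

lemma sum_upd_le:
  fixes h :: "multi_index \<Rightarrow> real"
  assumes A: "finite A" and s: "s < 2 ^ k" and B: "\<And>A. finite A \<Longrightarrow> sum h A \<le> B"
  shows "(\<Sum>i\<in>A. h (upd i k s)) \<le> 2 ^ k * B"
proof -
  have "(\<Sum>i\<in>A. h (upd i k s)) = (\<Sum>r<2^k. \<Sum>i\<in>{i\<in>A. digit i k = r}. h (upd i k s))"
    by (rule sum.group[symmetric]) (use A digit_less in auto)
  also have "\<dots> = (\<Sum>r<2^k. sum h ((\<lambda>i. upd i k s) ` {i\<in>A. digit i k = r}))"
    by (intro sum.cong refl sum.reindex_cong[symmetric, where l = "\<lambda>i. upd i k s"]
        inj_on_subset[OF inj_on_upd[OF s]]) auto
  also have "\<dots> \<le> (\<Sum>r<(2::nat)^k. B)"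
    by (intro sum_mono B finite_imageI) (use A in simp)
  finally show ?thesis by simp
qed

lemma factor_bound:
  fixes f :: "multi_index ell2" and a :: "complex mat" and k :: nat
  defines "K \<equiv> (\<Sum>r<2^k. \<Sum>s<2^k. norm (a $$ (r, s)))"
  assumes A: "finite A"
  shows "(\<Sum>i\<in>A. (norm (\<Sum>s<2^k. a $$ (digit i k, s) * coord f (upd i k s)))\<^sup>2)
    \<le> (norm f * (K * 2 ^ k * 2 ^ k))\<^sup>2"
proof -
  have K: "norm (a $$ (r, s)) \<le> K" if "r < 2 ^ k" "s < 2 ^ k" for r s
  proof -
    have "norm (a $$ (r, s)) \<le> (\<Sum>s<2^k. norm (a $$ (r, s)))"
      by (rule member_le_sum) (use that in auto)
    also have "\<dots> \<le> K" unfolding K_def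
      by (rule member_le_sum[of r _ "\<lambda>r. \<Sum>s<2^k. norm (a $$ (r, s))"]) (use that in \<open>auto intro: sum_nonneg\<close>)
    finally show ?thesis .
  qed
  have K0: "K \<ge> 0" unfolding K_def by (intro sum_nonneg) auto
  have "(norm (\<Sum>s<2^k. a $$ (digit i k, s) * coord f (upd i k s)))\<^sup>2
      \<le> K\<^sup>2 * (2 ^ k * (\<Sum>s<2^k. (norm (coord f (upd i k s)))\<^sup>2))" for i
  proof -
    have "norm (\<Sum>s<2^k. a $$ (digit i k, s) * coord f (upd i k s))
        \<le> (\<Sum>s<2^k. K * norm (coord f (upd i k s)))"
      by (rule order_trans[OF norm_sum]) (intro sum_mono, simp add: norm_mult mult_right_mono K digit_less)
    then have "(norm (\<Sum>s<2^k. a $$ (digit i k, s) * coord f (upd i k s)))\<^sup>2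
        \<le> (K * (\<Sum>s<2^k. 1 * norm (coord f (upd i k s))))\<^sup>2"
      by (intro power_mono) (auto simp: sum_distrib_left)
    also have "\<dots> = K\<^sup>2 * (\<Sum>s<2^k. 1 * norm (coord f (upd i k s)))\<^sup>2"
      by (rule power_mult_distrib)
    also have "\<dots> \<le> K\<^sup>2 * ((\<Sum>s<(2::nat)^k. 1\<^sup>2) * (\<Sum>s<2^k. (norm (coord f (upd i k s)))\<^sup>2))"
      by (intro mult_left_mono Cauchy_Schwarz_ineq_sum) simp
    finally show ?thesis by simp
  qed
  then have "(\<Sum>i\<in>A. (norm (\<Sum>s<2^k. a $$ (digit i k, s) * coord f (upd i k s)))\<^sup>2)
      \<le> (\<Sum>i\<in>A. K\<^sup>2 * (2 ^ k * (\<Sum>s<2^k. (norm (coord f (upd i k s)))\<^sup>2)))"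
    by (rule sum_mono)
  also have "\<dots> = K\<^sup>2 * (2 ^ k * (\<Sum>s<2^k. \<Sum>i\<in>A. (norm (coord f (upd i k s)))\<^sup>2))"
    by (subst sum.swap) (simp add: sum_distrib_left)
  also have "\<dots> \<le> K\<^sup>2 * (2 ^ k * (\<Sum>s<(2::nat)^k. 2 ^ k * (norm f)\<^sup>2))"
    by (intro mult_left_mono sum_mono sum_upd_le A sum_le_norm_ell2) auto
  also have "\<dots> = K\<^sup>2 * (norm f)\<^sup>2 * (2 ^ k * 2 ^ k * 2 ^ k)" by simp
  also have "\<dots> \<le> K\<^sup>2 * (norm f)\<^sup>2 * (2 ^ k * 2 ^ k * 2 ^ k * 2 ^ k)"
    by (intro mult_left_mono) auto
  also have "\<dots> = (norm f * (K * 2 ^ k * 2 ^ k))\<^sup>2" by (simp add: power2_eq_square algebra_simps)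
  finally show ?thesis .
qed

(* The operator 1 \<otimes> ... \<otimes> 1 \<otimes> a \<otimes> 1 \<otimes> ... with a in the k-th place. *)
lift_definition factor_fun :: "nat \<Rightarrow> complex mat \<Rightarrow> multi_index ell2 \<Rightarrow> multi_index ell2"
  is "\<lambda>k a f i. \<Sum>s<2^k. a $$ (digit i k, s) * f (upd i k s)"
  subgoal premises p for k a f
  proof -
    have "coord (Abs_ell2 f) = f" using p by (simp add: Abs_ell2_inverse)
    then show ?thesis
      using ell2_boundI(1)[OF factor_bound[where f = "Abs_ell2 f" and a = a and k = k]]
      by (simp add: mult_nonneg_nonneg sum_nonneg)
  qed
  done

lift_definition factor_op :: "nat \<Rightarrow> complex mat \<Rightarrow> multi_index ell2 \<Rightarrow>\<^sub>L multi_index ell2"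
  is factor_fun
  subgoal for k a
  proof (rule bounded_linear_intro)
    show "factor_fun k a (x + y) = factor_fun k a x + factor_fun k a y" for x y
      by (rule ell2_eqI) (simp add: factor_fun.rep_eq plus_ell2.rep_eq algebra_simps sum.distrib)
    show "factor_fun k a (r *\<^sub>R x) = r *\<^sub>R factor_fun k a x" for r x
      by (rule ell2_eqI) (simp add: factor_fun.rep_eq scaleR_ell2.rep_eq algebra_simps scaleR_sum_right)
    show "norm (factor_fun k a x) \<le>
        norm x * ((\<Sum>r<2^k. \<Sum>s<2^k. norm (a $$ (r, s))) * 2 ^ k * 2 ^ k)" for x
      unfolding factor_fun_def
      by (simp, rule ell2_boundI(2)) (use factor_bound in \<open>auto intro!: mult_nonneg_nonneg sum_nonneg\<close>)
  qed
  done

lemma infsum_finite_sum: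
  fixes F :: "'b \<Rightarrow> 'i \<Rightarrow> real"
  assumes "finite S" "\<And>s. s \<in> S \<Longrightarrow> F s summable_on A"
  shows "(\<Sum>\<^sub>\<infinity>i\<in>A. \<Sum>s\<in>S. F s i) = (\<Sum>s\<in>S. infsum (F s) A)
    \<and> (\<lambda>i. \<Sum>s\<in>S. F s i) summable_on A"
  using assms by (induction S) (auto simp: infsum_add summable_on_add)

lemma bij_betw_upd:
  assumes "r < 2 ^ k" "s < 2 ^ k"
  shows "bij_betw (\<lambda>i. upd i k s) {i. digit i k = r} {i. digit i k = s}"
  by (rule bij_betw_byWitness[where f' = "\<lambda>i. upd i k r"])
    (use assms upd_same in \<open>auto simp: upd_upd digit_upd\<close>)

lemma inner_factor_op:
  "inner (factor_op k a f) g = (\<Sum>r<2^k. \<Sum>s<2^k.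
     \<Sum>\<^sub>\<infinity>i\<in>{i. digit i k = r}. inner (a $$ (r, s) * coord f (upd i k s)) (coord g i))"
proof -
  have sq: "(\<lambda>i. (norm (coord h i))\<^sup>2) summable_on A" for h :: "multi_index ell2" and A
    by (rule summable_on_subset[OF ell2_summable]) simp
  have summ: "(\<lambda>i. inner (c * coord f (upd i k s)) (coord g i)) summable_on {i. digit i k = r}"
    if "r < 2 ^ k" "s < 2 ^ k" for r s c
  proof (rule inner_summable_on)
    have "(\<lambda>i. (norm (coord f (upd i k s)))\<^sup>2) summable_on {i. digit i k = r}"
      using summable_on_reindex_bij_betw[OF bij_betw_upd[OF that], of "\<lambda>i. (norm (coord f i))\<^sup>2"] sq
      by simp
    then show "(\<lambda>i. (norm (c * coord f (upd i k s)))\<^sup>2) summable_on {i. digit i k = r}"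
      by (simp add: norm_mult power_mult_distrib summable_on_cmult_right)
  qed (rule sq)
  have U: "UNIV = (\<Union>r<2^k. {i. digit i k = r})" using digit_less by auto
  have "inner (factor_op k a f) g
      = (\<Sum>\<^sub>\<infinity>i\<in>(\<Union>r<2^k. {i. digit i k = r}). inner (coord (factor_op k a f) i) (coord g i))"
    unfolding inner_ell2_def U[symmetric] ..
  also have "\<dots> = (\<Sum>r<2^k. \<Sum>\<^sub>\<infinity>i\<in>{i. digit i k = r}. inner (coord (factor_op k a f) i) (coord g i))"
    by (rule sum_infsum[symmetric])
      (auto intro: summable_on_subset[OF inner_summable])
  also have "\<dots> = (\<Sum>r<2^k. \<Sum>\<^sub>\<infinity>i\<in>{i. digit i k = r}.
      \<Sum>s<2^k. inner (a $$ (r, s) * coord f (upd i k s)) (coord g i))"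
    by (intro sum.cong refl infsum_cong)
      (auto simp: factor_op.rep_eq factor_fun.rep_eq inner_sum_left)
  also have "\<dots> = (\<Sum>r<2^k. \<Sum>s<2^k.
      \<Sum>\<^sub>\<infinity>i\<in>{i. digit i k = r}. inner (a $$ (r, s) * coord f (upd i k s)) (coord g i))"
    by (intro sum.cong refl infsum_finite_sum[THEN conjunct1]) (auto intro: summ)
  finally show ?thesis .
qed

lemma mat_adjoint_index:
  assumes "a \<in> carrier_mat n n" "i < n" "j < n"
  shows "mat_adjoint a $$ (i, j) = cnj (a $$ (j, i))"
  using assms by (simp add: mat_adjoint_def mat_of_rows_index)

lemma factor_op_adjoint:
  assumes a: "a \<in> carrier_mat (2 ^ k) (2 ^ k)"
  shows "inner (factor_op k a f) g = inner f (factor_op k (mat_adjoint a) g)"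
proof -
  have "inner (factor_op k a f) g = (\<Sum>r<2^k. \<Sum>s<2^k.
      \<Sum>\<^sub>\<infinity>j\<in>{j. digit j k = s}. inner (mat_adjoint a $$ (s, r) * coord g (upd j k r)) (coord f j))"
  proof (unfold inner_factor_op, intro sum.cong refl)
    fix r s :: nat assume rs: "r \<in> {..<2^k}" "s \<in> {..<2^k}"
    have "(\<Sum>\<^sub>\<infinity>i\<in>{i. digit i k = r}. inner (a $$ (r, s) * coord f (upd i k s)) (coord g i))
        = (\<Sum>\<^sub>\<infinity>j\<in>{j. digit j k = s}.
            inner (a $$ (r, s) * coord f (upd (upd j k r) k s)) (coord g (upd j k r)))"
      by (rule infsum_reindex_bij_betw[symmetric]) (use bij_betw_upd rs in auto)
    also have "\<dots> = (\<Sum>\<^sub>\<infinity>j\<in>{j. digit j k = s}.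
        inner (mat_adjoint a $$ (s, r) * coord g (upd j k r)) (coord f j))"
    proof (rule infsum_cong)
      fix j assume "j \<in> {j. digit j k = s}"
      then have "upd (upd j k r) k s = j" using rs upd_same[of j k] by (auto simp: upd_upd)
      then show "inner (a $$ (r, s) * coord f (upd (upd j k r) k s)) (coord g (upd j k r))
          = inner (mat_adjoint a $$ (s, r) * coord g (upd j k r)) (coord f j)"
        using rs a by (simp add: mat_adjoint_index inner_complex_def algebra_simps)
    qed
    finally show "(\<Sum>\<^sub>\<infinity>i\<in>{i. digit i k = r}. inner (a $$ (r, s) * coord f (upd i k s)) (coord g i))
        = (\<Sum>\<^sub>\<infinity>j\<in>{j. digit j k = s}. inner (mat_adjoint a $$ (s, r) * coord g (upd j k r)) (coord f j))" .
  qed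
  also have "\<dots> = inner (factor_op k (mat_adjoint a) g) f"
    unfolding inner_factor_op by (rule sum.swap)
  finally show ?thesis by (simp add: inner_commute)
qed

lemma coord_factor_op:
  "coord (factor_op k a f) i = (\<Sum>s<2^k. a $$ (digit i k, s) * coord f (upd i k s))"
  by (simp add: factor_op.rep_eq factor_fun.rep_eq)

lemma coord_cscale_op: "coord (cscale_op c f) i = c * coord f i"
  by (simp add: cscale_op.rep_eq cscale.rep_eq)

lemma factor_op_scalar: "factor_op k (c \<cdot>\<^sub>m 1\<^sub>m (2 ^ k)) = cscale_op c"
proof (rule blinfun_eqI, rule ell2_eqI)
  fix f i
  have "coord (factor_op k (c \<cdot>\<^sub>m 1\<^sub>m (2 ^ k)) f) i
      = (\<Sum>s<2^k. if s = digit i k then c * coord f (upd i k s) else 0)"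
    unfolding coord_factor_op by (rule sum.cong) (use digit_less in auto)
  then show "coord (factor_op k (c \<cdot>\<^sub>m 1\<^sub>m (2 ^ k)) f) i = coord (cscale_op c f) i"
    by (simp add: coord_cscale_op digit_less upd_same)
qed

(* The algebraic infinite tensor product of the matrix algebras of size 2^k, k >= 1, represented
   on the Hilbert space above: the algebra generated by the elementary tensors with one
   nontrivial factor. It contains the scalars (cscale_op_local) and is closed under adjoints
   (local_adjoint). *)
inductive_set local_ops :: "(multi_index ell2 \<Rightarrow>\<^sub>L multi_index ell2) set" where
  factor: "k \<ge> 1 \<Longrightarrow> a \<in> carrier_mat (2 ^ k) (2 ^ k) \<Longrightarrow> factor_op k a \<in> local_ops"
| add: "S \<in> local_ops \<Longrightarrow> T \<in> local_ops \<Longrightarrow> S + T \<in> local_ops"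
| compose: "S \<in> local_ops \<Longrightarrow> T \<in> local_ops \<Longrightarrow> S o\<^sub>L T \<in> local_ops"

lemma cscale_op_local: "cscale_op c \<in> local_ops"
  using local_ops.factor[of 1 "c \<cdot>\<^sub>m 1\<^sub>m 2"] factor_op_scalar[of 1 c] by simp

lemma blinfun_compose_assoc: "(S o\<^sub>L T) o\<^sub>L U = S o\<^sub>L (T o\<^sub>L U)"
  by (rule blinfun_eqI) simp

lemma closure_local_compose:
  assumes "S \<in> closure local_ops" "T \<in> closure local_ops"
  shows "S o\<^sub>L T \<in> closure local_ops"
proof -
  obtain X Y where "\<And>n. X n \<in> local_ops" "X \<longlonglongrightarrow> S" "\<And>n. Y n \<in> local_ops" "Y \<longlonglongrightarrow> T"
    using assms unfolding closure_sequential by blast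
  then show ?thesis unfolding closure_sequential
    by (intro exI[of _ "\<lambda>n. X n o\<^sub>L Y n"])
      (auto intro: local_ops.compose bounded_bilinear.tendsto[OF bounded_bilinear_blinfun_compose])
qed

lemma closure_local_add:
  assumes "S \<in> closure local_ops" "T \<in> closure local_ops"
  shows "S + T \<in> closure local_ops"
proof -
  obtain X Y where "\<And>n. X n \<in> local_ops" "X \<longlonglongrightarrow> S" "\<And>n. Y n \<in> local_ops" "Y \<longlonglongrightarrow> T"
    using assms unfolding closure_sequential by blast
  then show ?thesis unfolding closure_sequential
    by (intro exI[of _ "\<lambda>n. X n + Y n"]) (auto intro: local_ops.add tendsto_add)
qed

lemma cscale_op_of_real: "cscale_op (of_real r) = r *\<^sub>R id_blinfun"
  by (intro blinfun_eqI ell2_eqI)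
    (simp add: coord_cscale_op scaleR_ell2.rep_eq scaleR_blinfun.rep_eq scaleR_conv_of_real)

lemma cscale_op_closure: "cscale_op c \<in> closure local_ops"
  using cscale_op_local closure_subset by blast

lemma closure_local_scaleR:
  assumes "T \<in> closure local_ops"
  shows "r *\<^sub>R T \<in> closure local_ops"
proof -
  have "r *\<^sub>R T = cscale_op (of_real r) o\<^sub>L T"
    unfolding cscale_op_of_real by (rule blinfun_eqI) (simp add: scaleR_blinfun.rep_eq)
  then show ?thesis using closure_local_compose[OF cscale_op_closure assms] by simp
qed

lemma cscale_op_commute:
  assumes "T \<in> closure local_ops"
  shows "cscale_op c o\<^sub>L T = T o\<^sub>L cscale_op c"
proof -
  have L: "cscale_op c o\<^sub>L S = S o\<^sub>L cscale_op c" if "S \<in> local_ops" for S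
    using that
  proof induction
    case (factor k a)
    show ?case
      by (intro blinfun_eqI ell2_eqI)
        (simp add: coord_cscale_op coord_factor_op sum_distrib_left algebra_simps)
  next
    case (add S T)
    then show ?case
      by (simp add: bounded_bilinear.add_left[OF bounded_bilinear_blinfun_compose]
          bounded_bilinear.add_right[OF bounded_bilinear_blinfun_compose])
  next
    case (compose S T)
    then show ?case by (metis blinfun_compose_assoc)
  qed
  obtain X where X: "\<And>n. X n \<in> local_ops" "X \<longlonglongrightarrow> T"
    using assms unfolding closure_sequential by blast
  have "(\<lambda>n. cscale_op c o\<^sub>L X n) \<longlonglongrightarrow> (cscale_op c o\<^sub>L T)"
    "(\<lambda>n. X n o\<^sub>L cscale_op c) \<longlonglongrightarrow> (T o\<^sub>L cscale_op c)"
    by (intro bounded_bilinear.tendsto[OF bounded_bilinear_blinfun_compose] X tendsto_const)+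
  then show ?thesis using L[OF X(1)] LIMSEQ_unique by auto
qed

definition adjoint_pair :: "('i ell2 \<Rightarrow>\<^sub>L 'i ell2) \<Rightarrow> ('i ell2 \<Rightarrow>\<^sub>L 'i ell2) \<Rightarrow> bool" where
  "adjoint_pair S T \<longleftrightarrow> (\<forall>f g. inner (S f) g = inner f (T g))"

lemma adjoint_pair_sym: "adjoint_pair S T \<Longrightarrow> adjoint_pair T S"
  unfolding adjoint_pair_def by (metis inner_commute)

lemma adjoint_pair_unique: "adjoint_pair S T \<Longrightarrow> adjoint_pair S T' \<Longrightarrow> T = T'"
  unfolding adjoint_pair_def by (intro blinfun_eqI) (metis inner_commute vector_eq_rdot)

lemma adjoint_pair_norm_le:
  assumes "adjoint_pair S T"
  shows "norm T \<le> norm S"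
proof (rule norm_blinfun_bound)
  fix g
  have "norm (T g) * norm (T g) = inner (T g) (T g)"
    by (simp add: power2_norm_eq_inner[symmetric] power2_eq_square)
  also have "\<dots> = inner (S (T g)) g" using assms by (simp add: adjoint_pair_def)
  also have "\<dots> \<le> norm (S (T g)) * norm g" by (rule norm_cauchy_schwarz)
  also have "\<dots> \<le> (norm S * norm (T g)) * norm g" by (intro mult_right_mono norm_blinfun) simp
  finally have "norm (T g) * norm (T g) \<le> norm (T g) * (norm S * norm g)" by (simp only: ac_simps)
  then show "norm (T g) \<le> norm S * norm g"
    by (cases "T g = 0") simp_all
qed simp

lemma adjoint_pair_add:
  "adjoint_pair S S' \<Longrightarrow> adjoint_pair T T' \<Longrightarrow> adjoint_pair (S + T) (S' + T')"
  by (simp add: adjoint_pair_def plus_blinfun.rep_eq inner_add_left inner_add_right)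

lemma adjoint_pair_diff:
  "adjoint_pair S S' \<Longrightarrow> adjoint_pair T T' \<Longrightarrow> adjoint_pair (S - T) (S' - T')"
  by (simp add: adjoint_pair_def minus_blinfun.rep_eq inner_diff_left inner_diff_right)

lemma adjoint_pair_compose:
  "adjoint_pair S S' \<Longrightarrow> adjoint_pair T T' \<Longrightarrow> adjoint_pair (S o\<^sub>L T) (T' o\<^sub>L S')"
  by (simp add: adjoint_pair_def)

lemma adjoint_pair_cscale: "adjoint_pair (cscale_op c) (cscale_op (cnj c))"
  unfolding adjoint_pair_def inner_ell2_def
  by (intro allI infsum_cong) (simp add: coord_cscale_op inner_complex_def algebra_simps)

lemma local_adjoint: "S \<in> local_ops \<Longrightarrow> \<exists>T\<in>local_ops. adjoint_pair S T"
proof (induction rule: local_ops.induct)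
  case (factor k a)
  moreover have "mat_adjoint a \<in> carrier_mat (2 ^ k) (2 ^ k)"
    using factor(2) by (auto simp: mat_adjoint_def)
  ultimately show ?case
    by (intro bexI[of _ "factor_op k (mat_adjoint a)"] local_ops.factor)
      (auto simp: adjoint_pair_def factor_op_adjoint)
next
  case (add S T)
  then show ?case using adjoint_pair_add local_ops.add by blast
next
  case (compose S T)
  then show ?case using adjoint_pair_compose local_ops.compose by blast
qed

lemma closure_local_adjoint:
  assumes "S \<in> closure local_ops"
  shows "\<exists>T\<in>closure local_ops. adjoint_pair S T"
proof -
  obtain X where X: "\<And>n. X n \<in> local_ops" "X \<longlonglongrightarrow> S"
    using assms unfolding closure_sequential by blast
  from local_adjoint[OF X(1)] obtain Y where Y: "\<And>n. Y n \<in> local_ops" "\<And>n. adjoint_pair (X n) (Y n)"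
    by metis
  have "Cauchy X" using X(2) by (rule LIMSEQ_imp_Cauchy)
  have le: "norm (Y m - Y n) \<le> norm (X m - X n)" for m n
    by (intro adjoint_pair_norm_le adjoint_pair_diff Y)
  have "Cauchy Y"
    unfolding Cauchy_def dist_norm
  proof (intro allI impI)
    fix e :: real assume "e > 0"
    then obtain M where "\<And>m n. m \<ge> M \<Longrightarrow> n \<ge> M \<Longrightarrow> norm (X m - X n) < e"
      using \<open>Cauchy X\<close> unfolding Cauchy_def dist_norm by meson
    then show "\<exists>M. \<forall>m\<ge>M. \<forall>n\<ge>M. norm (Y m - Y n) < e"
      using le by (intro exI[of _ M] allI impI) (rule le_less_trans)
  qed
  then have "convergent Y" by (rule Cauchy_convergent)
  then obtain T where T: "Y \<longlonglongrightarrow> T" unfolding convergent_def ..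
  have "inner (S f) g = inner f (T g)" for f g
  proof (rule LIMSEQ_unique)
    show "(\<lambda>n. inner (X n f) g) \<longlonglongrightarrow> inner (S f) g"
      by (intro tendsto_inner blinfun.tendsto X tendsto_const)
    show "(\<lambda>n. inner (X n f) g) \<longlonglongrightarrow> inner f (T g)"
      unfolding Y(2)[unfolded adjoint_pair_def, rule_format]
      by (intro tendsto_inner blinfun.tendsto T tendsto_const)
  qed
  then have "adjoint_pair S T" by (simp add: adjoint_pair_def)
  moreover have "T \<in> closure local_ops" unfolding closure_sequential using Y(1) T by blast
  ultimately show ?thesis by blast
qed

subsection \<open>Unital C*-algebras and the infinite tensor product\<close>

class unital_cstar_algebra = banach + real_normed_algebra_1 +
  fixes scaleC :: "complex \<Rightarrow> 'a \<Rightarrow> 'a" (infixr "*\<^sub>C" 75)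
    and star :: "'a \<Rightarrow> 'a"
  assumes scaleC_add_right: "c *\<^sub>C (x + y) = c *\<^sub>C x + c *\<^sub>C y"
    and scaleC_add_left: "(c + d) *\<^sub>C x = c *\<^sub>C x + d *\<^sub>C x"
    and scaleC_scaleC: "c *\<^sub>C d *\<^sub>C x = (c * d) *\<^sub>C x"
    and scaleC_of_real: "complex_of_real r *\<^sub>C x = r *\<^sub>R x"
    and mult_scaleC_left: "(c *\<^sub>C x) * y = c *\<^sub>C (x * y)"
    and mult_scaleC_right: "x * (c *\<^sub>C y) = c *\<^sub>C (x * y)"
    and norm_scaleC: "norm (c *\<^sub>C x) = norm c * norm x"
    and star_star: "star (star x) = x"
    and star_add: "star (x + y) = star x + star y"
    and star_scaleC: "star (c *\<^sub>C x) = cnj c *\<^sub>C star x"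
    and star_mult: "star (x * y) = star y * star x"
    and cstar_identity: "norm (star x * x) = (norm x)\<^sup>2"

(* The representation is faithful and each finite tensor product of matrix algebras carries the
   operator norm, so the norm closure is the C*-algebraic infinite tensor product of the matrix
   algebras of size 2^k, k >= 1. *)
typedef uhf = "closure local_ops" morphisms rep_uhf Abs_uhf
  using cscale_op_closure by blast

setup_lifting type_definition_uhf

lemma id_closure: "id_blinfun \<in> closure local_ops"
  using cscale_op_closure[of 1] by (simp add: cscale_op_of_real[of 1, simplified])

lemma closure_local_uminus:
  assumes "T \<in> closure local_ops" shows "- T \<in> closure local_ops"
  using closure_local_scaleR[OF assms, of "-1"] by simp

lemma closure_local_diff:
  assumes "S \<in> closure local_ops" "T \<in> closure local_ops" shows "S - T \<in> closure local_ops"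
  using closure_local_add[OF assms(1) closure_local_uminus[OF assms(2)]] by simp

lemma zero_closure: "0 \<in> closure local_ops"
  using closure_local_scaleR[OF id_closure, of 0] by simp

lemma norm_id_multi_index: "norm (id_blinfun :: multi_index ell2 \<Rightarrow>\<^sub>L multi_index ell2) = 1"
proof (rule antisym)
  show "norm (id_blinfun :: multi_index ell2 \<Rightarrow>\<^sub>L multi_index ell2) \<le> 1"
    by (rule norm_blinfun_bound) simp_all
  fix i0 :: multi_index
  define f where "f = Abs_ell2 (\<lambda>i. if i = i0 then 1 else 0)"
  have "(\<lambda>i. (norm (if i = i0 then 1 else 0 :: complex))\<^sup>2) summable_on UNIV"
    by (rule finite_nonzero_values_imp_summable_on) (auto intro: finite_subset[of _ "{i0}"])
  then have "coord f i0 = 1" by (simp add: f_def Abs_ell2_inverse)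
  then have "norm f > 0" by (auto simp: zero_ell2.rep_eq)
  moreover have "norm f \<le> norm (id_blinfun :: multi_index ell2 \<Rightarrow>\<^sub>L multi_index ell2) * norm f"
    using norm_blinfun[of id_blinfun f] by simp
  ultimately show "1 \<le> norm (id_blinfun :: multi_index ell2 \<Rightarrow>\<^sub>L multi_index ell2)"
    by (simp add: mult_le_cancel_right)
qed

(* For complex-linear operators the adjoint with respect to the real part of the inner product
   is the usual one. *)
definition adjoint_op :: "(multi_index ell2 \<Rightarrow>\<^sub>L multi_index ell2) \<Rightarrow> (multi_index ell2 \<Rightarrow>\<^sub>L multi_index ell2)"
  where "adjoint_op T = Blinfun (adjoint T)"

lemma adjoint_op_eqI:
  assumes "adjoint_pair S T" shows "adjoint_op S = T"
proof -
  have "adjoint (blinfun_apply S) = blinfun_apply T"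
    by (rule adjoint_unique) (use assms in \<open>simp add: adjoint_pair_def\<close>)
  then show ?thesis by (simp add: adjoint_op_def blinfun_apply_inverse)
qed

lemma adjoint_op:
  assumes "T \<in> closure local_ops"
  shows "adjoint_op T \<in> closure local_ops" "adjoint_pair T (adjoint_op T)"
  using closure_local_adjoint[OF assms] adjoint_op_eqI by auto

instantiation uhf :: real_vector
begin
lift_definition zero_uhf :: uhf is 0 by (rule zero_closure)
lift_definition plus_uhf :: "uhf \<Rightarrow> uhf \<Rightarrow> uhf" is "(+)" by (rule closure_local_add)
lift_definition uminus_uhf :: "uhf \<Rightarrow> uhf" is uminus by (rule closure_local_uminus)
lift_definition minus_uhf :: "uhf \<Rightarrow> uhf \<Rightarrow> uhf" is "(-)" by (rule closure_local_diff)
lift_definition scaleR_uhf :: "real \<Rightarrow> uhf \<Rightarrow> uhf" is scaleR by (rule closure_local_scaleR)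
instance
proof
  fix x y z :: uhf and a b :: real
  show "x + y + z = x + (y + z)" by transfer (rule add.assoc)
  show "x + y = y + x" by transfer (rule add.commute)
  show "0 + x = x" by transfer simp
  show "- x + x = 0" by transfer simp
  show "x - y = x + - y" by transfer simp
  show "a *\<^sub>R (x + y) = a *\<^sub>R x + a *\<^sub>R y" by transfer (rule scaleR_add_right)
  show "(a + b) *\<^sub>R x = a *\<^sub>R x + b *\<^sub>R x" by transfer (rule scaleR_add_left)
  show "a *\<^sub>R b *\<^sub>R x = (a * b) *\<^sub>R x" by transfer simp
  show "1 *\<^sub>R x = x" by transfer simp
qed
end

instantiation uhf :: real_normed_vector
begin
lift_definition norm_uhf :: "uhf \<Rightarrow> real" is norm .
definition dist_uhf :: "uhf \<Rightarrow> uhf \<Rightarrow> real" where "dist_uhf x y = norm (x - y)"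
definition sgn_uhf :: "uhf \<Rightarrow> uhf" where "sgn_uhf x = x /\<^sub>R norm x"
definition uniformity_uhf :: "(uhf \<times> uhf) filter"
  where "uniformity_uhf = (INF e\<in>{0<..}. principal {(x, y). dist x y < e})"
definition open_uhf :: "uhf set \<Rightarrow> bool"
  where "open_uhf U \<longleftrightarrow> (\<forall>x\<in>U. \<forall>\<^sub>F (x', y) in uniformity. x' = x \<longrightarrow> y \<in> U)"
instance
proof
  fix x y :: uhf and a :: real
  show "(norm x = 0) = (x = 0)" by transfer simp
  show "norm (x + y) \<le> norm x + norm y" by transfer (rule norm_triangle_ineq)
  show "norm (a *\<^sub>R x) = \<bar>a\<bar> * norm x" by transfer simp
qed (rule dist_uhf_def sgn_uhf_def uniformity_uhf_def open_uhf_def)+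
end

lemma dist_rep_uhf: "dist (rep_uhf x) (rep_uhf y) = dist x y"
  by (simp add: dist_norm norm_uhf.rep_eq minus_uhf.rep_eq)

instance uhf :: complete_space
proof
  fix X :: "nat \<Rightarrow> uhf"
  assume "Cauchy X"
  then have "Cauchy (\<lambda>n. rep_uhf (X n))"
    by (simp add: Cauchy_def dist_rep_uhf)
  then have "convergent (\<lambda>n. rep_uhf (X n))" by (rule Cauchy_convergent)
  then obtain T where T: "(\<lambda>n. rep_uhf (X n)) \<longlonglongrightarrow> T" unfolding convergent_def ..
  have "T \<in> closure local_ops"
    using closed_sequentially[OF closed_closure rep_uhf T] .
  then have "(\<lambda>n. rep_uhf (X n)) \<longlonglongrightarrow> rep_uhf (Abs_uhf T)" using T by (simp add: Abs_uhf_inverse)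
  then have "X \<longlonglongrightarrow> Abs_uhf T" by (simp add: lim_sequentially dist_rep_uhf)
  then show "convergent X" by (auto simp: convergent_def)
qed

instantiation uhf :: unital_cstar_algebra
begin
lift_definition one_uhf :: uhf is id_blinfun by (rule id_closure)
lift_definition times_uhf :: "uhf \<Rightarrow> uhf \<Rightarrow> uhf" is "(o\<^sub>L)" by (rule closure_local_compose)
lift_definition scaleC_uhf :: "complex \<Rightarrow> uhf \<Rightarrow> uhf" is "\<lambda>c T. cscale_op c o\<^sub>L T"
  by (intro closure_local_compose cscale_op_closure)
lift_definition star_uhf :: "uhf \<Rightarrow> uhf" is adjoint_op by (rule adjoint_op)

instance
proof
  note bil = bounded_bilinear_blinfun_compose
  fix x y z :: uhf and c d :: complex and r :: real
  show "x * y * z = x * (y * z)" by transfer (rule blinfun_compose_assoc)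
  show "(x + y) * z = x * z + y * z" by transfer (rule bounded_bilinear.add_left[OF bil])
  show "x * (y + z) = x * y + x * z" by transfer (rule bounded_bilinear.add_right[OF bil])
  show "r *\<^sub>R x * y = r *\<^sub>R (x * y)" by transfer (rule bounded_bilinear.scaleR_left[OF bil])
  show "x * r *\<^sub>R y = r *\<^sub>R (x * y)" by transfer (rule bounded_bilinear.scaleR_right[OF bil])
  show "1 * x = x" by transfer (rule blinfun_eqI, simp)
  show "x * 1 = x" by transfer (rule blinfun_eqI, simp)
  show n1: "norm (1 :: uhf) = 1" by transfer (rule norm_id_multi_index)
  show "(0 :: uhf) \<noteq> 1" using n1 by (metis norm_zero zero_neq_one)
  show "norm (x * y) \<le> norm x * norm y" by transfer (rule norm_blinfun_compose)
  show "c *\<^sub>C (x + y) = c *\<^sub>C x + c *\<^sub>C y" by transfer (rule bounded_bilinear.add_right[OF bil])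
  have "cscale_op (c + d) = (cscale_op c + cscale_op d :: multi_index ell2 \<Rightarrow>\<^sub>L _)"
    by (intro blinfun_eqI ell2_eqI)
      (simp add: coord_cscale_op plus_blinfun.rep_eq plus_ell2.rep_eq algebra_simps)
  then show "(c + d) *\<^sub>C x = c *\<^sub>C x + d *\<^sub>C x"
    by transfer (simp add: bounded_bilinear.add_left[OF bil])
  have cc: "cscale_op c o\<^sub>L cscale_op d = (cscale_op (c * d) :: multi_index ell2 \<Rightarrow>\<^sub>L _)" for c d
    by (intro blinfun_eqI ell2_eqI) (simp add: coord_cscale_op)
  then show "c *\<^sub>C d *\<^sub>C x = (c * d) *\<^sub>C x"
    by transfer (simp add: blinfun_compose_assoc[symmetric])
  have rr: "complex_of_real r *\<^sub>C x = r *\<^sub>R x" for r and x :: uhf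
    by transfer (rule blinfun_eqI, simp add: cscale_op_of_real scaleR_blinfun.rep_eq)
  then show "complex_of_real r *\<^sub>C x = r *\<^sub>R x" .
  show "c *\<^sub>C x * y = c *\<^sub>C (x * y)" by transfer (rule blinfun_compose_assoc)
  show "x * c *\<^sub>C y = c *\<^sub>C (x * y)"
    by transfer (simp add: blinfun_compose_assoc[symmetric] cscale_op_commute)
  show "star (star x) = x"
    by transfer (rule adjoint_op_eqI[OF adjoint_pair_sym[OF adjoint_op(2)]])
  show "star (x + y) = star x + star y"
    by transfer (intro adjoint_op_eqI adjoint_pair_add adjoint_op)
  show st: "star (c *\<^sub>C x) = cnj c *\<^sub>C star x" for c and x :: uhf
  proof transfer
    fix c T assume T: "T \<in> closure local_ops"
    have "adjoint_pair (T o\<^sub>L cscale_op c) (cscale_op (cnj c) o\<^sub>L adjoint_op T)"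
      by (intro adjoint_pair_compose adjoint_pair_cscale adjoint_op T)
    then show "adjoint_op (cscale_op c o\<^sub>L T) = cscale_op (cnj c) o\<^sub>L adjoint_op T"
      by (simp add: adjoint_op_eqI cscale_op_commute T)
  qed
  show "star (x * y) = star y * star x"
    by transfer (intro adjoint_op_eqI adjoint_pair_compose adjoint_op)
  show id: "norm (star x * x) = (norm x)\<^sup>2" for x :: uhf
  proof transfer
    fix T assume T: "T \<in> closure local_ops"
    let ?S = "adjoint_op T"
    have adj: "adjoint_pair T ?S" by (rule adjoint_op(2)[OF T])
    have "norm (?S o\<^sub>L T) \<le> norm ?S * norm T" by (rule norm_blinfun_compose)
    also have "\<dots> \<le> norm T * norm T" by (intro mult_right_mono adjoint_pair_norm_le adj) simp
    finally have le: "norm (?S o\<^sub>L T) \<le> (norm T)\<^sup>2" by (simp add: power2_eq_square)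
    have "norm T \<le> sqrt (norm (?S o\<^sub>L T))"
    proof (rule norm_blinfun_bound)
      fix f
      have "(norm (T f))\<^sup>2 = inner f (?S (T f))"
        using adj by (simp add: adjoint_pair_def power2_norm_eq_inner)
      also have "\<dots> \<le> norm f * norm ((?S o\<^sub>L T) f)" using norm_cauchy_schwarz by simp
      also have "\<dots> \<le> norm f * (norm (?S o\<^sub>L T) * norm f)" by (intro mult_left_mono norm_blinfun) simp
      also have "\<dots> = (sqrt (norm (?S o\<^sub>L T)) * norm f)\<^sup>2" by (simp add: power_mult_distrib) (simp add: power2_eq_square)
      finally show "norm (T f) \<le> sqrt (norm (?S o\<^sub>L T)) * norm f"
        by (rule power2_le_imp_le) simp
    qed simp
    then have "(norm T)\<^sup>2 \<le> (sqrt (norm (?S o\<^sub>L T)))\<^sup>2" by (rule power_mono) simp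
    with le show "norm (?S o\<^sub>L T) = (norm T)\<^sup>2" by simp
  qed
  show "norm (c *\<^sub>C x) = norm c * norm x"
  proof -
    have ml: "c *\<^sub>C x * y = c *\<^sub>C (x * y)" for c and x y :: uhf by transfer (rule blinfun_compose_assoc)
    have mr: "x * c *\<^sub>C y = c *\<^sub>C (x * y)" for c and x y :: uhf
      by transfer (simp add: blinfun_compose_assoc[symmetric] cscale_op_commute)
    have sc: "c *\<^sub>C d *\<^sub>C x = (c * d) *\<^sub>C x" for c d and x :: uhf
      using cc by transfer (simp add: blinfun_compose_assoc[symmetric])
    have "(norm (c *\<^sub>C x))\<^sup>2 = norm (star (c *\<^sub>C x) * c *\<^sub>C x)" by (simp only: id)
    also have "star (c *\<^sub>C x) * c *\<^sub>C x = (cnj c * c) *\<^sub>C (star x * x)"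
      by (simp only: st ml mr sc mult.commute[of c "cnj c"])
    also have "cnj c * c = complex_of_real ((norm c)\<^sup>2)"
      by (subst complex_norm_square) (rule mult.commute)
    also have "norm (complex_of_real ((norm c)\<^sup>2) *\<^sub>C (star x * x)) = (norm c * norm x)\<^sup>2"
      by (simp only: rr norm_scaleR id) (simp add: power_mult_distrib)
    finally show ?thesis by (simp add: power2_eq_iff_nonneg)
  qed
qed
end

subsection \<open>The tracial Rokhlin property\<close>

definition positive :: "'a::unital_cstar_algebra \<Rightarrow> bool" where
  "positive x \<longleftrightarrow> (\<exists>y. x = star y * y)"

definition cstar_le :: "'a::unital_cstar_algebra \<Rightarrow> 'a \<Rightarrow> bool" where
  "cstar_le x y \<longleftrightarrow> positive (y - x)"

definition projection :: "'a::unital_cstar_algebra \<Rightarrow> bool" where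
  "projection p \<longleftrightarrow> star p = p \<and> p * p = p"

definition mvn_equivalent :: "'a::unital_cstar_algebra \<Rightarrow> 'a \<Rightarrow> bool" where
  "mvn_equivalent p q \<longleftrightarrow> (\<exists>v. star v * v = p \<and> v * star v = q)"

definition hereditary_subalgebra :: "'a::unital_cstar_algebra set \<Rightarrow> bool" where
  "hereditary_subalgebra B \<longleftrightarrow>
     closed B \<and> 0 \<in> B \<and>
     (\<forall>x\<in>B. \<forall>y\<in>B. x + y \<in> B \<and> x * y \<in> B) \<and>
     (\<forall>x\<in>B. \<forall>c. c *\<^sub>C x \<in> B) \<and>
     (\<forall>x\<in>B. star x \<in> B) \<and>
     (\<forall>b\<in>B. \<forall>a. positive a \<and> cstar_le a b \<longrightarrow> a \<in> B)"

definition hereditary_subalgebra_generated :: "'a::unital_cstar_algebra \<Rightarrow> 'a set" where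
  "hereditary_subalgebra_generated x = \<Inter> {B. hereditary_subalgebra B \<and> x \<in> B}"

definition simple_cstar :: "'a::unital_cstar_algebra itself \<Rightarrow> bool" where
  "simple_cstar _ \<longleftrightarrow>
     (\<forall>I :: 'a set. closed I \<and> 0 \<in> I \<and> (\<forall>x\<in>I. \<forall>y\<in>I. x + y \<in> I) \<and>
        (\<forall>x\<in>I. \<forall>a. a * x \<in> I \<and> x * a \<in> I) \<longrightarrow> I = {0} \<or> I = UNIV)"

(* For every k, each isometry v in the k x k matrices over the algebra is unitary;
   v i j is the (i, j) entry. *)
definition stably_finite :: "'a::unital_cstar_algebra itself \<Rightarrow> bool" where
  "stably_finite _ \<longleftrightarrow>
     (\<forall>k. \<forall>v :: nat \<Rightarrow> nat \<Rightarrow> 'a.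
        (\<forall>i<k. \<forall>j<k. (\<Sum>l<k. star (v l i) * v l j) = (if i = j then 1 else 0)) \<longrightarrow>
        (\<forall>i<k. \<forall>j<k. (\<Sum>l<k. v i l * star (v j l)) = (if i = j then 1 else 0)))"

definition star_automorphism :: "('a::unital_cstar_algebra \<Rightarrow> 'a) \<Rightarrow> bool" where
  "star_automorphism \<alpha> \<longleftrightarrow> bij \<alpha> \<and>
     (\<forall>x y. \<alpha> (x + y) = \<alpha> x + \<alpha> y) \<and>
     (\<forall>c x. \<alpha> (c *\<^sub>C x) = c *\<^sub>C \<alpha> x) \<and>
     (\<forall>x y. \<alpha> (x * y) = \<alpha> x * \<alpha> y) \<and>
     (\<forall>x. \<alpha> (star x) = star (\<alpha> x))"

(* The standing assumptions on the algebra and on \<alpha> are part of the property. *)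
definition tracial_rokhlin_property :: "nat \<Rightarrow> ('a::unital_cstar_algebra \<Rightarrow> 'a) \<Rightarrow> bool" where
  "tracial_rokhlin_property n \<alpha> \<longleftrightarrow>
     stably_finite TYPE('a) \<and> simple_cstar TYPE('a) \<and> star_automorphism \<alpha> \<and> \<alpha> ^^ n = id \<and>
     (\<forall>(F :: 'a set) (\<epsilon> :: real) (N :: nat) (x :: 'a).
        finite F \<and> \<epsilon> > 0 \<and> positive x \<and> x \<noteq> 0 \<longrightarrow>
        (\<exists>e :: nat \<Rightarrow> 'a.
           (\<forall>j<n. projection (e j)) \<and>
           (\<forall>i<n. \<forall>j<n. i \<noteq> j \<longrightarrow> e i * e j = 0) \<and>
           (\<forall>j. j + 1 < n \<longrightarrow> norm (\<alpha> (e j) - e (j + 1)) < \<epsilon>) \<and>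
           (\<forall>j<n. \<forall>a\<in>F. norm (e j * a - a * e j) < \<epsilon>) \<and>
           (\<exists>q. projection q \<and> q \<in> hereditary_subalgebra_generated x \<and>
                mvn_equivalent (1 - (\<Sum>j<n. e j)) q) \<and>
           (\<forall>j<n. \<exists>f :: nat \<Rightarrow> 'a.
              (\<forall>i<N. projection (f i) \<and> cstar_le (f i) (e j) \<and>
                 mvn_equivalent (f i) (1 - (\<Sum>j<n. e j))) \<and>
              (\<forall>i<N. \<forall>l<N. i \<noteq> l \<longrightarrow> f i * f l = 0))))"

subsection \<open>The automorphism\<close>

(* The value 0 for k = 0 or for matrices of the wrong size is a dummy. *)
lift_definition factor :: "nat \<Rightarrow> complex mat \<Rightarrow> uhf"
  is "\<lambda>k a. if k \<ge> 1 \<and> a \<in> carrier_mat (2 ^ k) (2 ^ k) then factor_op k a else 0"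
  using local_ops.factor closure_subset[of local_ops] zero_closure by auto

(* The infinite tensor product of automorphisms \<theta> k of the matrix algebras. Automorphisms of
   C*-algebras are automatically continuous; continuity is listed so that uniqueness is
   immediate from the density of the elementary tensors. *)
definition is_tensor_automorphism ::
    "(nat \<Rightarrow> complex mat \<Rightarrow> complex mat) \<Rightarrow> (uhf \<Rightarrow> uhf) \<Rightarrow> bool" where
  "is_tensor_automorphism \<theta> \<beta> \<longleftrightarrow> star_automorphism \<beta> \<and> continuous_on UNIV \<beta> \<and>
     (\<forall>k\<ge>1. \<forall>a\<in>carrier_mat (2 ^ k) (2 ^ k). \<beta> (factor k a) = factor k (\<theta> k a))"

definition tensor_automorphism :: "(nat \<Rightarrow> complex mat \<Rightarrow> complex mat) \<Rightarrow> uhf \<Rightarrow> uhf" where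
  "tensor_automorphism \<theta> = (THE \<beta>. is_tensor_automorphism \<theta> \<beta>)"

definition Ad :: "complex mat \<Rightarrow> complex mat \<Rightarrow> complex mat" where
  "Ad u a = u * a * mat_adjoint u"

definition sign_unitary :: "nat \<Rightarrow> complex mat" where
  "sign_unitary n = diag_block_mat [1\<^sub>m (2 ^ (n - 1) + 1), - 1\<^sub>m (2 ^ (n - 1) - 1)]"

definition beta :: "uhf \<Rightarrow> uhf" where
  "beta = tensor_automorphism (\<lambda>n. Ad (sign_unitary n))"

subsection \<open>Existence and uniqueness of the automorphism, and its order\<close>

lemma uhf_induct [case_names factor add mult closed]:
  assumes "\<And>k a. k \<ge> 1 \<Longrightarrow> a \<in> carrier_mat (2 ^ k) (2 ^ k) \<Longrightarrow> P (factor k a)"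
    and "\<And>x y. P x \<Longrightarrow> P y \<Longrightarrow> P (x + y)"
    and "\<And>x y. P x \<Longrightarrow> P y \<Longrightarrow> P (x * y)"
    and "closed {x. P x}"
  shows "P x"
proof -
  have L: "P (Abs_uhf T)" if "T \<in> local_ops" for T
    using that
  proof induction
    case (factor k a)
    then have "Abs_uhf (factor_op k a) = factor k a" by (simp add: factor_def)
    then show ?case using assms(1)[OF factor] by simp
  next
    case (add S T)
    then have "Abs_uhf (S + T) = Abs_uhf S + Abs_uhf T"
      using closure_subset[of local_ops]
      by (intro rep_uhf_inject[THEN iffD1])
        (auto simp: plus_uhf.rep_eq Abs_uhf_inverse local_ops.add subset_iff)
    then show ?case using add assms(2) by simp
  next
    case (compose S T)
    then have "Abs_uhf (S o\<^sub>L T) = Abs_uhf S * Abs_uhf T"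
      using closure_subset[of local_ops]
      by (intro rep_uhf_inject[THEN iffD1])
        (auto simp: times_uhf.rep_eq Abs_uhf_inverse local_ops.compose subset_iff)
    then show ?case using compose assms(3) by simp
  qed
  obtain X where X: "\<And>n. X n \<in> local_ops" "X \<longlonglongrightarrow> rep_uhf x"
    using rep_uhf[of x] unfolding closure_sequential by blast
  have "rep_uhf (Abs_uhf (X n)) = X n" for n
    using X(1) closure_subset[of local_ops] by (intro Abs_uhf_inverse) blast
  then have "(\<lambda>n. Abs_uhf (X n)) \<longlonglongrightarrow> x"
    using X(2) by (simp add: lim_sequentially dist_rep_uhf[symmetric])
  then show ?thesis
    using closed_sequentially[OF assms(4), of "\<lambda>n. Abs_uhf (X n)" x] L X(1) by simp
qed

lemma tensor_automorphism_unique: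
  assumes "is_tensor_automorphism \<theta> \<beta>" "is_tensor_automorphism \<theta> \<gamma>"
  shows "\<beta> = \<gamma>"
proof
  fix x
  show "\<beta> x = \<gamma> x"
  proof (induction x rule: uhf_induct)
    show "closed {x. \<beta> x = \<gamma> x}"
      using assms by (intro closed_Collect_eq) (auto simp: is_tensor_automorphism_def)
  qed (use assms in \<open>auto simp: is_tensor_automorphism_def star_automorphism_def\<close>)
qed

definition diag_sign :: "nat \<Rightarrow> nat \<Rightarrow> complex" where
  "diag_sign k s = (if s \<le> 2 ^ (k - 1) then 1 else - 1)"

lemma sign_unitary_diag:
  assumes "k \<ge> 1"
  shows "sign_unitary k = mat_diag (2 ^ k) (diag_sign k)"
proof -
  obtain m where m: "k = Suc m" using assms by (cases k) auto
  have "1 \<le> (2::nat) ^ m" by simp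
  then show ?thesis
    unfolding sign_unitary_def m mat_diag_def
    by (intro eq_matI) (auto simp: Let_def diag_sign_def)
qed

lemma Ad_sign_unitary:
  assumes "k \<ge> 1" "a \<in> carrier_mat (2 ^ k) (2 ^ k)"
  shows "Ad (sign_unitary k) a \<in> carrier_mat (2 ^ k) (2 ^ k)"
    and "r < 2 ^ k \<Longrightarrow> s < 2 ^ k \<Longrightarrow>
      Ad (sign_unitary k) a $$ (r, s) = diag_sign k r * a $$ (r, s) * diag_sign k s"
proof -
  let ?u = "mat_diag (2 ^ k) (diag_sign k)"
  have u: "?u \<in> carrier_mat (2 ^ k) (2 ^ k)" by (simp add: mat_diag_def)
  have "mat_adjoint ?u = ?u"
  proof (rule eq_matI)
    fix i j assume "i < dim_row ?u" "j < dim_col ?u"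
    then show "mat_adjoint ?u $$ (i, j) = ?u $$ (i, j)"
      using mat_adjoint_index[OF u, of i j] by (auto simp: mat_diag_def diag_sign_def)
  qed (simp_all add: mat_adjoint_def mat_diag_def)
  then have Ad: "Ad (sign_unitary k) a = ?u * a * ?u"
    using assms by (simp add: Ad_def sign_unitary_diag)
  show "Ad (sign_unitary k) a \<in> carrier_mat (2 ^ k) (2 ^ k)"
    unfolding Ad by (rule mult_carrier_mat[OF mult_carrier_mat[OF u assms(2)] u])
  show "Ad (sign_unitary k) a $$ (r, s) = diag_sign k r * a $$ (r, s) * diag_sign k s"
    if "r < 2 ^ k" "s < 2 ^ k"
    unfolding Ad using that assms(2)
    by (simp add: mat_diag_mult_left[OF assms(2)] mat_diag_mult_right[of _ "2 ^ k" "2 ^ k"])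
qed

definition index_sign :: "multi_index \<Rightarrow> complex" where
  "index_sign i = (\<Prod>k\<in>{k. digit i k \<noteq> 0}. diag_sign k (digit i k))"

lemma diag_sign_sq: "diag_sign k s * diag_sign k s = 1"
  by (simp add: diag_sign_def)

lemma index_sign_cases: "index_sign i = 1 \<or> index_sign i = - 1"
proof -
  have "(\<Prod>k\<in>A. diag_sign k (digit i k)) = 1 \<or> (\<Prod>k\<in>A. diag_sign k (digit i k)) = - 1" for A
    by (induction A rule: infinite_finite_induct) (auto simp: diag_sign_def)
  then show ?thesis by (simp add: index_sign_def)
qed

lemma index_sign_split:
  "index_sign i = diag_sign k (digit i k) * (\<Prod>l\<in>{l. digit i l \<noteq> 0} - {k}. diag_sign l (digit i l))"
proof -
  have fin: "finite {l. digit i l \<noteq> 0}" using digit[of i] by simp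
  show ?thesis
  proof (cases "digit i k = 0")
    case True
    then have "{l. digit i l \<noteq> 0} - {k} = {l. digit i l \<noteq> 0}" by auto
    then show ?thesis using True by (simp add: index_sign_def diag_sign_def)
  next
    case False
    then show ?thesis unfolding index_sign_def using fin by (subst prod.remove[of _ k]) auto
  qed
qed

lemma index_sign_upd:
  assumes "s < 2 ^ k"
  shows "index_sign i * index_sign (upd i k s) = diag_sign k (digit i k) * diag_sign k s"
proof -
  let ?P = "\<Prod>l\<in>{l. digit i l \<noteq> 0} - {k}. diag_sign l (digit i l)"
  have "(\<Prod>l\<in>{l. digit (upd i k s) l \<noteq> 0} - {k}. diag_sign l (digit (upd i k s) l)) = ?P"
    by (rule prod.cong) (auto simp: digit_upd assms)
  then have u: "index_sign (upd i k s) = diag_sign k s * ?P"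
    using index_sign_split[of "upd i k s" k] assms by (simp add: digit_upd)
  have "?P * ?P = 1"
    by (simp add: prod.distrib[symmetric] diag_sign_sq)
  then show ?thesis unfolding u index_sign_split[of i k] by (simp add: algebra_simps)
qed

lift_definition sign_fun :: "multi_index ell2 \<Rightarrow> multi_index ell2" is "\<lambda>f i. index_sign i * f i"
proof -
  have "norm (index_sign i * z) = norm z" for i z
    using index_sign_cases[of i] by auto
  then show "(\<lambda>i. (norm (index_sign i * f i))\<^sup>2) summable_on UNIV"
    if "(\<lambda>i. (norm (f i))\<^sup>2) summable_on UNIV" for f
    using that by simp
qed

lemma norm_sign_fun: "norm (sign_fun f) = norm f"
proof -
  have "norm (index_sign i * z) = norm z" for i z
    using index_sign_cases[of i] by auto
  then have "(norm (sign_fun f))\<^sup>2 = (norm f)\<^sup>2" by (simp add: norm_ell2_sq sign_fun.rep_eq)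
  then show ?thesis by (simp add: power2_eq_iff_nonneg)
qed

lift_definition sign_op :: "multi_index ell2 \<Rightarrow>\<^sub>L multi_index ell2" is sign_fun
  by (rule bounded_linear_intro[where K = 1])
    (auto simp: norm_sign_fun intro!: ell2_eqI
      simp: sign_fun.rep_eq plus_ell2.rep_eq scaleR_ell2.rep_eq algebra_simps)

lemma coord_sign_op: "coord (sign_op f) i = index_sign i * coord f i"
  by (simp add: sign_op.rep_eq sign_fun.rep_eq)

lemma sign_op_sq: "sign_op o\<^sub>L sign_op = id_blinfun"
proof (intro blinfun_eqI ell2_eqI)
  fix f i
  show "coord ((sign_op o\<^sub>L sign_op) f) i = coord (id_blinfun f) i"
    using index_sign_cases[of i] by (auto simp: coord_sign_op)
qed

lemma sign_op_self_adjoint: "adjoint_pair sign_op sign_op"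
  unfolding adjoint_pair_def inner_ell2_def
proof (intro allI infsum_cong)
  fix f g i
  show "inner (coord (sign_op f) i) (coord g i) = inner (coord f i) (coord (sign_op g) i)"
    using index_sign_cases[of i] by (auto simp: coord_sign_op)
qed

definition conj_sign :: "(multi_index ell2 \<Rightarrow>\<^sub>L multi_index ell2) \<Rightarrow> (multi_index ell2 \<Rightarrow>\<^sub>L multi_index ell2)"
  where "conj_sign T = sign_op o\<^sub>L T o\<^sub>L sign_op"

lemma conj_sign_factor:
  assumes "k \<ge> 1" "a \<in> carrier_mat (2 ^ k) (2 ^ k)"
  shows "conj_sign (factor_op k a) = factor_op k (Ad (sign_unitary k) a)"
proof (intro blinfun_eqI ell2_eqI)
  fix f i
  have "coord (conj_sign (factor_op k a) f) i =
      (\<Sum>s<2^k. a $$ (digit i k, s) * (index_sign i * index_sign (upd i k s)) * coord f (upd i k s))"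
    by (simp add: conj_sign_def coord_sign_op coord_factor_op sum_distrib_left algebra_simps)
  also have "\<dots> = coord (factor_op k (Ad (sign_unitary k) a) f) i"
    unfolding coord_factor_op
    by (intro sum.cong refl) (simp add: index_sign_upd Ad_sign_unitary(2)[OF assms] digit_less)
  finally show "coord (conj_sign (factor_op k a) f) i = coord (factor_op k (Ad (sign_unitary k) a) f) i" .
qed

lemma conj_sign_compose: "conj_sign (S o\<^sub>L T) = conj_sign S o\<^sub>L conj_sign T"
proof (rule blinfun_eqI)
  fix f
  have "sign_op (sign_op g) = g" for g using sign_op_sq by (metis blinfun_apply_blinfun_compose blinfun_apply_id_blinfun id_apply)
  then show "conj_sign (S o\<^sub>L T) f = (conj_sign S o\<^sub>L conj_sign T) f" by (simp add: conj_sign_def)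
qed

lemma conj_sign_conj_sign: "conj_sign (conj_sign T) = T"
proof (rule blinfun_eqI)
  fix f
  have "sign_op (sign_op g) = g" for g using sign_op_sq by (metis blinfun_apply_blinfun_compose blinfun_apply_id_blinfun id_apply)
  then show "conj_sign (conj_sign T) f = T f" by (simp add: conj_sign_def)
qed

lemma bounded_linear_conj_sign: "bounded_linear conj_sign"
  unfolding conj_sign_def
  by (intro bounded_linear_compose[OF bounded_bilinear.bounded_linear_left[OF bounded_bilinear_blinfun_compose]
      bounded_bilinear.bounded_linear_right[OF bounded_bilinear_blinfun_compose]])

lemma conj_sign_local: "T \<in> local_ops \<Longrightarrow> conj_sign T \<in> local_ops"
proof (induction rule: local_ops.induct)
  case (factor k a)
  then show ?case by (simp add: conj_sign_factor local_ops.factor Ad_sign_unitary(1))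
next
  case (add S T)
  then show ?case
    by (simp add: linear_add[OF bounded_linear.linear[OF bounded_linear_conj_sign]] local_ops.add)
next
  case (compose S T)
  then show ?case by (simp add: conj_sign_compose local_ops.compose)
qed

lift_definition beta_lift :: "uhf \<Rightarrow> uhf" is conj_sign
proof -
  fix T assume "T \<in> closure local_ops"
  then obtain X where X: "\<And>n. X n \<in> local_ops" "X \<longlonglongrightarrow> T"
    unfolding closure_sequential by blast
  then show "conj_sign T \<in> closure local_ops"
    unfolding closure_sequential
    by (intro exI[of _ "\<lambda>n. conj_sign (X n)"])
      (auto intro: conj_sign_local bounded_linear.tendsto[OF bounded_linear_conj_sign])
qed

lemma beta_lift_beta_lift: "beta_lift (beta_lift x) = x"
  by transfer (rule conj_sign_conj_sign)

lemma is_tensor_automorphism_beta_lift: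
  "is_tensor_automorphism (\<lambda>n. Ad (sign_unitary n)) beta_lift"
  unfolding is_tensor_automorphism_def star_automorphism_def
proof (intro conjI allI impI ballI)
  note lin = bounded_linear.linear[OF bounded_linear_conj_sign]
  show "bij beta_lift" by (rule o_bij[where g = beta_lift]) (auto simp: beta_lift_beta_lift)
  show add: "beta_lift (x + y) = beta_lift x + beta_lift y" for x y
    by transfer (rule linear_add[OF lin])
  show "beta_lift (x * y) = beta_lift x * beta_lift y" for x y
    by transfer (rule conj_sign_compose)
  show "beta_lift (c *\<^sub>C x) = c *\<^sub>C beta_lift x" for c x
  proof transfer
    fix c T
    have "conj_sign (cscale_op c) = cscale_op c"
    proof (intro blinfun_eqI ell2_eqI)
      fix f i
      show "coord (conj_sign (cscale_op c) f) i = coord (cscale_op c f) i"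
        using index_sign_cases[of i] by (auto simp: conj_sign_def coord_sign_op coord_cscale_op)
    qed
    then show "conj_sign (cscale_op c o\<^sub>L T) = cscale_op c o\<^sub>L conj_sign T"
      by (simp add: conj_sign_compose)
  qed
  show "beta_lift (star x) = star (beta_lift x)" for x
  proof transfer
    fix T assume T: "T \<in> closure local_ops"
    have "adjoint_pair (conj_sign T) (conj_sign (adjoint_op T))"
      unfolding conj_sign_def blinfun_compose_assoc[of sign_op "adjoint_op T"]
      by (intro adjoint_pair_compose sign_op_self_adjoint adjoint_op T)
    then show "conj_sign (adjoint_op T) = adjoint_op (conj_sign T)" by (simp add: adjoint_op_eqI)
  qed
  have "norm (beta_lift x) \<le> norm x * (norm sign_op * norm sign_op)" for x
  proof -
    have "norm (conj_sign (rep_uhf x)) \<le> norm (sign_op o\<^sub>L rep_uhf x) * norm sign_op"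
      unfolding conj_sign_def by (rule norm_blinfun_compose)
    also have "\<dots> \<le> (norm sign_op * norm (rep_uhf x)) * norm sign_op"
      by (intro mult_right_mono norm_blinfun_compose) simp
    finally show ?thesis
      by (simp only: norm_uhf.rep_eq beta_lift.rep_eq ac_simps)
  qed
  moreover have "beta_lift (r *\<^sub>R x) = r *\<^sub>R beta_lift x" for r x
    by transfer (rule linear_scale[OF lin])
  ultimately have "bounded_linear beta_lift"
    by (intro bounded_linear_intro add)
  then show "continuous_on UNIV beta_lift"
    by (intro linear_continuous_on)
  show "beta_lift (factor k a) = factor k (Ad (sign_unitary k) a)"
    if "1 \<le> k" "a \<in> carrier_mat (2 ^ k) (2 ^ k)" for k a
    using that by transfer (simp add: conj_sign_factor Ad_sign_unitary(1))
qed

theorem is_tensor_automorphism_beta: "is_tensor_automorphism (\<lambda>n. Ad (sign_unitary n)) beta"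
  unfolding beta_def tensor_automorphism_def
proof (rule theI[where P = "is_tensor_automorphism (\<lambda>n. Ad (sign_unitary n))" and a = beta_lift])
  show "is_tensor_automorphism (\<lambda>n. Ad (sign_unitary n)) beta_lift"
    by (rule is_tensor_automorphism_beta_lift)
  show "\<gamma> = beta_lift" if "is_tensor_automorphism (\<lambda>n. Ad (sign_unitary n)) \<gamma>" for \<gamma>
    using that is_tensor_automorphism_beta_lift by (rule tensor_automorphism_unique)
qed

corollary star_automorphism_beta: "star_automorphism beta"
  and beta_factor: "k \<ge> 1 \<Longrightarrow> a \<in> carrier_mat (2 ^ k) (2 ^ k) \<Longrightarrow>
    beta (factor k a) = factor k (Ad (sign_unitary k) a)"
  using is_tensor_automorphism_beta by (auto simp: is_tensor_automorphism_def)

corollary beta_beta: "beta (beta x) = x"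
  using tensor_automorphism_unique[OF is_tensor_automorphism_beta is_tensor_automorphism_beta_lift]
  by (simp add: beta_lift_beta_lift)

lemma beta_neq_id: "beta \<noteq> id"
proof
  let ?a = "mat 4 4 (\<lambda>(i, j). if i = 0 \<and> j = 3 then 1 else 0) :: complex mat"
  assume "beta = id"
  have a: "?a \<in> carrier_mat (2 ^ 2) (2 ^ 2)" by simp
  define i0 where "i0 = Abs_multi_index (\<lambda>_. 0)"
  have d0: "digit i0 = (\<lambda>_. 0)" by (simp add: i0_def Abs_multi_index_inverse)
  define i3 where "i3 = upd i0 2 3"
  define f where "f = Abs_ell2 (\<lambda>i. if i = i3 then 1 else 0)"
  have "(\<lambda>i. (norm (if i = i3 then 1 else 0 :: complex))\<^sup>2) summable_on UNIV"
    by (rule finite_nonzero_values_imp_summable_on) (auto intro: finite_subset[of _ "{i3}"])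
  then have f: "coord f i3 = 1" by (simp add: f_def Abs_ell2_inverse)
  have c: "coord (factor_op 2 b f) i0 = b $$ (0, 3)"
    if "\<And>s. s < 3 \<Longrightarrow> b $$ (0, s) = 0" for b
  proof -
    have "coord (factor_op 2 b f) i0 = (\<Sum>s\<in>{0, 1, 2, 3}. b $$ (0, s) * coord f (upd i0 2 s))"
      unfolding coord_factor_op d0 by (rule sum.cong) auto
    then show ?thesis using that f by (simp add: i3_def[symmetric])
  qed
  have "factor_op 2 (Ad (sign_unitary 2) ?a) = factor_op 2 ?a"
    using beta_factor[OF _ a] \<open>beta = id\<close> a Ad_sign_unitary(1)[OF _ a]
    by (simp add: factor.rep_eq rep_uhf_inject[symmetric])
  moreover have "Ad (sign_unitary 2) ?a $$ (0, s) = diag_sign 2 0 * ?a $$ (0, s) * diag_sign 2 s"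
    if "s < 4" for s using Ad_sign_unitary(2)[OF _ a, of 0 s] that by simp
  ultimately have "?a $$ (0, 3) = Ad (sign_unitary 2) ?a $$ (0, 3)"
    using c[of ?a] c[of "Ad (sign_unitary 2) ?a"] by simp
  then show False
    using Ad_sign_unitary(2)[OF _ a, of 0 3] by (simp add: diag_sign_def)
qed

end

theory Submission
  imports Defs
begin

text \<open>
  Everything happens in one tensor factor, of size \<open>2 ^ n\<close> with \<open>n\<close> large. The diagonal unitary has
  \<open>2 ^ (n - 1) + 1\<close> entries 1 and \<open>2 ^ (n - 1) - 1\<close> entries -1. Pair each of the latter with one of the
  former; on the span of such a pair of basis vectors the unitary is \<open>diag (1, -1)\<close> and swaps the lines
  spanned by the sum and the difference of the two vectors. The projections \<open>e 0\<close> and \<open>e 1\<close> onto all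
  sums and onto all differences are therefore exchanged exactly by the automorphism, and they leave
  only a projection of rank two, on the two unpaired vectors (\<open>swapped_matrix_units\<close>). They commute
  with all elements of the earlier factors, and such elements are dense; this gives the approximate
  commutation. Since the remainder has rank two and \<open>e 0\<close> and \<open>e 1\<close> have rank \<open>2 ^ (n - 1) - 1\<close>, each
  of them contains as many orthogonal copies of the remainder as desired.

  What remains is about the algebra alone, and rests on one fact (\<open>excision\<close>): for \<open>x \<noteq> 0\<close> there are
  an element \<open>c\<close> and a minimal projection \<open>p\<close> of a finite stage of the tensor product with
  \<open>star (x * c) * (x * c) = p\<close>. Indeed the compression of \<open>star x * x\<close> to a suitable small corner is
  close to a nonzero scalar, and a binomial series corrects it to that scalar. It is used three times.

  \<^item> Comparison: in a large factor a rank two projection is so small that it is equivalent to one below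
    \<open>p\<close> (\<open>spread_partial_isometry\<close>), and \<open>x * c\<close> carries the latter into the hereditary subalgebra
    generated by a positive \<open>x\<close> (\<open>subequivalent_to_hereditary\<close>).

  \<^item> Simplicity: a nonzero ideal contains a minimal projection \<open>p\<close>, hence 1.

  \<^item> Stable finiteness: averaging vector states over the matrix units of the first \<open>m\<close> factors gives states
    that become tracial as \<open>m\<close> grows, and \<open>x\<close> cannot be null for them because then \<open>p\<close> would be
    (\<open>T_faithful\<close>). An isometric matrix over the algebra is unitary since its defect has trace zero.
\<close>

section \<open>Norm, adjoints and square roots in a unital C*-algebra\<close>

lemma star_scaleR: "star (r *\<^sub>R x) = r *\<^sub>R star (x :: 'a::unital_cstar_algebra)"
  using star_scaleC[of "complex_of_real r" x] by (simp add: scaleC_of_real)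

lemma scaleC_zero [simp]: "c *\<^sub>C (0 :: 'a::unital_cstar_algebra) = 0"
  using scaleC_add_right[of c 0 "0::'a"] by simp

lemma star_zero [simp]: "star (0 :: 'a::unital_cstar_algebra) = 0"
  using star_add[of 0 "0::'a"] by simp

lemma scaleC_zero_left [simp]: "0 *\<^sub>C x = (0 :: 'a::unital_cstar_algebra)"
  using scaleC_of_real[of 0 x] by simp

lemma scaleC_one [simp]: "1 *\<^sub>C x = (x :: 'a::unital_cstar_algebra)"
  using scaleC_of_real[of 1 x] by simp

lemma scaleC_minus_one [simp]: "(- 1) *\<^sub>C x = (- x :: 'a::unital_cstar_algebra)"
  using scaleC_of_real[of "- 1" x] by simp

lemma scaleC_sum_left: "(\<Sum>a\<in>A. c a) *\<^sub>C x = (\<Sum>a\<in>A. c a *\<^sub>C (x :: 'a::unital_cstar_algebra))"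
  by (induction A rule: infinite_finite_induct) (auto simp: scaleC_add_left)

lemma scaleC_sum_right: "c *\<^sub>C (\<Sum>a\<in>A. f a) = (\<Sum>a\<in>A. c *\<^sub>C (f a :: 'a::unital_cstar_algebra))"
  by (induction A rule: infinite_finite_induct) (auto simp: scaleC_add_right)

lemma star_minus: "star (- x) = - star (x :: 'a::unital_cstar_algebra)"
  using star_add[of x "- x"] by (simp add: eq_neg_iff_add_eq_0 add.commute)

lemma star_diff: "star (x - y) = star x - star (y :: 'a::unital_cstar_algebra)"
  using star_add[of x "- y"] by (simp add: star_minus)

lemma star_one [simp]: "star (1 :: 'a::unital_cstar_algebra) = 1"
  using star_mult[of "star (1::'a)" 1] by (simp add: star_star)

lemma star_sum: "star (sum f A) = (\<Sum>i\<in>A. star (f i :: 'a::unital_cstar_algebra))"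
  by (induction A rule: infinite_finite_induct) (auto simp: star_add)

lemma star_power: "star (x ^ n) = star (x :: 'a::unital_cstar_algebra) ^ n"
  by (induction n) (auto simp: star_mult power_commutes)

lemma norm_star [simp]: "norm (star x) = norm (x :: 'a::unital_cstar_algebra)"
proof -
  have le: "norm y \<le> norm (star y)" for y :: 'a
  proof (cases "y = 0")
    case False
    have "norm y * norm y \<le> norm (star y) * norm y"
      using norm_mult_ineq[of "star y" y] by (simp add: cstar_identity power2_eq_square)
    then show ?thesis using False by simp
  qed simp
  show ?thesis using le[of x] le[of "star x"] by (simp add: star_star)
qed

lemma bounded_linear_star: "bounded_linear (star :: 'a::unital_cstar_algebra \<Rightarrow> 'a)"
  by (rule bounded_linear_intro[where K = 1]) (auto simp: star_add star_scaleR)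

lemma norm_projection_le_1:
  assumes "projection p" shows "norm p \<le> 1"
proof -
  have "norm p * norm p = norm p"
    using assms cstar_identity[of p] by (simp add: projection_def power2_eq_square)
  then show ?thesis by (cases "norm p = 0") auto
qed

lemma positive_star_mult: "positive (star y * y)"
  by (auto simp: positive_def)

lemma positive_mult_star: "positive (y * star y)"
  using positive_star_mult[of "star y"] by (simp add: star_star)

lemma positive_self_adjoint: "positive x \<Longrightarrow> star x = x"
  by (auto simp: positive_def star_mult star_star)

lemma projection_positive: "projection p \<Longrightarrow> positive p"
  unfolding positive_def projection_def by (rule exI[of _ p]) simp

text \<open>
  The power \<open>(1 - t) powr a\<close>, for \<open>norm t < 1\<close>. The binomial series gives the roots needed below
  without functional calculus, and Vandermonde's identity makes it multiplicative in \<open>a\<close>.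
\<close>

definition binomial_series :: "real \<Rightarrow> 'a::unital_cstar_algebra \<Rightarrow> 'a" where
  "binomial_series a t = (\<Sum>n. (a gchoose n) *\<^sub>R (- t) ^ n)"

lemma summable_norm_binomial_series:
  fixes t :: "'a::unital_cstar_algebra"
  assumes "norm t < 1"
  shows "summable (\<lambda>n. norm ((a gchoose n) *\<^sub>R (- t) ^ n))"
proof (rule summable_comparison_test')
  have "ereal (norm (norm t)) < conv_radius (\<lambda>n. a gchoose n)"
    using assms by (simp add: conv_radius_gchoose one_ereal_def)
  from abs_summable_in_conv_radius[OF this]
  show "summable (\<lambda>n. norm ((a gchoose n) * norm t ^ n))" .
  show "norm (norm ((a gchoose n) *\<^sub>R (- t) ^ n)) \<le> norm ((a gchoose n) * norm t ^ n)" for n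
    using norm_power_ineq[of "- t" n] by (simp add: abs_mult mult_left_mono)
qed

lemma binomial_series_add:
  fixes t :: "'a::unital_cstar_algebra"
  assumes "norm t < 1"
  shows "binomial_series a t * binomial_series b t = binomial_series (a + b) t"
proof -
  have "(\<Sum>i\<le>n. (a gchoose i) *\<^sub>R (- t) ^ i * (b gchoose (n - i)) *\<^sub>R (- t) ^ (n - i))
      = (a + b gchoose n) *\<^sub>R (- t) ^ n" for n
  proof -
    have "(\<Sum>i\<le>n. (a gchoose i) *\<^sub>R (- t) ^ i * (b gchoose (n - i)) *\<^sub>R (- t) ^ (n - i))
       = (\<Sum>i\<le>n. ((a gchoose i) * (b gchoose (n - i))) *\<^sub>R (- t) ^ n)"
      by (intro sum.cong refl) (simp add: power_add[symmetric])
    then show ?thesis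
      by (simp add: scaleR_sum_left[symmetric] gbinomial_Vandermonde[symmetric] atLeast0AtMost)
  qed
  then show ?thesis
    unfolding binomial_series_def
    by (simp only: Cauchy_product[OF summable_norm_binomial_series[OF assms] summable_norm_binomial_series[OF assms]])
qed

lemma binomial_series_0: "binomial_series 0 t = 1"
  unfolding binomial_series_def
  by (subst suminf_finite[of "{0}"]) (auto simp: gbinomial_0_left)

lemma binomial_series_1: "binomial_series 1 t = 1 - t"
proof -
  have "(1::real) gchoose n = 0" if "n \<notin> {0, 1}" for n
    using that binomial_gbinomial[of 1 n, where 'a = real] by (auto simp: binomial_eq_0)
  then show ?thesis
    unfolding binomial_series_def by (subst suminf_finite[of "{0, 1}"]) auto
qed

lemma binomial_series_self_adjoint:
  assumes "norm t < 1" "star t = t"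
  shows "star (binomial_series a t) = binomial_series a t"
proof -
  have "summable (\<lambda>n. (a gchoose n) *\<^sub>R (- t) ^ n)"
    by (rule summable_norm_cancel[OF summable_norm_binomial_series[OF assms(1)]])
  from bounded_linear.suminf[OF bounded_linear_star this] show ?thesis
    by (simp add: binomial_series_def star_scaleR star_power star_minus assms(2))
qed

lemma binomial_series_commute:
  assumes "norm t < 1" "s * t = t * s"
  shows "s * binomial_series a t = binomial_series a t * s"
proof -
  have sm: "summable (\<lambda>n. (a gchoose n) *\<^sub>R (- t) ^ n)"
    by (rule summable_norm_cancel[OF summable_norm_binomial_series[OF assms(1)]])
  have "s * (- t) = (- t) * s" using assms(2) by simp
  then have "s * (- t) ^ n = (- t) ^ n * s" for n by (rule power_commuting_commutes[symmetric, OF sym])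
  then show ?thesis
    unfolding binomial_series_def
    using suminf_mult[OF sm, of s] suminf_mult2[OF sm, of s] by simp
qed

text \<open>
  A square root of \<open>C - g\<close> is \<open>sqrt C\<close> times the one of \<open>1 - g / C\<close>, a binomial series.
\<close>

lemma positive_if_norm_less:
  assumes "star g = g" "norm g < C"
  shows "positive (C *\<^sub>R 1 - g :: 'a::unital_cstar_algebra)"
proof -
  have C: "C > 0" using assms(2) norm_ge_zero[of g] by linarith
  define t where "t = (1 / C) *\<^sub>R g"
  have t: "norm t < 1" "star t = t" using C assms by (simp_all add: t_def star_scaleR)
  define b where "b = sqrt C *\<^sub>R binomial_series (1 / 2) t"
  have "star b * b = (sqrt C * sqrt C) *\<^sub>R (binomial_series (1 / 2) t * binomial_series (1 / 2) t)"
    by (simp add: b_def star_scaleR binomial_series_self_adjoint[OF t])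
  also have "\<dots> = C *\<^sub>R (1 - t)"
    using C by (simp add: binomial_series_add[OF t(1)] binomial_series_1)
  also have "\<dots> = C *\<^sub>R 1 - g" using C by (simp add: t_def scaleR_diff_right)
  finally show ?thesis by (metis positive_star_mult)
qed

lemma positive_conjugate:
  assumes "positive y" shows "positive (star x * y * x)"
proof -
  obtain z where "y = star z * z" using assms by (auto simp: positive_def)
  then have "star x * y * x = star (z * x) * (z * x)" by (simp add: star_mult mult.assoc)
  then show ?thesis using positive_star_mult by metis
qed

lemma conjugate_le:
  assumes "star g = g" "norm g < C"
  shows "cstar_le (star x * g * x) (C *\<^sub>R (star x * x))"
proof -
  have "C *\<^sub>R (star x * x) - star x * g * x = star x * (C *\<^sub>R 1 - g) * x"
    by (simp add: algebra_simps)
  then show ?thesis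
    using positive_conjugate[OF positive_if_norm_less[OF assms], of x] by (simp add: cstar_le_def)
qed

text \<open>
  If the compression of \<open>y\<close> to the corner of \<open>p\<close> is close to the scalar \<open>l\<close>, it is \<open>l (p - t)\<close>
  with \<open>t\<close> in the corner and of norm below 1, so that \<open>p (1 - t) powr (- 1 / 2) / sqrt l\<close>
  normalizes it. Since \<open>t\<close> commutes with \<open>p\<close>, the root may be taken in the whole algebra.
\<close>

lemma corner_normalize:
  assumes p: "projection p" and y: "star y = y" and l: "l > 0"
    and near: "norm (p * y * p - l *\<^sub>R p) < l"
  shows "\<exists>c. p * c = c \<and> star c * y * c = p"
proof -
  define t where "t = p - (1 / l) *\<^sub>R (p * y * p)"
  have pp: "p * p = p" "star p = p" using p by (auto simp: projection_def)
  have ppx: "p * (p * z) = p * z" for z using pp by (metis mult.assoc)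
  have st: "star t = t"
    by (simp add: t_def star_diff star_scaleR star_mult pp y mult.assoc)
  have "l *\<^sub>R t = - (p * y * p - l *\<^sub>R p)" using l by (simp add: t_def scaleR_diff_right)
  then have "norm (l *\<^sub>R t) < l" using near by (simp only: norm_minus_cancel)
  then have "l * norm t < l" using l by simp
  then have t: "norm t < 1" using l by simp
  have pt: "p * t = t" "t * p = t"
    by (simp_all add: t_def right_diff_distrib left_diff_distrib pp ppx mult.assoc)
  define r where "r = binomial_series (- 1 / 2) t"
  have r: "star r = r" "p * r = r * p" "t * r = r * t"
    unfolding r_def using t st pt by (auto intro!: binomial_series_self_adjoint binomial_series_commute)
  have "r * r * (1 - t) = binomial_series (- 1 / 2 + - 1 / 2 + 1) t"
    unfolding r_def binomial_series_1[symmetric] by (simp only: binomial_series_add[OF t])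
  then have rr: "r * r * (1 - t) = 1" by (simp add: binomial_series_0)
  define c where "c = (1 / sqrt l) *\<^sub>R (p * r)"
  have lt: "p * y * p = l *\<^sub>R (p - t)" using l by (simp add: t_def)
  have "star c * y * c = (1 / l) *\<^sub>R (r * (p * y * p) * r)"
    using l by (simp add: c_def star_scaleR star_mult pp r mult.assoc divide_simps)
  also have "\<dots> = r * (p - t) * r" using l by (simp add: lt)
  also have "p - t = p * (1 - t)" by (simp add: right_diff_distrib pt)
  also have "r * (p * (1 - t)) * r = (r * p) * ((1 - t) * r)" by (simp only: mult.assoc)
  also have "(1 - t) * r = r * (1 - t)" using r(3) by (simp add: left_diff_distrib right_diff_distrib)
  also have "(r * p) * (r * (1 - t)) = p * (r * r * (1 - t))"
    by (simp only: r(2)[symmetric] mult.assoc)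
  finally have "star c * y * c = p" by (simp add: rr)
  moreover have "p * c = c" by (simp add: c_def ppx)
  ultimately show ?thesis by blast
qed

section \<open>Systems of matrix units\<close>

definition matrix_units :: "'i set \<Rightarrow> ('i \<Rightarrow> 'i \<Rightarrow> 'a::unital_cstar_algebra) \<Rightarrow> bool" where
  "matrix_units I e \<longleftrightarrow> finite I \<and>
     (\<forall>i\<in>I. \<forall>j\<in>I. \<forall>k\<in>I. \<forall>l\<in>I. e i j * e k l = (if j = k then e i l else 0)) \<and>
     (\<forall>i\<in>I. \<forall>j\<in>I. star (e i j) = e j i) \<and> (\<Sum>i\<in>I. e i i) = 1"

text \<open>
  All projections of the final construction are of this form, so that their orthogonality, order and
  equivalence become statements about index sets.
\<close>

definition diag_projection :: "('i \<Rightarrow> 'i \<Rightarrow> 'a::unital_cstar_algebra) \<Rightarrow> 'i set \<Rightarrow> 'a" where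
  "diag_projection e J = (\<Sum>j\<in>J. e j j)"

lemma matrix_units_finite: "matrix_units I e \<Longrightarrow> finite I"
  and matrix_units_mult: "matrix_units I e \<Longrightarrow> i \<in> I \<Longrightarrow> j \<in> I \<Longrightarrow> k \<in> I \<Longrightarrow> l \<in> I \<Longrightarrow>
    e i j * e k l = (if j = k then e i l else 0)"
  and matrix_units_star: "matrix_units I e \<Longrightarrow> i \<in> I \<Longrightarrow> j \<in> I \<Longrightarrow> star (e i j) = e j i"
  and matrix_units_sum: "matrix_units I e \<Longrightarrow> (\<Sum>i\<in>I. e i i) = 1"
  by (auto simp: matrix_units_def)

lemma matrix_units_projection: "matrix_units I e \<Longrightarrow> i \<in> I \<Longrightarrow> projection (e i i)"
  by (simp add: projection_def matrix_units_mult matrix_units_star)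

text \<open>
  Covers at once the products of diagonal projections and the two products \<open>star v * v\<close> and
  \<open>v * star v\<close> of a partial isometry matching up two index sets.
\<close>

lemma partial_isometry_mult:
  assumes e: "matrix_units I e" and J: "J \<subseteq> I" and K: "K \<subseteq> I"
    and f: "f ` J \<subseteq> I" "f' ` J \<subseteq> I" "g ` K \<subseteq> I" "g' ` K \<subseteq> I"
    and inj: "\<And>j k. j \<in> J \<Longrightarrow> k \<in> K \<Longrightarrow> f' j = g k \<Longrightarrow> j = k"
      "\<And>j. j \<in> J \<Longrightarrow> j \<in> K \<Longrightarrow> f' j = g j"
  shows "(\<Sum>j\<in>J. e (f j) (f' j)) * (\<Sum>k\<in>K. e (g k) (g' k)) = (\<Sum>j\<in>J \<inter> K. e (f j) (g' j))"
proof -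
  have fin: "finite J" "finite K"
    using matrix_units_finite[OF e] J K finite_subset by auto
  have "(\<Sum>j\<in>J. e (f j) (f' j)) * (\<Sum>k\<in>K. e (g k) (g' k))
      = (\<Sum>j\<in>J. \<Sum>k\<in>K. if k = j then e (f j) (g' j) else 0)"
    unfolding sum_product
  proof (intro sum.cong refl)
    fix j k assume jk: "j \<in> J" "k \<in> K"
    then have "e (f j) (f' j) * e (g k) (g' k) = (if f' j = g k then e (f j) (g' k) else 0)"
      by (intro matrix_units_mult[OF e]) (use f in auto)
    moreover have "f' j = g k \<longleftrightarrow> k = j" using inj jk by metis
    ultimately show "e (f j) (f' j) * e (g k) (g' k) = (if k = j then e (f j) (g' j) else 0)"
      by simp
  qed
  also have "\<dots> = (\<Sum>j\<in>J. if j \<in> K then e (f j) (g' j) else 0)"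
    using fin by (intro sum.cong refl) (simp add: sum.delta)
  also have "\<dots> = (\<Sum>j\<in>J \<inter> K. e (f j) (g' j))" using fin by (simp add: sum.inter_restrict)
  finally show ?thesis .
qed

lemma diag_projection_mult:
  assumes "matrix_units I e" "J \<subseteq> I" "K \<subseteq> I"
  shows "diag_projection e J * diag_projection e K = diag_projection e (J \<inter> K)"
  unfolding diag_projection_def using assms by (intro partial_isometry_mult[OF assms(1)]) auto

lemma projection_diag_projection:
  assumes "matrix_units I e" "J \<subseteq> I"
  shows "projection (diag_projection e J)"
proof -
  have "star (diag_projection e J) = diag_projection e J"
    unfolding diag_projection_def star_sum
    using assms by (intro sum.cong refl matrix_units_star[OF assms(1)]) auto
  then show ?thesis
    using diag_projection_mult[OF assms assms(2)] by (simp add: projection_def)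
qed

lemma diag_projection_mono:
  assumes "matrix_units I e" "J \<subseteq> K" "K \<subseteq> I"
  shows "cstar_le (diag_projection e J) (diag_projection e K)"
proof -
  have "finite K" using assms matrix_units_finite finite_subset by blast
  then have "diag_projection e K - diag_projection e J = diag_projection e (K - J)"
    using assms(2) by (simp add: diag_projection_def sum_diff)
  then show ?thesis
    unfolding cstar_le_def
    using assms projection_positive[OF projection_diag_projection[OF assms(1), of "K - J"]] by auto
qed

lemma diag_projection_mvn:
  assumes e: "matrix_units I e" and J: "J \<subseteq> I" "h ` J \<subseteq> I" and h: "inj_on h J"
  shows "mvn_equivalent (diag_projection e (h ` J)) (diag_projection e J)"
proof -
  define v where "v = (\<Sum>j\<in>J. e j (h j))"
  have sv: "star v = (\<Sum>j\<in>J. e (h j) j)"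
    unfolding v_def star_sum using J by (intro sum.cong refl matrix_units_star[OF e]) auto
  have "star v * v = (\<Sum>j\<in>J \<inter> J. e (h j) (h j))"
    unfolding sv unfolding v_def using J by (intro partial_isometry_mult[OF e]) auto
  moreover have "v * star v = (\<Sum>j\<in>J \<inter> J. e j j)"
    unfolding sv unfolding v_def using J h by (intro partial_isometry_mult[OF e]) (auto dest: inj_onD)
  ultimately show ?thesis
    unfolding mvn_equivalent_def diag_projection_def
    by (intro exI[of _ v]) (simp add: sum.reindex[OF h])
qed

text \<open>
  An orthonormal basis of column vectors yields the matrix units of that basis; this is the way to
  change the basis without leaving the algebra.
\<close>

lemma matrix_units_from_orthonormal_columns:
  assumes fin: "finite I"
    and on: "\<And>a b. a \<in> I \<Longrightarrow> b \<in> I \<Longrightarrow> star (g a) * g b = (if a = b then p else 0)"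
    and gp: "\<And>a. a \<in> I \<Longrightarrow> g a * p = g a"
    and one: "(\<Sum>a\<in>I. g a * star (g a)) = 1"
  shows "matrix_units I (\<lambda>a b. g a * star (g b))"
  unfolding matrix_units_def
proof (intro conjI ballI fin one)
  fix a b c d assume I: "a \<in> I" "b \<in> I" "c \<in> I" "d \<in> I"
  have "g a * star (g b) * (g c * star (g d)) = g a * (star (g b) * g c) * star (g d)"
    by (simp add: mult.assoc)
  then show "g a * star (g b) * (g c * star (g d)) = (if b = c then g a * star (g d) else 0)"
    using on[OF I(2,3)] gp[OF I(1)] by simp
qed (simp add: star_mult star_star)

lemma matrix_units_tensor:
  assumes e: "matrix_units I e" and g: "matrix_units J g"
    and comm: "\<And>i j r s. i \<in> I \<Longrightarrow> j \<in> I \<Longrightarrow> r \<in> J \<Longrightarrow> s \<in> J \<Longrightarrow> e i j * g r s = g r s * e i j"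
  shows "matrix_units (I \<times> J) (\<lambda>a b. e (fst a) (fst b) * g (snd a) (snd b))"
  unfolding matrix_units_def
proof (intro conjI ballI)
  show "finite (I \<times> J)" using e g by (auto simp: matrix_units_def)
  show "(\<Sum>a\<in>I \<times> J. e (fst a) (fst a) * g (snd a) (snd a)) = 1"
  proof -
    have "(\<Sum>a\<in>I \<times> J. e (fst a) (fst a) * g (snd a) (snd a)) = (\<Sum>i\<in>I. \<Sum>r\<in>J. e i i * g r r)"
      by (simp add: sum.cartesian_product case_prod_beta)
    also have "\<dots> = (\<Sum>i\<in>I. e i i) * (\<Sum>r\<in>J. g r r)" by (simp add: sum_product)
    finally show ?thesis by (simp add: matrix_units_sum[OF e] matrix_units_sum[OF g])
  qed
  fix a b assume ab: "a \<in> I \<times> J" "b \<in> I \<times> J"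
  then show "star (e (fst a) (fst b) * g (snd a) (snd b)) = e (fst b) (fst a) * g (snd b) (snd a)"
    by (auto simp: star_mult matrix_units_star[OF e] matrix_units_star[OF g] comm)
  fix c d assume cd: "c \<in> I \<times> J" "d \<in> I \<times> J"
  have "e (fst a) (fst b) * g (snd a) (snd b) * (e (fst c) (fst d) * g (snd c) (snd d))
      = e (fst a) (fst b) * (g (snd a) (snd b) * e (fst c) (fst d)) * g (snd c) (snd d)"
    by (simp add: mult.assoc)
  also have "g (snd a) (snd b) * e (fst c) (fst d) = e (fst c) (fst d) * g (snd a) (snd b)"
    using ab cd by (auto simp: comm)
  also have "e (fst a) (fst b) * (e (fst c) (fst d) * g (snd a) (snd b)) * g (snd c) (snd d)
      = (e (fst a) (fst b) * e (fst c) (fst d)) * (g (snd a) (snd b) * g (snd c) (snd d))"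
    by (simp add: mult.assoc)
  also have "\<dots> = (if b = c then e (fst a) (fst d) * g (snd a) (snd d) else 0)"
    using ab cd by (auto simp: matrix_units_mult[OF e] matrix_units_mult[OF g] prod_eq_iff)
  finally show "e (fst a) (fst b) * g (snd a) (snd b) * (e (fst c) (fst d) * g (snd c) (snd d))
      = (if b = c then e (fst a) (fst d) * g (snd a) (snd d) else 0)" .
qed

lemma matrix_units_reindex:
  assumes "bij_betw h K I" and e: "matrix_units I e"
  shows "matrix_units K (\<lambda>a b. e (h a) (h b))"
proof -
  have K: "h a \<in> I" if "a \<in> K" for a using assms(1) that by (auto simp: bij_betw_def)
  have "h a = h b \<longleftrightarrow> a = b" if "a \<in> K" "b \<in> K" for a b
    using assms(1) that by (auto simp: bij_betw_def inj_on_def)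
  moreover have "(\<Sum>a\<in>K. e (h a) (h a)) = 1"
    using sum.reindex_bij_betw[OF assms(1), of "\<lambda>i. e i i"] matrix_units_sum[OF e] by simp
  moreover have "finite K" using assms bij_betw_finite matrix_units_finite by blast
  ultimately show ?thesis
    by (auto simp: matrix_units_def K matrix_units_mult[OF e] matrix_units_star[OF e])
qed

section \<open>Coordinates in the infinite tensor product\<close>

lemma uhf_eqI:
  assumes "\<And>f i. coord (rep_uhf x f) i = coord (rep_uhf y f) i"
  shows "x = y"
  by (intro rep_uhf_inject[THEN iffD1] blinfun_eqI ell2_eqI assms)

lemma rep_times [simp]: "rep_uhf (x * y) f = rep_uhf x (rep_uhf y f)"
  and rep_one [simp]: "rep_uhf 1 f = f"
  and coord_rep_zero [simp]: "coord (rep_uhf 0 f) i = 0"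
  and coord_rep_add [simp]: "coord (rep_uhf (x + y) f) i = coord (rep_uhf x f) i + coord (rep_uhf y f) i"
  and coord_rep_scaleC [simp]: "coord (rep_uhf (c *\<^sub>C x) f) i = c * coord (rep_uhf x f) i"
  by (simp_all add: times_uhf.rep_eq one_uhf.rep_eq zero_uhf.rep_eq plus_uhf.rep_eq
      scaleC_uhf.rep_eq zero_ell2.rep_eq plus_blinfun.rep_eq plus_ell2.rep_eq coord_cscale_op)

lemma coord_rep_sum: "coord (rep_uhf (sum g A) f) i = (\<Sum>a\<in>A. coord (rep_uhf (g a) f) i)"
  by (induction A rule: infinite_finite_induct) auto

lemma rep_factor:
  "k \<ge> 1 \<Longrightarrow> a \<in> carrier_mat (2 ^ k) (2 ^ k) \<Longrightarrow> rep_uhf (factor k a) = factor_op k a"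
  by (simp add: factor.rep_eq)

lemma upd_commute: "k \<noteq> l \<Longrightarrow> s < 2 ^ k \<Longrightarrow> t < 2 ^ l \<Longrightarrow> upd (upd i k s) l t = upd (upd i l t) k s"
  by (intro multi_index_eqI) (simp add: digit_upd fun_upd_twist)

lemma factor_commute:
  assumes "k \<noteq> l" "k \<ge> 1" "l \<ge> 1" "a \<in> carrier_mat (2 ^ k) (2 ^ k)" "b \<in> carrier_mat (2 ^ l) (2 ^ l)"
  shows "factor k a * factor l b = factor l b * factor k a"
proof (rule uhf_eqI)
  fix f i
  have "coord (rep_uhf (factor k a * factor l b) f) i =
    (\<Sum>s<2^k. \<Sum>t<2^l. a $$ (digit i k, s) * (b $$ (digit i l, t) * coord f (upd (upd i k s) l t)))"
    using assms by (simp add: rep_factor coord_factor_op sum_distrib_left digit_upd)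
  also have "\<dots> = (\<Sum>t<2^l. \<Sum>s<2^k. a $$ (digit i k, s) * (b $$ (digit i l, t) * coord f (upd (upd i k s) l t)))"
    by (rule sum.swap)
  also have "\<dots> = (\<Sum>t<2^l. \<Sum>s<2^k. b $$ (digit i l, t) * (a $$ (digit i k, s) * coord f (upd (upd i l t) k s)))"
    using assms(1) by (intro sum.cong refl) (simp add: upd_commute ac_simps)
  also have "\<dots> = coord (rep_uhf (factor l b * factor k a) f) i"
    using assms by (simp add: rep_factor coord_factor_op sum_distrib_left digit_upd)
  finally show "coord (rep_uhf (factor k a * factor l b) f) i = coord (rep_uhf (factor l b * factor k a) f) i" .
qed

lemma star_factor:
  assumes "k \<ge> 1" "a \<in> carrier_mat (2 ^ k) (2 ^ k)"
  shows "star (factor k a) = factor k (mat_adjoint a)"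
proof -
  have "mat_adjoint a \<in> carrier_mat (2 ^ k) (2 ^ k)"
    using assms(2) by (auto simp: mat_adjoint_def)
  moreover have "adjoint_pair (factor_op k a) (factor_op k (mat_adjoint a))"
    using factor_op_adjoint[OF assms(2)] by (simp add: adjoint_pair_def)
  ultimately show ?thesis
    using assms by (intro rep_uhf_inject[THEN iffD1]) (simp add: star_uhf.rep_eq rep_factor adjoint_op_eqI)
qed

definition unit_mat :: "nat \<Rightarrow> nat \<Rightarrow> nat \<Rightarrow> complex mat" where
  "unit_mat k r s = mat (2 ^ k) (2 ^ k) (\<lambda>(i, j). if i = r \<and> j = s then 1 else 0)"

definition unit_elem :: "nat \<Rightarrow> nat \<Rightarrow> nat \<Rightarrow> uhf" where
  "unit_elem k r s = factor k (unit_mat k r s)"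

lemma unit_mat_carrier [simp]: "unit_mat k r s \<in> carrier_mat (2 ^ k) (2 ^ k)"
  by (simp add: unit_mat_def)

lemma coord_unit_elem:
  assumes "k \<ge> 1" "r < 2 ^ k" "s < 2 ^ k"
  shows "coord (rep_uhf (unit_elem k r s) f) i = (if digit i k = r then coord f (upd i k s) else 0)"
proof -
  have "coord (rep_uhf (unit_elem k r s) f) i
      = (\<Sum>t<2^k. if t = s then (if digit i k = r then coord f (upd i k s) else 0) else 0)"
    unfolding unit_elem_def rep_factor[OF assms(1) unit_mat_carrier] coord_factor_op
    using assms by (intro sum.cong refl) (auto simp: unit_mat_def digit_less)
  then show ?thesis using assms by simp
qed

lemma unit_elem_mult:
  assumes "k \<ge> 1" "r < 2 ^ k" "s < 2 ^ k" "t < 2 ^ k" "u < 2 ^ k"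
  shows "unit_elem k r s * unit_elem k t u = (if s = t then unit_elem k r u else 0)"
  by (rule uhf_eqI) (use assms in \<open>simp add: coord_unit_elem digit_upd upd_upd\<close>)

lemma unit_elem_sum:
  assumes "k \<ge> 1"
  shows "(\<Sum>s<2^k. unit_elem k s s) = 1"
proof (rule uhf_eqI)
  fix f i
  have "coord (rep_uhf (\<Sum>s<2^k. unit_elem k s s) f) i = (\<Sum>s<2^k. if s = digit i k then coord f i else 0)"
    unfolding coord_rep_sum using assms by (intro sum.cong refl) (auto simp: coord_unit_elem upd_same)
  then show "coord (rep_uhf (\<Sum>s<2^k. unit_elem k s s) f) i = coord (rep_uhf 1 f) i"
    by (simp add: digit_less)
qed

lemma unit_elem_star: "k \<ge> 1 \<Longrightarrow> star (unit_elem k r s) = unit_elem k s r"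
proof -
  assume k: "k \<ge> 1"
  have "mat_adjoint (unit_mat k r s) = unit_mat k s r"
  proof (rule eq_matI)
    fix i j assume "i < dim_row (unit_mat k s r)" "j < dim_col (unit_mat k s r)"
    then show "mat_adjoint (unit_mat k r s) $$ (i, j) = unit_mat k s r $$ (i, j)"
      using mat_adjoint_index[OF unit_mat_carrier, of i k j r s] by (auto simp: unit_mat_def)
  qed (simp_all add: mat_adjoint_def unit_mat_def)
  then show ?thesis using k by (simp add: unit_elem_def star_factor)
qed

lemma matrix_units_unit_elem: "k \<ge> 1 \<Longrightarrow> matrix_units {..<2 ^ k} (unit_elem k)"
  by (auto simp: matrix_units_def unit_elem_mult unit_elem_sum unit_elem_star)

lemma unit_elem_compress:
  assumes "k \<ge> 1" "a \<in> carrier_mat (2 ^ k) (2 ^ k)" "r < 2 ^ k" "s < 2 ^ k"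
  shows "unit_elem k r r * factor k a * unit_elem k s s = a $$ (r, s) *\<^sub>C unit_elem k r s"
proof (rule uhf_eqI)
  fix f i
  have "coord (rep_uhf (factor k a * unit_elem k s s) f) j = a $$ (digit j k, s) * coord f (upd j k s)" for j
  proof -
    have "coord (rep_uhf (factor k a * unit_elem k s s) f) j
        = (\<Sum>t<2^k. if t = s then a $$ (digit j k, s) * coord f (upd j k s) else 0)"
      unfolding rep_times rep_factor[OF assms(1,2)] coord_factor_op
      using assms by (intro sum.cong refl) (auto simp: coord_unit_elem digit_upd upd_upd)
    then show ?thesis using assms by simp
  qed
  from this[of "upd i k r"] show "coord (rep_uhf (unit_elem k r r * factor k a * unit_elem k s s) f) i
      = coord (rep_uhf (a $$ (r, s) *\<^sub>C unit_elem k r s) f) i"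
    using assms by (simp add: coord_unit_elem digit_upd upd_upd)
qed

lemma beta_unit_elem:
  assumes "k \<ge> 1" "r < 2 ^ k" "s < 2 ^ k"
  shows "beta (unit_elem k r s) = (diag_sign k r * diag_sign k s) *\<^sub>C unit_elem k r s"
proof (rule uhf_eqI)
  fix f i
  let ?a = "Ad (sign_unitary k) (unit_mat k r s)"
  have a: "?a \<in> carrier_mat (2 ^ k) (2 ^ k)" using assms by (simp add: Ad_sign_unitary)
  have "coord (rep_uhf (beta (unit_elem k r s)) f) i = (\<Sum>t<2^k. ?a $$ (digit i k, t) * coord f (upd i k t))"
    unfolding unit_elem_def using assms a by (simp add: beta_factor rep_factor coord_factor_op)
  also have "\<dots> = (\<Sum>t<2^k. if t = s then (if digit i k = r then
      diag_sign k r * diag_sign k s * coord f (upd i k s) else 0) else 0)"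
    using assms by (intro sum.cong refl)
      (auto simp: Ad_sign_unitary digit_less unit_mat_def)
  finally show "coord (rep_uhf (beta (unit_elem k r s)) f) i
      = coord (rep_uhf ((diag_sign k r * diag_sign k s) *\<^sub>C unit_elem k r s) f) i"
    using assms by (simp add: coord_unit_elem)
qed

definition basis_vec :: "multi_index \<Rightarrow> multi_index ell2" where
  "basis_vec b = Abs_ell2 (\<lambda>i. if i = b then 1 else 0)"

lemma coord_basis_vec: "coord (basis_vec b) i = (if i = b then 1 else 0)"
proof -
  have "(\<lambda>i. (norm (if i = b then 1 else 0 :: complex))\<^sup>2) summable_on UNIV"
    by (rule finite_nonzero_values_imp_summable_on) (auto intro: finite_subset[of _ "{b}"])
  then show ?thesis by (simp add: basis_vec_def Abs_ell2_inverse)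
qed

lemma inner_cscale_basis_vec: "inner f (cscale c (basis_vec b)) = inner (coord f b) c"
proof -
  have "inner f (cscale c (basis_vec b)) = (\<Sum>\<^sub>\<infinity>i\<in>{b}. inner (coord f i) c)"
    unfolding inner_ell2_def
    by (rule infsum_cong_neutral) (auto simp: cscale.rep_eq coord_basis_vec)
  then show ?thesis by simp
qed

lemma norm_basis_vec: "norm (basis_vec b) = 1"
proof -
  have "cscale 1 (basis_vec b) = basis_vec b" by (rule ell2_eqI) (simp add: cscale.rep_eq)
  then have "inner (basis_vec b) (basis_vec b) = 1"
    using inner_cscale_basis_vec[of "basis_vec b" 1 b] by (simp add: coord_basis_vec)
  then show ?thesis by (simp add: norm_eq_sqrt_inner)
qed

lemma rep_star_adjoint: "inner (rep_uhf x f) g = inner f (rep_uhf (star x) g)"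
  using adjoint_op(2)[OF rep_uhf[of x]] by (simp add: adjoint_pair_def star_uhf.rep_eq)

text \<open>
  An element killing all basis vectors has an adjoint whose values are orthogonal to all of them. The
  inner product is only the real part of the complex one, so the multiples
  \<open>cscale c (basis_vec b)\<close> must be killed as well, which holds as elements are complex linear.
\<close>

lemma uhf_nonzero_basis_vec:
  assumes "x \<noteq> 0"
  shows "\<exists>b. rep_uhf x (basis_vec b) \<noteq> 0"
proof (rule ccontr)
  assume "\<not> ?thesis"
  then have z: "rep_uhf x (basis_vec b) = 0" for b by blast
  have "star x = 0"
  proof (rule uhf_eqI)
    fix g b
    have "inner (coord (rep_uhf (star x) g) b) c = 0" for c
    proof -
      have "rep_uhf x (cscale c (basis_vec b)) = cscale c (rep_uhf x (basis_vec b))"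
        using arg_cong[OF cscale_op_commute[OF rep_uhf[of x], of c], of "\<lambda>T. T (basis_vec b)"]
        by (simp add: cscale_op.rep_eq)
      also have "\<dots> = 0" unfolding z by (rule ell2_eqI) (simp add: cscale.rep_eq zero_ell2.rep_eq)
      finally show ?thesis
        using rep_star_adjoint[of x "cscale c (basis_vec b)" g]
        by (metis inner_cscale_basis_vec inner_commute inner_zero_left)
    qed
    from this[of "coord (rep_uhf (star x) g) b"]
    show "coord (rep_uhf (star x) g) b = coord (rep_uhf 0 g) b" by simp
  qed
  then show False using assms star_star[of x] by simp
qed

lemma dense_subring:
  fixes S :: "uhf set"
  assumes f: "\<And>k a. k \<ge> 1 \<Longrightarrow> a \<in> carrier_mat (2 ^ k) (2 ^ k) \<Longrightarrow> factor k a \<in> S"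
    and add: "\<And>x y. x \<in> S \<Longrightarrow> y \<in> S \<Longrightarrow> x + y \<in> S"
    and mult: "\<And>x y. x \<in> S \<Longrightarrow> y \<in> S \<Longrightarrow> x * y \<in> S"
  shows "x \<in> closure S"
proof (induction x rule: uhf_induct)
  case (factor k a)
  then show ?case using f closure_subset by blast
next
  case (add x y)
  then obtain X Y where "\<And>n. X n \<in> S" "X \<longlonglongrightarrow> x" "\<And>n. Y n \<in> S" "Y \<longlonglongrightarrow> y"
    unfolding closure_sequential by blast
  then show ?case unfolding closure_sequential
    by (intro exI[of _ "\<lambda>n. X n + Y n"]) (auto intro: assms tendsto_add)
next
  case (mult x y)
  then obtain X Y where "\<And>n. X n \<in> S" "X \<longlonglongrightarrow> x" "\<And>n. Y n \<in> S" "Y \<longlonglongrightarrow> y"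
    unfolding closure_sequential by blast
  then show ?case unfolding closure_sequential
    by (intro exI[of _ "\<lambda>n. X n * Y n"]) (auto intro: assms tendsto_mult)
next
  case closed
  then show ?case by simp
qed

section \<open>Matrix units of the finite tensor products\<close>

text \<open>
  In the presence of matrix units this says that \<open>x\<close> is a linear combination of them; the form
  with corners passes to sums, products and tensor products without mentioning coefficients.
\<close>

definition scalar_corners :: "'i set \<Rightarrow> ('i \<Rightarrow> 'i \<Rightarrow> 'a::unital_cstar_algebra) \<Rightarrow> 'a \<Rightarrow> bool" where
  "scalar_corners I e x \<longleftrightarrow> (\<forall>i\<in>I. \<forall>j\<in>I. \<exists>c. e i i * x * e j j = c *\<^sub>C e i j)"

lemma scalar_corners_add:
  assumes "scalar_corners I e x" "scalar_corners I e y"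
  shows "scalar_corners I e (x + y)"
  unfolding scalar_corners_def
proof (intro ballI)
  fix i j assume "i \<in> I" "j \<in> I"
  then obtain c d where "e i i * x * e j j = c *\<^sub>C e i j" "e i i * y * e j j = d *\<^sub>C e i j"
    using assms by (meson scalar_corners_def)
  then have "e i i * (x + y) * e j j = (c + d) *\<^sub>C e i j"
    by (simp add: distrib_left distrib_right scaleC_add_left)
  then show "\<exists>c. e i i * (x + y) * e j j = c *\<^sub>C e i j" ..
qed

lemma scalar_corners_mult:
  assumes e: "matrix_units I e" and x: "scalar_corners I e x" and y: "scalar_corners I e y"
  shows "scalar_corners I e (x * y)"
  unfolding scalar_corners_def
proof (intro ballI)
  fix i j assume ij: "i \<in> I" "j \<in> I"
  have "\<forall>k\<in>I. \<exists>c. e i i * x * e k k = c *\<^sub>C e i k" "\<forall>k\<in>I. \<exists>c. e k k * y * e j j = c *\<^sub>C e k j"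
    using x y ij by (auto simp: scalar_corners_def)
  from this[THEN bchoice] obtain c d where
    c: "\<And>k. k \<in> I \<Longrightarrow> e i i * x * e k k = c k *\<^sub>C e i k" and
    d: "\<And>k. k \<in> I \<Longrightarrow> e k k * y * e j j = d k *\<^sub>C e k j" by auto
  have "e i i * (x * y) * e j j = e i i * x * (\<Sum>k\<in>I. e k k) * y * e j j"
    by (simp add: matrix_units_sum[OF e] mult.assoc)
  also have "\<dots> = (\<Sum>k\<in>I. (e i i * x * e k k) * (e k k * y * e j j))"
    unfolding sum_distrib_left sum_distrib_right
  proof (intro sum.cong refl)
    fix k assume "k \<in> I"
    then have "e k k = e k k * e k k" by (simp add: matrix_units_mult[OF e])
    then show "e i i * x * e k k * y * e j j = e i i * x * e k k * (e k k * y * e j j)"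
      by (metis mult.assoc)
  qed
  also have "\<dots> = (\<Sum>k\<in>I. (c k * d k) *\<^sub>C e i j)"
    using ij by (intro sum.cong refl)
      (simp add: c d mult_scaleC_left mult_scaleC_right scaleC_scaleC matrix_units_mult[OF e] mult.commute)
  finally show "\<exists>c. e i i * (x * y) * e j j = c *\<^sub>C e i j"
    unfolding scaleC_sum_left[symmetric] ..
qed

lemma unit_elem_basis_vec:
  assumes "k \<ge> 1"
  shows "rep_uhf (unit_elem k (digit b k) (digit b k)) (basis_vec b) = basis_vec b"
proof (rule ell2_eqI)
  fix i
  have "upd i k (digit b k) = i" if "digit i k = digit b k" using that upd_same by metis
  then show "coord (rep_uhf (unit_elem k (digit b k) (digit b k)) (basis_vec b)) i = coord (basis_vec b) i"
    using assms by (auto simp: coord_unit_elem digit_less coord_basis_vec)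
qed

text \<open>
  \<open>e\<close> is a system of matrix units for the tensor product of the factors \<open>1, ..., m\<close>. The last
  condition ties it to the standard basis: every basis vector lies in the range of a minimal
  projection, so that a vector on which an element is large picks out a corner of the element.
\<close>

definition local_units :: "nat \<Rightarrow> nat set \<Rightarrow> (nat \<Rightarrow> nat \<Rightarrow> uhf) \<Rightarrow> bool" where
  "local_units m I e \<longleftrightarrow> matrix_units I e \<and>
     (\<forall>k a. 1 \<le> k \<and> k \<le> m \<and> a \<in> carrier_mat (2 ^ k) (2 ^ k) \<longrightarrow> scalar_corners I e (factor k a)) \<and>
     (\<forall>k a. m < k \<and> a \<in> carrier_mat (2 ^ k) (2 ^ k) \<longrightarrow>
        (\<forall>i\<in>I. \<forall>j\<in>I. factor k a * e i j = e i j * factor k a)) \<and>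
     (\<forall>b. \<exists>i\<in>I. rep_uhf (e i i) (basis_vec b) = basis_vec b)"

lemma local_units_matrix_units: "local_units m I e \<Longrightarrow> matrix_units I e"
  by (simp add: local_units_def)

lemma local_units_scalar:
  assumes "local_units m I e" "1 \<le> k" "k \<le> m" "a \<in> carrier_mat (2 ^ k) (2 ^ k)"
  shows "scalar_corners I e (factor k a)"
  using assms by (simp add: local_units_def)

lemma local_units_commute:
  assumes "local_units m I e" "m < k" "a \<in> carrier_mat (2 ^ k) (2 ^ k)" "i \<in> I" "j \<in> I"
  shows "factor k a * e i j = e i j * factor k a"
  using assms unfolding local_units_def by blast

lemma local_units_fix:
  assumes "local_units m I e"
  obtains i where "i \<in> I" "rep_uhf (e i i) (basis_vec b) = basis_vec b"
  using assms unfolding local_units_def by blast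

text \<open>
  Induction on the number of factors: the matrix units of the next factor commute with the earlier
  ones, and the products of both form the next system. The pairs of indices are encoded as natural
  numbers to keep the index type fixed.
\<close>

lemma local_units_exist: "\<exists>I e. local_units m I e"
proof (induction m)
  case 0
  have "local_units 0 {0} (\<lambda>_ _. 1)"
    by (auto simp: local_units_def matrix_units_def)
  then show ?case by blast
next
  case (Suc m)
  then obtain I e where L: "local_units m I e" by blast
  then have e: "matrix_units I e" by (simp add: local_units_def)
  let ?k = "Suc m"
  let ?u = "unit_elem ?k"
  define J where "J = {..<(2::nat) ^ ?k}"
  have u: "matrix_units J ?u" unfolding J_def by (rule matrix_units_unit_elem) simp
  have comm: "e i j * ?u r s = ?u r s * e i j" if "i \<in> I" "j \<in> I" for i j r s
    using local_units_commute[OF L lessI unit_mat_carrier that] by (simp add: unit_elem_def)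
  define K where "K = prod_encode ` (I \<times> J)"
  define g where "g a b = e (fst (prod_decode a)) (fst (prod_decode b))
    * ?u (snd (prod_decode a)) (snd (prod_decode b))" for a b
  have bij: "bij_betw prod_decode K (I \<times> J)"
    by (auto simp: K_def bij_betw_def inj_on_def image_image)
  have mu: "matrix_units K g"
    using matrix_units_reindex[OF bij matrix_units_tensor[OF e u]] comm
    unfolding g_def by (simp add: g_def[abs_def])
  have g: "g (prod_encode (i, r)) (prod_encode (j, s)) = e i j * ?u r s" for i j r s
    by (simp add: g_def)
  have "scalar_corners K g (factor k a)"
    if k: "1 \<le> k" "k \<le> ?k" and a: "a \<in> carrier_mat (2 ^ k) (2 ^ k)" for k a
    unfolding scalar_corners_def K_def
  proof safe
    fix i r j s assume I: "i \<in> I" "j \<in> I" and J: "r \<in> J" "s \<in> J"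
    show "\<exists>c. g (prod_encode (i, r)) (prod_encode (i, r)) * factor k a * g (prod_encode (j, s)) (prod_encode (j, s))
        = c *\<^sub>C g (prod_encode (i, r)) (prod_encode (j, s))"
    proof (cases "k \<le> m")
      case True
      then obtain c where c: "e i i * factor k a * e j j = c *\<^sub>C e i j"
        using local_units_scalar[OF L k(1) _ a] I by (meson scalar_corners_def)
      have uf: "?u r r * factor k a = factor k a * ?u r r"
        unfolding unit_elem_def by (rule factor_commute[OF _ _ _ unit_mat_carrier a]) (use True k in auto)
      have "e i i * ?u r r * factor k a * (e j j * ?u s s) = e i i * (?u r r * factor k a) * (e j j * ?u s s)"
        by (simp add: mult.assoc)
      also have "\<dots> = e i i * factor k a * (?u r r * e j j) * ?u s s"
        by (simp add: mult.assoc uf)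
      also have "\<dots> = (e i i * factor k a * e j j) * (?u r r * ?u s s)"
        by (simp add: mult.assoc comm[OF I(2,2), symmetric])
      also have "\<dots> = (if r = s then c else 0) *\<^sub>C (e i j * ?u r s)"
        using J by (simp add: c mult_scaleC_left matrix_units_mult[OF u])
      finally show ?thesis unfolding g by blast
    next
      case False
      then have km: "k = ?k" using k by simp
      have ef: "factor k a * e j j = e j j * factor k a"
        using local_units_commute[OF L _ a I(2,2)] km by simp
      have "e i i * ?u r r * factor k a * (e j j * ?u s s) = e i i * ?u r r * (factor k a * e j j) * ?u s s"
        by (simp add: mult.assoc)
      also have "\<dots> = e i i * (?u r r * e j j) * factor k a * ?u s s"
        by (simp add: mult.assoc ef)
      also have "\<dots> = (e i i * e j j) * (?u r r * factor k a * ?u s s)"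
        by (simp add: mult.assoc comm[OF I(2,2), symmetric])
      also have "\<dots> = (if i = j then a $$ (r, s) else 0) *\<^sub>C (e i j * ?u r s)"
        using J I a km
        by (simp add: unit_elem_compress J_def matrix_units_mult[OF e] mult_scaleC_right)
      finally show ?thesis unfolding g by blast
    qed
  qed
  moreover have "factor k a * g x y = g x y * factor k a"
    if k: "?k < k" and a: "a \<in> carrier_mat (2 ^ k) (2 ^ k)" and "x \<in> K" "y \<in> K" for k a x y
  proof -
    obtain i r j s where xy: "x = prod_encode (i, r)" "y = prod_encode (j, s)"
      and I: "i \<in> I" "j \<in> I" using \<open>x \<in> K\<close> \<open>y \<in> K\<close> by (auto simp: K_def)
    have "factor k a * e i j = e i j * factor k a" using local_units_commute[OF L _ a I] k by simp
    moreover have "factor k a * ?u r s = ?u r s * factor k a"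
      unfolding unit_elem_def by (rule factor_commute[OF _ _ _ a unit_mat_carrier]) (use k in auto)
    ultimately show ?thesis unfolding xy g by (metis mult.assoc)
  qed
  moreover have "\<exists>x\<in>K. rep_uhf (g x x) (basis_vec b) = basis_vec b" for b
  proof -
    obtain i where i: "i \<in> I" "rep_uhf (e i i) (basis_vec b) = basis_vec b"
      by (rule local_units_fix[OF L])
    have "rep_uhf (?u (digit b ?k) (digit b ?k)) (basis_vec b) = basis_vec b"
      by (rule unit_elem_basis_vec) simp
    then have "rep_uhf (g (prod_encode (i, digit b ?k)) (prod_encode (i, digit b ?k))) (basis_vec b) = basis_vec b"
      unfolding g by (simp add: i)
    moreover have "prod_encode (i, digit b ?k) \<in> K"
      using i digit_less[of b ?k] by (auto simp: K_def J_def)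
    ultimately show ?thesis by blast
  qed
  ultimately have "local_units ?k K g" using mu unfolding local_units_def by blast
  then show ?case by blast
qed

text \<open>
  This set contains the tensor product of the first \<open>n\<close> factors; it is described by the two
  properties of that subalgebra that the proof uses.
\<close>

definition local_up_to :: "nat \<Rightarrow> uhf set" where
  "local_up_to n = {x.
     (\<forall>m\<ge>n. \<forall>I e. local_units m I e \<longrightarrow> scalar_corners I e x) \<and>
     (\<forall>k>n. \<forall>a\<in>carrier_mat (2 ^ k) (2 ^ k). factor k a * x = x * factor k a)}"

lemma local_up_to_scalar:
  assumes "x \<in> local_up_to n" "n \<le> m" "local_units m I e"
  shows "scalar_corners I e x"
  using assms unfolding local_up_to_def by blast

lemma local_up_to_commute:
  assumes "x \<in> local_up_to n" "n < k" "a \<in> carrier_mat (2 ^ k) (2 ^ k)"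
  shows "factor k a * x = x * factor k a"
  using assms unfolding local_up_to_def by blast

lemma local_up_to_mono:
  assumes "x \<in> local_up_to n" "n \<le> m"
  shows "x \<in> local_up_to m"
  unfolding local_up_to_def
proof (intro CollectI conjI allI ballI impI)
  show "scalar_corners I e x" if "m \<le> k" "local_units k I e" for k I e
    by (rule local_up_to_scalar[OF assms(1) _ that(2)]) (use assms(2) that(1) in simp)
  show "factor k a * x = x * factor k a" if "m < k" "a \<in> carrier_mat (2 ^ k) (2 ^ k)" for k a
    by (rule local_up_to_commute[OF assms(1) _ that(2)]) (use assms(2) that(1) in simp)
qed

lemma local_elements_dense:
  assumes "\<epsilon> > 0"
  shows "\<exists>n. \<exists>y\<in>local_up_to n. norm (x - y) < \<epsilon>"
proof -
  have "x \<in> closure (\<Union>n. local_up_to n)"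
  proof (rule dense_subring)
    fix k :: nat and a :: "complex mat" assume k: "k \<ge> 1" and a: "a \<in> carrier_mat (2 ^ k) (2 ^ k)"
    have "factor k a \<in> local_up_to k"
      unfolding local_up_to_def using k a by (auto intro: local_units_scalar factor_commute)
    then show "factor k a \<in> (\<Union>n. local_up_to n)" by blast
  next
    fix x y assume "x \<in> (\<Union>n. local_up_to n)" "y \<in> (\<Union>n. local_up_to n)"
    then obtain m n where "x \<in> local_up_to m" "y \<in> local_up_to n" by blast
    then have x: "x \<in> local_up_to (max m n)" and y: "y \<in> local_up_to (max m n)"
      by (auto intro: local_up_to_mono)
    have "x + y \<in> local_up_to (max m n)"
      unfolding local_up_to_def
    proof (intro CollectI conjI allI ballI impI)
      fix k I e assume "max m n \<le> k" "local_units k I e"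
      then show "scalar_corners I e (x + y)"
        by (intro scalar_corners_add local_up_to_scalar[OF x] local_up_to_scalar[OF y])
    next
      fix k and a :: "complex mat" assume ka: "max m n < k" "a \<in> carrier_mat (2 ^ k) (2 ^ k)"
      show "factor k a * (x + y) = (x + y) * factor k a"
        by (simp only: distrib_left distrib_right local_up_to_commute[OF x ka] local_up_to_commute[OF y ka])
    qed
    then show "x + y \<in> (\<Union>n. local_up_to n)" by blast
    have "x * y \<in> local_up_to (max m n)"
      unfolding local_up_to_def
    proof (intro CollectI conjI allI ballI impI)
      fix k I e assume "max m n \<le> k" "local_units k I e"
      then show "scalar_corners I e (x * y)"
        by (intro scalar_corners_mult local_up_to_scalar[OF x] local_up_to_scalar[OF y]
            local_units_matrix_units)
    next
      fix k and a :: "complex mat" assume ka: "max m n < k" "a \<in> carrier_mat (2 ^ k) (2 ^ k)"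
      from local_up_to_commute[OF x ka] local_up_to_commute[OF y ka]
      show "factor k a * (x * y) = x * y * factor k a" by (metis mult.assoc)
    qed
    then show "x * y \<in> (\<Union>n. local_up_to n)" by blast
  qed
  then show ?thesis using assms unfolding closure_approachable
    by (fastforce simp: dist_norm norm_minus_commute)
qed

section \<open>Cutting a nonzero element down to a minimal projection\<close>

definition vec_state :: "multi_index \<Rightarrow> uhf \<Rightarrow> real" where
  "vec_state b x = inner (rep_uhf x (basis_vec b)) (basis_vec b)"

lemma vec_state_add: "vec_state b (x + y) = vec_state b x + vec_state b y"
  by (simp add: vec_state_def plus_uhf.rep_eq plus_blinfun.rep_eq inner_add_left)

lemma vec_state_scaleR: "vec_state b (r *\<^sub>R x) = r * vec_state b x"
  by (simp add: vec_state_def scaleR_uhf.rep_eq scaleR_blinfun.rep_eq)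

lemma vec_state_bound: "\<bar>vec_state b x\<bar> \<le> norm x"
proof -
  have "\<bar>vec_state b x\<bar> \<le> norm (rep_uhf x (basis_vec b)) * norm (basis_vec b)"
    unfolding vec_state_def by (rule Cauchy_Schwarz_ineq2)
  also have "\<dots> \<le> norm x"
    using norm_blinfun[of "rep_uhf x" "basis_vec b"] by (simp add: norm_basis_vec norm_uhf.rep_eq)
  finally show ?thesis .
qed

lemma vec_state_star_mult: "vec_state b (star x * x) = (norm (rep_uhf x (basis_vec b)))\<^sup>2"
  using rep_star_adjoint[of "star x" "rep_uhf x (basis_vec b)" "basis_vec b"]
  by (simp add: vec_state_def star_star power2_norm_eq_inner)

text \<open>
  The step from which simplicity, faithfulness of the trace and comparison all follow. Choose a basis
  vector \<open>b\<close> with \<open>x b \<noteq> 0\<close>, put \<open>y = star x * x\<close> and let \<open>p\<close> be the minimal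
  projection fixing \<open>b\<close>. If \<open>y\<close> is close to a local element, then \<open>p * y * p\<close> is close to a
  multiple of \<open>p\<close>, and the vector state at \<open>b\<close> shows that the factor is about the square of the
  norm of \<open>x b\<close>. So the corner can be normalized. The bound for the distance to the local
  element does not depend on the size of \<open>p\<close>, which shrinks as \<open>m\<close> grows.
\<close>

lemma excision:
  assumes "x \<noteq> 0"
  shows "\<exists>m0. \<forall>m\<ge>m0. \<forall>I e. local_units m I e \<longrightarrow>
    (\<exists>i\<in>I. \<exists>c. e i i * c = c \<and> star (x * c) * (x * c) = e i i)"
proof -
  obtain b where b: "rep_uhf x (basis_vec b) \<noteq> 0" using uhf_nonzero_basis_vec[OF assms] by blast
  define l where "l = (norm (rep_uhf x (basis_vec b)))\<^sup>2"
  have l: "l > 0" using b by (simp add: l_def)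
  define y where "y = star x * x"
  have sy: "star y = y" by (simp add: y_def star_mult star_star)
  obtain m0 y' where y': "y' \<in> local_up_to m0" "norm (y - y') < l / 2"
    using local_elements_dense[of "l / 2" y] l by auto
  have "\<exists>i\<in>I. \<exists>c. e i i * c = c \<and> star (x * c) * (x * c) = e i i"
    if m: "m \<ge> m0" and L: "local_units m I e" for m I e
  proof -
    have e: "matrix_units I e" by (rule local_units_matrix_units[OF L])
    obtain i where i: "i \<in> I" "rep_uhf (e i i) (basis_vec b) = basis_vec b"
      by (rule local_units_fix[OF L])
    define p where "p = e i i"
    have p: "projection p" using matrix_units_projection[OF e i(1)] by (simp add: p_def)
    then have sp: "star p = p" and np: "norm p \<le> 1"
      by (auto simp: projection_def norm_projection_le_1)
    obtain c where c: "p * y' * p = c *\<^sub>C p"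
      using local_up_to_scalar[OF y'(1) m L] i unfolding scalar_corners_def p_def by blast
    define z where "z = p * y * p - c *\<^sub>C p"
    have "z = p * (y - y') * p" by (simp add: z_def c[symmetric] algebra_simps)
    also have "norm \<dots> \<le> norm p * norm (y - y') * norm p"
      by (rule order_trans[OF norm_mult_ineq mult_right_mono[OF norm_mult_ineq norm_ge_zero]])
    also have "\<dots> \<le> 1 * norm (y - y') * 1"
      using np by (intro mult_mono) auto
    finally have z: "norm z < l / 2" using y'(2) by simp
    \<comment> \<open>The compression is self-adjoint, so taking the real part of \<open>c\<close> costs nothing.\<close>
    define w where "w = p * y * p - Re c *\<^sub>R p"
    have "c *\<^sub>C p + cnj c *\<^sub>C p = (2 * Re c) *\<^sub>R p"
      unfolding scaleC_add_left[symmetric] complex_add_cnj scaleC_of_real ..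
    then have "2 *\<^sub>R w = z + star z"
      by (simp add: w_def z_def star_diff star_mult star_scaleC sp sy mult.assoc scaleR_diff_right scaleR_2)
        (simp add: algebra_simps)
    then have "2 * norm w \<le> norm z + norm (star z)"
      by (metis norm_triangle_ineq norm_scaleR abs_numeral)
    then have w: "norm w < l / 2" using z by simp
    have "vec_state b (p * y * p) = vec_state b (star (x * p) * (x * p))"
      by (simp add: y_def star_mult sp mult.assoc)
    also have "\<dots> = l" unfolding vec_state_star_mult using i by (simp add: l_def p_def)
    finally have "vec_state b (p * y * p) = l" .
    moreover have "vec_state b p = 1"
      using i norm_basis_vec[of b] by (simp add: vec_state_def p_def norm_eq_1)
    ultimately have "l = vec_state b w + Re c"
      using vec_state_add[of b w "Re c *\<^sub>R p"] by (simp add: w_def vec_state_scaleR)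
    then have lc: "\<bar>Re c - l\<bar> < l / 2" using vec_state_bound[of b w] w by linarith
    have "p * y * p - l *\<^sub>R p = w + (Re c - l) *\<^sub>R p" by (simp add: w_def scaleR_diff_left)
    also have "norm \<dots> \<le> norm w + \<bar>Re c - l\<bar> * norm p" using norm_triangle_ineq by (metis norm_scaleR)
    also have "\<dots> \<le> norm w + \<bar>Re c - l\<bar>" using np by (simp add: mult_left_le)
    also have "\<dots> < l" using w lc by linarith
    finally obtain d where "p * d = d" "star d * y * d = p"
      using corner_normalize[OF p sy l] by blast
    then show ?thesis using i(1) by (auto simp: y_def p_def star_mult mult.assoc)
  qed
  then show ?thesis by blast
qed

text \<open>
  By excision an ideal containing \<open>x \<noteq> 0\<close> contains a minimal projection of some finite stage, hence
  all minimal projections of that stage and their sum 1.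
\<close>

theorem simple_uhf: "simple_cstar TYPE(uhf)"
  unfolding simple_cstar_def
proof (intro allI impI, elim conjE)
  fix S :: "uhf set"
  assume z: "0 \<in> S" and add: "\<forall>x\<in>S. \<forall>y\<in>S. x + y \<in> S"
    and ideal: "\<forall>x\<in>S. \<forall>a. a * x \<in> S \<and> x * a \<in> S"
  show "S = {0} \<or> S = UNIV"
  proof (rule disjCI)
    assume "S \<noteq> UNIV"
    show "S = {0}"
    proof (rule ccontr)
      assume "S \<noteq> {0}"
      then obtain x where x: "x \<in> S" "x \<noteq> 0" using z by blast
      obtain m I e where L: "local_units m I e"
        and ex: "\<exists>i\<in>I. \<exists>c. e i i * c = c \<and> star (x * c) * (x * c) = e i i"
        using excision[OF x(2)] local_units_exist by (metis order_refl)
      then obtain i c where i: "i \<in> I" "star (x * c) * (x * c) = e i i" by blast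
      have e: "matrix_units I e" by (rule local_units_matrix_units[OF L])
      have eS: "e j j \<in> S" if "j \<in> I" for j
      proof -
        have "e i i \<in> S" using i(2) ideal x(1) by metis
        moreover have "e j i * e i i * e i j = e j j" using that i by (simp add: matrix_units_mult[OF e])
        ultimately show ?thesis using ideal by metis
      qed
      have "(\<Sum>j\<in>J. e j j) \<in> S" if "finite J" "J \<subseteq> I" for J
        using that by (induction J) (use z add eS in auto)
      then have "1 \<in> S" using matrix_units_sum[OF e] matrix_units_finite[OF e] by (metis order_refl)
      then have "S = UNIV" using ideal by (metis UNIV_eq_I mult_1_right)
      then show False using \<open>S \<noteq> UNIV\<close> by simp
    qed
  qed
qed

section \<open>Asymptotic trace and stable finiteness\<close>

lemma scalar_corners_expand:
  assumes e: "matrix_units I e" and x: "scalar_corners I e x"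
  obtains c where "x = (\<Sum>k\<in>I. \<Sum>l\<in>I. c k l *\<^sub>C e k l)"
proof -
  have "\<forall>k\<in>I. \<forall>l\<in>I. \<exists>c. e k k * x * e l l = c *\<^sub>C e k l" using x by (simp add: scalar_corners_def)
  then obtain c where c: "\<And>k l. k \<in> I \<Longrightarrow> l \<in> I \<Longrightarrow> e k k * x * e l l = c k l *\<^sub>C e k l"
    by metis
  have "x = (\<Sum>k\<in>I. e k k) * x * (\<Sum>l\<in>I. e l l)" by (simp add: matrix_units_sum[OF e])
  also have "\<dots> = (\<Sum>k\<in>I. \<Sum>l\<in>I. c k l *\<^sub>C e k l)"
    by (subst sum.swap) (simp add: sum_distrib_left sum_distrib_right c)
  finally show ?thesis by (rule that)
qed

text \<open>
  The map \<open>x \<mapsto> (\<Sum>j. e i j * x * e j i)\<close> is a multiple of the conditional expectation onto the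
  relative commutant of the matrix units, compressed to one corner; so it has the trace property for
  elements of the matrix algebra against arbitrary ones.
\<close>

lemma corner_average_commute:
  assumes e: "matrix_units I e" and x: "scalar_corners I e x" and i: "i \<in> I"
  shows "(\<Sum>j\<in>I. e i j * (x * y) * e j i) = (\<Sum>j\<in>I. e i j * (y * x) * e j i)"
proof -
  have fin: "finite I" by (rule matrix_units_finite[OF e])
  obtain c where c: "x = (\<Sum>k\<in>I. \<Sum>l\<in>I. c k l *\<^sub>C e k l)" by (rule scalar_corners_expand[OF e x])
  have unit: "(\<Sum>j\<in>I. e i j * (e k l * y) * e j i) = (\<Sum>j\<in>I. e i j * (y * e k l) * e j i)"
    if "k \<in> I" "l \<in> I" for k l
  proof -
    have "(\<Sum>j\<in>I. e i j * (e k l * y) * e j i) = (\<Sum>j\<in>I. if j = k then e i l * y * e k i else 0)"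
      using that i by (intro sum.cong refl)
        (auto simp: mult.assoc[symmetric] matrix_units_mult[OF e])
    also have "\<dots> = (\<Sum>j\<in>I. if j = l then e i l * y * e k i else 0)" using fin that by simp
    also have "\<dots> = (\<Sum>j\<in>I. e i j * (y * e k l) * e j i)"
      using that i by (intro sum.cong refl) (auto simp: mult.assoc matrix_units_mult[OF e])
    finally show ?thesis .
  qed
  have "(\<Sum>j\<in>I. e i j * (x * y) * e j i)
      = (\<Sum>j\<in>I. \<Sum>k\<in>I. \<Sum>l\<in>I. c k l *\<^sub>C (e i j * (e k l * y) * e j i))"
    unfolding c by (simp add: sum_distrib_left sum_distrib_right mult_scaleC_left mult_scaleC_right)
  also have "\<dots> = (\<Sum>k\<in>I. \<Sum>l\<in>I. \<Sum>j\<in>I. c k l *\<^sub>C (e i j * (e k l * y) * e j i))"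
    by (subst sum.swap) (intro sum.cong refl sum.swap)
  also have "\<dots> = (\<Sum>k\<in>I. \<Sum>l\<in>I. c k l *\<^sub>C (\<Sum>j\<in>I. e i j * (e k l * y) * e j i))"
    by (simp add: scaleC_sum_right)
  also have "\<dots> = (\<Sum>k\<in>I. \<Sum>l\<in>I. c k l *\<^sub>C (\<Sum>j\<in>I. e i j * (y * e k l) * e j i))"
    by (simp add: unit)
  also have "\<dots> = (\<Sum>k\<in>I. \<Sum>l\<in>I. \<Sum>j\<in>I. c k l *\<^sub>C (e i j * (y * e k l) * e j i))"
    by (simp add: scaleC_sum_right)
  also have "\<dots> = (\<Sum>j\<in>I. \<Sum>k\<in>I. \<Sum>l\<in>I. c k l *\<^sub>C (e i j * (y * e k l) * e j i))"
    by (subst (2) sum.swap) (intro sum.cong refl sum.swap)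
  also have "\<dots> = (\<Sum>j\<in>I. e i j * (y * x) * e j i)"
    unfolding c by (simp add: sum_distrib_left sum_distrib_right mult_scaleC_left mult_scaleC_right)
  finally show ?thesis .
qed

text \<open>
  A sequence of states that become tracial in the limit stands in for the trace of the algebra: an
  element of trace zero is one whose values \<open>T m x\<close> form a null sequence. The values are real because
  only the real parts of the states are kept.
\<close>

locale asymptotic_trace =
  fixes T :: "nat \<Rightarrow> uhf \<Rightarrow> real"
  assumes T_add: "T m (x + y) = T m x + T m y"
    and T_scaleR: "T m (r *\<^sub>R x) = r * T m x"
    and T_bound: "\<bar>T m x\<bar> \<le> norm x"
    and T_positive: "0 \<le> T m (star x * x)"
    and T_one: "T m 1 = 1"
    and T_commute: "(\<lambda>m. T m (x * y) - T m (y * x)) \<longlonglongrightarrow> 0"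

text \<open>
  \<open>T m\<close> averages a vector state over the matrix units of the first \<open>m\<close> factors. It is exactly
  tracial against elements local up to \<open>m\<close>, and these are dense.
\<close>

lemma asymptotic_trace_exists: "\<exists>T. asymptotic_trace T"
proof -
  fix b :: multi_index
  have "\<forall>m. \<exists>I e i. local_units m I e \<and> i \<in> I \<and> rep_uhf (e i i) (basis_vec b) = basis_vec b"
    using local_units_exist local_units_fix by metis
  then obtain I e i where L: "\<And>m. local_units m (I m) (e m)" and i: "\<And>m. i m \<in> I m"
    and fixed: "\<And>m. rep_uhf (e m (i m) (i m)) (basis_vec b) = basis_vec b"
    by metis
  have e: "matrix_units (I m) (e m)" for m by (rule local_units_matrix_units[OF L])
  have card: "card (I m) > 0" for m
    using i[of m] matrix_units_finite[OF e] by (auto simp: card_gt_0_iff)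
  define T where "T m x = (\<Sum>j\<in>I m. vec_state b (e m (i m) j * x * e m j (i m))) / card (I m)" for m x
  have T_sum: "T m x = vec_state b (\<Sum>j\<in>I m. e m (i m) j * x * e m j (i m)) / card (I m)" for m x
  proof -
    have "vec_state b 0 = 0" using vec_state_scaleR[of b 0 0] by simp
    then have "vec_state b (sum f A) = (\<Sum>j\<in>A. vec_state b (f j))" for f :: "nat \<Rightarrow> uhf" and A
      by (induction A rule: infinite_finite_induct) (auto simp: vec_state_add)
    then show ?thesis by (simp add: T_def)
  qed
  have add: "T m (x + y) = T m x + T m y" for m x y
    by (simp add: T_def distrib_left distrib_right vec_state_add sum.distrib add_divide_distrib)
  have scale: "T m (r *\<^sub>R x) = r * T m x" for m r x
    by (simp add: T_def vec_state_scaleR sum_distrib_left)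
  have bound: "\<bar>T m x\<bar> \<le> norm x" for m x
  proof -
    have n1: "norm (e m j k) \<le> 1" if "j \<in> I m" "k \<in> I m" for j k
    proof -
      have "(norm (e m j k))\<^sup>2 = norm (e m k k)"
        using cstar_identity[of "e m j k"] that by (simp add: matrix_units_star[OF e] matrix_units_mult[OF e])
      also have "\<dots> \<le> 1\<^sup>2" using norm_projection_le_1[OF matrix_units_projection[OF e that(2)]] by simp
      finally show ?thesis by (rule power2_le_imp_le) simp
    qed
    have "\<bar>vec_state b (e m (i m) j * x * e m j (i m))\<bar> \<le> norm x" if "j \<in> I m" for j
    proof -
      have "\<bar>vec_state b (e m (i m) j * x * e m j (i m))\<bar> \<le> norm (e m (i m) j * x * e m j (i m))"
        by (rule vec_state_bound)
      also have "\<dots> \<le> norm (e m (i m) j) * norm x * norm (e m j (i m))"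
        by (rule order_trans[OF norm_mult_ineq mult_right_mono[OF norm_mult_ineq norm_ge_zero]])
      also have "\<dots> \<le> 1 * norm x * 1" using n1 i that by (intro mult_mono) auto
      finally show ?thesis by simp
    qed
    then have "\<bar>\<Sum>j\<in>I m. vec_state b (e m (i m) j * x * e m j (i m))\<bar> \<le> (\<Sum>j\<in>I m. norm x)"
      by (intro order_trans[OF sum_abs sum_mono])
    then show ?thesis using card[of m] by (simp add: T_def field_simps)
  qed
  have pos: "0 \<le> T m (star x * x)" for m x
  proof -
    have "0 \<le> vec_state b (e m (i m) j * (star x * x) * e m j (i m))" if "j \<in> I m" for j
    proof -
      have "e m (i m) j * (star x * x) * e m j (i m) = star (x * e m j (i m)) * (x * e m j (i m))"
        using that i by (simp add: star_mult matrix_units_star[OF e] mult.assoc)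
      then show ?thesis by (simp add: vec_state_star_mult)
    qed
    then show ?thesis unfolding T_def by (intro divide_nonneg_nonneg sum_nonneg) auto
  qed
  have one: "T m 1 = 1" for m
  proof -
    have "vec_state b (e m (i m) (i m)) = 1"
      using norm_basis_vec[of b] by (simp add: vec_state_def fixed norm_eq_1)
    then show ?thesis using i[of m] card[of m] by (simp add: T_def matrix_units_mult[OF e])
  qed
  have commute: "(\<lambda>m. T m (x * y) - T m (y * x)) \<longlonglongrightarrow> 0" for x y
  proof (rule LIMSEQ_I)
    fix r :: real assume "r > 0"
    \<comment> \<open>Replacing \<open>x\<close> by a local element changes both traces by at most \<open>\<epsilon> * norm y\<close>.\<close>
    define \<epsilon> where "\<epsilon> = r / (2 * norm y + 1)"
    have n: "2 * norm y + 1 > 0" using norm_ge_zero[of y] by linarith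
    obtain n x' where x': "x' \<in> local_up_to n" "norm (x - x') < \<epsilon>"
      using local_elements_dense[of \<epsilon> x] \<open>r > 0\<close> n by (auto simp: \<epsilon>_def)
    have "norm (T m (x * y) - T m (y * x) - 0) < r" if "m \<ge> n" for m
    proof -
      have "T m (x' * y) = T m (y * x')"
        unfolding T_sum corner_average_commute[OF e local_up_to_scalar[OF x'(1) that L] i] ..
      then have "T m (x * y) - T m (y * x) = T m ((x - x') * y) - T m (y * (x - x'))"
        using add[of m "(x - x') * y" "x' * y"] add[of m "y * (x - x')" "y * x'"]
        by (simp add: algebra_simps)
      moreover have "norm ((x - x') * y) \<le> norm (x - x') * norm y"
        "norm (y * (x - x')) \<le> norm (x - x') * norm y"
        using norm_mult_ineq[of "x - x'" y] norm_mult_ineq[of y "x - x'"] by (simp_all add: mult.commute)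
      ultimately have "\<bar>T m (x * y) - T m (y * x)\<bar> \<le> norm (x - x') * (2 * norm y)"
        using bound[of m "(x - x') * y"] bound[of m "y * (x - x')"] by linarith
      also have "\<dots> \<le> norm (x - x') * (2 * norm y + 1)" by (intro mult_left_mono) auto
      also have "\<dots> < \<epsilon> * (2 * norm y + 1)" using x'(2) n by (intro mult_strict_right_mono)
      also have "\<dots> = r" using n by (simp add: \<epsilon>_def)
      finally show ?thesis by simp
    qed
    then show "\<exists>no. \<forall>m\<ge>no. norm (T m (x * y) - T m (y * x) - 0) < r" by blast
  qed
  have "asymptotic_trace T"
    by unfold_locales (fact add scale bound pos one commute)+
  then show "\<exists>T. asymptotic_trace T" by (rule exI[where x = T])
qed

context asymptotic_trace
begin

lemma T_zero: "T m 0 = 0"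
  using T_scaleR[of m 0 0] by simp

lemma T_diff: "T m (x - y) = T m x - T m y"
  using T_add[of m "x - y" y] by simp

lemma T_sum: "T m (sum f A) = (\<Sum>a\<in>A. T m (f a))"
  by (induction A rule: infinite_finite_induct) (auto simp: T_add T_zero)

lemma T_mono:
  assumes "cstar_le x y"
  shows "T m x \<le> T m y"
proof -
  obtain z where "y - x = star z * z" using assms by (auto simp: cstar_le_def positive_def)
  then have "0 \<le> T m (y - x)" by (simp add: T_positive)
  then show ?thesis by (simp add: T_diff)
qed

lemma T_commute_null:
  assumes "(\<lambda>m. T m (y * x)) \<longlonglongrightarrow> 0"
  shows "(\<lambda>m. T m (x * y)) \<longlonglongrightarrow> 0"
  using tendsto_add[OF T_commute[of x y] assms] by simp

text \<open>
  By excision some minimal projection \<open>e i i\<close> equals \<open>star (x * c) * (x * c)\<close>. Asymptotically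
  its trace is that of \<open>x * c * star (x * c)\<close>, which is dominated by a multiple of \<open>x * star x\<close>,
  hence null. All minimal projections of the same stage are equivalent, so 1 would have trace 0.
\<close>

lemma T_faithful:
  assumes lim: "(\<lambda>m. T m (star x * x)) \<longlonglongrightarrow> 0"
  shows "x = 0"
proof (rule ccontr)
  assume "x \<noteq> 0"
  obtain m0 I e where L: "local_units m0 I e"
    and "\<exists>i\<in>I. \<exists>c. e i i * c = c \<and> star (x * c) * (x * c) = e i i"
    using excision[OF \<open>x \<noteq> 0\<close>] local_units_exist by (metis order_refl)
  then obtain i c where i: "i \<in> I" and c: "star (x * c) * (x * c) = e i i" by blast
  have e: "matrix_units I e" by (rule local_units_matrix_units[OF L])
  define C where "C = norm (c * star c) + 1"
  have le: "cstar_le (x * c * star (x * c)) (C *\<^sub>R (x * star x))"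
    using conjugate_le[of "c * star c" C "star x"]
    by (simp add: C_def star_mult star_star mult.assoc)
  have "(\<lambda>m. T m (x * c * star (x * c))) \<longlonglongrightarrow> 0"
  proof (rule tendsto_sandwich)
    show "\<forall>\<^sub>F m in sequentially. 0 \<le> T m (x * c * star (x * c))"
      using T_positive[of _ "star (x * c)"] by (simp add: star_star)
    show "\<forall>\<^sub>F m in sequentially. T m (x * c * star (x * c)) \<le> C * T m (x * star x)"
      using T_mono[OF le] by (simp add: T_scaleR)
    show "(\<lambda>m. C * T m (x * star x)) \<longlonglongrightarrow> 0"
      using T_commute_null[OF lim] by (intro tendsto_mult_right_zero)
  qed simp
  then have "(\<lambda>m. T m (star (x * c) * (x * c))) \<longlonglongrightarrow> 0" by (rule T_commute_null)
  then have i0: "(\<lambda>m. T m (e i i)) \<longlonglongrightarrow> 0" by (simp only: c)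
  have "(\<lambda>m. T m (e j j)) \<longlonglongrightarrow> 0" if "j \<in> I" for j
    using T_commute_null[of "e i j" "e j i"] i0 that i by (simp add: matrix_units_mult[OF e])
  then have "(\<lambda>m. \<Sum>j\<in>I. T m (e j j)) \<longlonglongrightarrow> 0" by (rule tendsto_null_sum)
  moreover have "(\<Sum>j\<in>I. T m (e j j)) = 1" for m
    unfolding T_sum[symmetric] matrix_units_sum[OF e] by (rule T_one)
  ultimately show False by (simp add: LIMSEQ_const_iff)
qed

end

text \<open>
  For an isometric matrix \<open>v\<close> the projection \<open>w = 1 - v * star v\<close> has trace tending to zero by
  the trace property. Its diagonal entries are sums of terms \<open>star (w l i) * w l i\<close>, so every entry
  of \<open>w\<close> vanishes by faithfulness.
\<close>

theorem stably_finite_uhf: "stably_finite TYPE(uhf)"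
  unfolding stably_finite_def
proof (intro allI impI)
  fix k i j :: nat and v :: "nat \<Rightarrow> nat \<Rightarrow> uhf"
  assume v: "\<forall>i<k. \<forall>j<k. (\<Sum>l<k. star (v l i) * v l j) = (if i = j then 1 else 0)"
    and ij: "i < k" "j < k"
  obtain T where "asymptotic_trace T" using asymptotic_trace_exists by blast
  then interpret asymptotic_trace T .
  define q where "q i j = (\<Sum>l<k. v i l * star (v j l))" for i j
  define w where "w i j = (if i = j then 1 else 0) - q i j" for i j
  have qq: "(\<Sum>l<k. q i l * q l j) = q i j" for i j
  proof -
    have "(\<Sum>l<k. q i l * q l j) = (\<Sum>l<k. \<Sum>a<k. \<Sum>b<k. v i a * (star (v l a) * v l b) * star (v j b))"
      by (simp add: q_def sum_product mult.assoc)
    also have "\<dots> = (\<Sum>a<k. \<Sum>b<k. \<Sum>l<k. v i a * (star (v l a) * v l b) * star (v j b))"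
      by (subst sum.swap) (intro sum.cong refl sum.swap)
    also have "\<dots> = (\<Sum>a<k. \<Sum>b<k. v i a * (\<Sum>l<k. star (v l a) * v l b) * star (v j b))"
      by (simp add: sum_distrib_left sum_distrib_right)
    also have "\<dots> = (\<Sum>a<k. \<Sum>b<k. if b = a then v i a * star (v j a) else 0)"
      using v by (intro sum.cong refl) auto
    finally show ?thesis by (simp add: q_def)
  qed
  have sq: "star (q i j) = q j i" for i j by (simp add: q_def star_sum star_mult star_star)
  have sw: "star (w i j) = w j i" for i j by (simp add: w_def star_diff sq)
  have ww: "(\<Sum>l<k. w i l * w l i) = w i i" if "i < k" for i
  proof -
    have "w i l * w l i = (if l = i then 1 - q i i - q i i else 0) + q i l * q l i" for l
      by (simp add: w_def algebra_simps)
    then have "(\<Sum>l<k. w i l * w l i) = (1 - q i i - q i i) + (\<Sum>l<k. q i l * q l i)"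
      using that by (simp add: sum.distrib)
    then show ?thesis by (simp add: qq w_def)
  qed
  have "(\<lambda>m. \<Sum>i<k. T m (w i i)) \<longlonglongrightarrow> 0"
  proof -
    have "(\<Sum>i<k. T m (w i i)) = - (\<Sum>i<k. \<Sum>l<k. T m (v i l * star (v i l)) - T m (star (v i l) * v i l))" for m
    proof -
      have "(\<Sum>i<k. \<Sum>l<k. T m (star (v i l) * v i l)) = (\<Sum>l<k. T m (\<Sum>i<k. star (v i l) * v i l))"
        by (subst sum.swap) (simp add: T_sum)
      also have "\<dots> = k" using v by (simp add: T_one)
      finally show ?thesis by (simp add: w_def q_def T_diff T_one T_sum sum_subtractf)
    qed
    moreover have "(\<lambda>m. - (\<Sum>i<k. \<Sum>l<k. T m (v i l * star (v i l)) - T m (star (v i l) * v i l))) \<longlonglongrightarrow> - 0"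
      by (intro tendsto_minus tendsto_null_sum T_commute)
    ultimately show ?thesis by simp
  qed
  moreover have "(\<Sum>i<k. T m (w i i)) = (\<Sum>i<k. \<Sum>l<k. T m (star (w l i) * w l i))" for m
    unfolding sw T_sum[symmetric] by (intro arg_cong[of _ _ "T m"] sum.cong refl) (simp add: ww)
  ultimately have lim: "(\<lambda>m. \<Sum>i<k. \<Sum>l<k. T m (star (w l i) * w l i)) \<longlonglongrightarrow> 0" by simp
  have "(\<lambda>m. T m (star (w i j) * w i j)) \<longlonglongrightarrow> 0"
  proof (rule tendsto_sandwich[OF _ _ tendsto_const lim])
    have "T m (star (w i j) * w i j) \<le> (\<Sum>j<k. \<Sum>i<k. T m (star (w i j) * w i j))" for m
    proof -
      have "T m (star (w i j) * w i j) \<le> (\<Sum>i<k. T m (star (w i j) * w i j))"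
        using ij by (intro member_le_sum) (auto simp: T_positive)
      also have "\<dots> \<le> (\<Sum>j<k. \<Sum>i<k. T m (star (w i j) * w i j))"
        using ij by (intro member_le_sum[where f = "\<lambda>j. \<Sum>i<k. T m (star (w i j) * w i j)"])
          (auto simp: T_positive intro: sum_nonneg)
      finally show ?thesis .
    qed
    then show "\<forall>\<^sub>F m in sequentially. T m (star (w i j) * w i j) \<le> (\<Sum>j<k. \<Sum>i<k. T m (star (w i j) * w i j))"
      by simp
  qed (simp add: T_positive)
  then have "w i j = 0" by (rule T_faithful)
  then show "(\<Sum>l<k. v i l * star (v j l)) = (if i = j then 1 else 0)"
    by (simp add: w_def q_def)
qed

section \<open>Comparison with hereditary subalgebras\<close>

lemma projection_range:
  assumes "projection (star z * z)"
  shows "projection (z * star z)"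
proof -
  let ?f = "star z * z"
  have f: "star ?f = ?f" "?f * ?f = ?f" using assms by (auto simp: projection_def)
  have "star (z - z * ?f) * (z - z * ?f) = ?f - ?f * ?f - ?f * ?f + ?f * ?f * ?f"
    using f(1) by (simp add: star_diff star_mult star_star algebra_simps)
  also have "\<dots> = 0" using f by simp
  finally have "norm (z - z * ?f) = 0" using cstar_identity[of "z - z * ?f"] by simp
  then have "z * ?f = z" by simp
  then have "z * star z * (z * star z) = z * star z" by (metis mult.assoc)
  then show ?thesis by (simp add: projection_def star_mult star_star)
qed

text \<open>
  The element lies below a multiple of \<open>x * x\<close>.
\<close>

lemma conjugate_in_hereditary_subalgebra:
  assumes x: "positive x" and g: "positive g"
  shows "x * g * x \<in> hereditary_subalgebra_generated x"
  unfolding hereditary_subalgebra_generated_def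
proof (intro InterI, elim CollectE conjE)
  fix B assume B: "hereditary_subalgebra B" "x \<in> B"
  have sx: "star x = x" by (rule positive_self_adjoint[OF x])
  define C where "C = norm g + 1"
  have "cstar_le (x * g * x) (C *\<^sub>R (x * x))"
    using conjugate_le[OF positive_self_adjoint[OF g], of C x] by (simp add: sx C_def)
  moreover have "C *\<^sub>R (x * x) \<in> B"
    using B unfolding hereditary_subalgebra_def scaleC_of_real[symmetric] by blast
  moreover have "positive (x * g * x)" using positive_conjugate[OF g, of x] by (simp add: sx)
  ultimately show "x * g * x \<in> B" using B(1) unfolding hereditary_subalgebra_def by blast
qed

text \<open>
  A projection in a far factor is equivalent to one below the small projection \<open>e i i\<close>, once the far
  factor is large enough. In \<open>w = (\<Sum>j. e i j * V j)\<close> the partial isometries \<open>V j\<close> of the far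
  factor move the index set \<open>C\<close> to pairwise disjoint places \<open>h (j, _)\<close>, so that the summands
  have orthogonal ranges below \<open>e i i\<close> and their source projections add up over \<open>j\<close>.
\<close>

lemma spread_partial_isometry:
  assumes e: "matrix_units I e" and G: "matrix_units K G" and i: "i \<in> I"
    and comm: "\<And>j k r s. j \<in> I \<Longrightarrow> k \<in> I \<Longrightarrow> r \<in> K \<Longrightarrow> s \<in> K \<Longrightarrow> G r s * e j k = e j k * G r s"
    and C: "C \<subseteq> K" and card: "card I * card C \<le> card K"
  shows "\<exists>w. e i i * w = w \<and> star w * w = diag_projection G C"
proof -
  have fin: "finite I" "finite K" "finite C"
    using matrix_units_finite[OF e] matrix_units_finite[OF G] C finite_subset by auto
  have "card (I \<times> C) \<le> card K" using card by (simp add: card_cartesian_product)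
  then obtain h where h: "inj_on h (I \<times> C)" "h ` (I \<times> C) \<subseteq> K"
    using card_le_inj[of "I \<times> C" K] fin by auto
  have hK: "h (j, s) \<in> K" if "j \<in> I" "s \<in> C" for j s using h(2) that by auto
  have CK: "s \<in> K" if "s \<in> C" for s using C that by auto
  define V where "V j = (\<Sum>s\<in>C. G (h (j, s)) s)" for j
  define w where "w = (\<Sum>j\<in>I. e i j * V j)"
  have sV: "star (V j) = (\<Sum>s\<in>C. G s (h (j, s)))" if "j \<in> I" for j
    unfolding V_def star_sum
    using that hK CK by (intro sum.cong refl matrix_units_star[OF G]) auto
  have VV: "star (V j) * V k = (if j = k then diag_projection G C else 0)" if "j \<in> I" "k \<in> I" for j k
  proof -
    have "star (V j) * V k = (\<Sum>s\<in>C. \<Sum>t\<in>C. if t = s then (if j = k then G s s else 0) else 0)"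
      unfolding sV[OF that(1)] unfolding V_def sum_product
    proof (intro sum.cong refl)
      fix s t assume st: "s \<in> C" "t \<in> C"
      have "h (j, s) = h (k, t) \<longleftrightarrow> j = k \<and> s = t"
        using inj_on_eq_iff[OF h(1), of "(j, s)" "(k, t)"] that st by auto
      then show "G s (h (j, s)) * G (h (k, t)) t = (if t = s then (if j = k then G s s else 0) else 0)"
        using matrix_units_mult[OF G CK[OF st(1)] hK[OF that(1) st(1)] hK[OF that(2) st(2)] CK[OF st(2)]]
        by auto
    qed
    then show ?thesis using fin by (simp add: diag_projection_def)
  qed
  have sVe: "star (V j) * e k l = e k l * star (V j)" if "j \<in> I" "k \<in> I" "l \<in> I" for j k l
    unfolding sV[OF that(1)] sum_distrib_left sum_distrib_right
    using that hK CK by (intro sum.cong refl comm) auto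
  have "star w * w = (\<Sum>j\<in>I. \<Sum>k\<in>I. star (e i j * V j) * (e i k * V k))"
    by (simp add: w_def star_sum sum_product)
  also have "\<dots> = (\<Sum>j\<in>I. \<Sum>k\<in>I. if k = j then e j j * diag_projection G C else 0)"
  proof (intro sum.cong refl)
    fix j k assume jk: "j \<in> I" "k \<in> I"
    have "star (e i j * V j) * (e i k * V k) = star (V j) * (e j i * e i k) * V k"
      using jk i by (simp add: star_mult matrix_units_star[OF e] mult.assoc)
    also have "\<dots> = star (V j) * e j k * V k" using jk i by (simp add: matrix_units_mult[OF e])
    also have "\<dots> = e j k * (star (V j) * V k)"
      unfolding sVe[OF jk(1) jk] by (rule mult.assoc)
    finally show "star (e i j * V j) * (e i k * V k) = (if k = j then e j j * diag_projection G C else 0)"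
      using jk by (simp add: VV)
  qed
  also have "\<dots> = (\<Sum>j\<in>I. e j j) * diag_projection G C"
    using fin by (simp add: sum_distrib_right)
  finally have "star w * w = diag_projection G C" by (simp add: matrix_units_sum[OF e])
  moreover have "e i i * w = w"
    unfolding w_def sum_distrib_left
    using i by (intro sum.cong refl) (simp add: mult.assoc[symmetric] matrix_units_mult[OF e])
  ultimately show ?thesis by blast
qed

text \<open>
  Given \<open>f\<close> equivalent to a projection below \<open>p\<close>, and \<open>x * c\<close> carrying \<open>p\<close> into the range of \<open>x\<close>, the
  composite \<open>z = x * c * w\<close> is a partial isometry with source \<open>f\<close> and with \<open>z * star z\<close> of the form
  \<open>x * g * x\<close>.
\<close>

lemma subequivalent_to_hereditary:
  assumes x: "positive x" and c: "star (x * c) * (x * c) = p" and w: "p * w = w"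
    and f: "star w * w = f" "projection f"
  shows "\<exists>q. projection q \<and> q \<in> hereditary_subalgebra_generated x \<and> mvn_equivalent f q"
proof -
  define z where "z = x * c * w"
  have "star z * z = star w * (star (x * c) * (x * c) * w)"
    by (simp add: z_def star_mult mult.assoc)
  then have z: "star z * z = f" by (simp add: c w f)
  have "z * star z = x * (c * w * star (c * w)) * x"
    by (simp add: z_def star_mult positive_self_adjoint[OF x] mult.assoc)
  then have "z * star z \<in> hereditary_subalgebra_generated x"
    using conjugate_in_hereditary_subalgebra[OF x positive_mult_star, of "c * w"] by simp
  moreover have "projection (z * star z)" using f z by (intro projection_range) simp
  ultimately show ?thesis using z unfolding mvn_equivalent_def by blast
qed

section \<open>Swapped projections in one tensor factor\<close>

lemma beta_add: "beta (x + y) = beta x + beta y"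
  and beta_mult: "beta (x * y) = beta x * beta y"
  and beta_star: "beta (star x) = star (beta x)"
  and beta_scaleC: "beta (c *\<^sub>C x) = c *\<^sub>C beta x"
  using star_automorphism_beta by (auto simp: star_automorphism_def)

lemma beta_scaleR: "beta (r *\<^sub>R x) = r *\<^sub>R beta x"
  using beta_scaleC[of "complex_of_real r" x] by (simp add: scaleC_of_real)

lemma beta_sum: "beta (sum f A) = (\<Sum>a\<in>A. beta (f a))"
proof -
  have "beta 0 = 0" using beta_add[of 0 0] by simp
  then show ?thesis by (induction A rule: infinite_finite_induct) (auto simp: beta_add)
qed

lemma sum_lessThan_double:
  fixes f :: "nat \<Rightarrow> 'b::comm_monoid_add"
  shows "(\<Sum>a<2 * H. f a) = (\<Sum>a<H. f a + f (a + H))"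
proof -
  have "{..<2 * H} = {..<H} \<union> {H..<H + H}" by auto
  then have "(\<Sum>a<2 * H. f a) = (\<Sum>a<H. f a) + (\<Sum>a\<in>{H..<H + H}. f a)"
    by (simp add: sum.union_disjoint ivl_disj_int)
  also have "(\<Sum>a\<in>{H..<H + H}. f a) = (\<Sum>a<H. f (a + H))"
    using sum.shift_bounds_nat_ivl[of f 0 H H] by (simp add: atLeast0LessThan)
  finally show ?thesis by (simp add: sum.distrib)
qed

text \<open>
  The sign unitary is \<open>+1\<close> on the basis vectors \<open>0, ..., H\<close> and \<open>-1\<close> on \<open>H + 1, ..., 2 * H - 1\<close>.
  For \<open>1 \<le> s < H\<close> it therefore swaps the two vectors \<open>(b s + b (s + H)) / sqrt 2\<close> and
  \<open>(b s - b (s + H)) / sqrt 2\<close>, where \<open>b\<close> is the standard basis. These, placed at \<open>s\<close> and \<open>s + H\<close>,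
  together with the two unpaired basis vectors \<open>0\<close> and \<open>H\<close> form a new orthonormal basis.
\<close>

lemma swapped_matrix_units:
  assumes n: "n \<ge> 1"
  defines "H \<equiv> (2::nat) ^ (n - 1)"
  shows "\<exists>G. matrix_units {..<2 * H} G \<and>
    (\<forall>s. 1 \<le> s \<and> s < H \<longrightarrow> beta (G s s) = G (s + H) (s + H)) \<and>
    (\<forall>x. (\<forall>a\<in>carrier_mat (2 ^ n) (2 ^ n). factor n a * x = x * factor n a) \<longrightarrow>
      (\<forall>r<2 * H. \<forall>s<2 * H. G r s * x = x * G r s))"
proof -
  have H: "2 ^ n = 2 * H" "H \<ge> 1" using n by (auto simp: H_def power_Suc[symmetric])
  let ?E = "unit_elem n"
  \<comment> \<open>The column \<open>g a\<close> is a combination of the basis vectors \<open>lo a\<close> and \<open>lo a + H\<close>; the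
    coefficients \<open>x a\<close> and \<open>y a\<close> form an orthogonal two-by-two matrix for each value of \<open>lo a\<close>.\<close>
  define lo where "lo a = (if a < H then a else a - H)" for a
  define d :: real where "d = 1 / sqrt 2"
  have d: "d * d = 1 / 2" by (simp add: d_def)
  define x :: "nat \<Rightarrow> real" where "x a = (if a = 0 then 1 else if a = H then 0 else d)" for a
  define y :: "nat \<Rightarrow> real" where
    "y a = (if a = 0 then 0 else if a = H then 1 else if a < H then d else - d)" for a
  define g where "g a = x a *\<^sub>R ?E (lo a) 0 + y a *\<^sub>R ?E (lo a + H) 0" for a
  have sg: "star (g a) = x a *\<^sub>R ?E 0 (lo a) + y a *\<^sub>R ?E 0 (lo a + H)" for a
    using n by (simp add: g_def star_scaleR star_add unit_elem_star)
  have E: "?E r s * ?E t u = (if s = t then ?E r u else 0)"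
    if "r < 2 * H" "s < 2 * H" "t < 2 * H" "u < 2 * H" for r s t u
    using unit_elem_mult[OF n, of r s t u] that by (simp add: H)
  have lo: "lo a < H" if "a < 2 * H" for a using that by (auto simp: lo_def)
  have "star (g a) * g b = (if a = b then ?E 0 0 else 0)" if ab: "a < 2 * H" "b < 2 * H" for a b
  proof -
    have "star (g a) * g b = (if lo a = lo b then (x a * x b + y a * y b) *\<^sub>R ?E 0 0 else 0)"
      unfolding sg unfolding g_def using lo[OF ab(1)] lo[OF ab(2)]
      by (auto simp: E distrib_left distrib_right scaleR_add_left mult.commute)
    moreover have "lo a = lo b \<longleftrightarrow> a = b \<or> a = b + H \<or> b = a + H"
      using ab by (auto simp: lo_def)
    moreover have "x a * x a + y a * y a = 1" by (auto simp: x_def y_def d)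
    moreover have "x a * x b + y a * y b = 0" if "a = b + H \<or> b = a + H"
      using that ab H(2) by (auto simp: x_def y_def)
    ultimately show ?thesis using H(2) by auto
  qed
  moreover have "g a * ?E 0 0 = g a" if "a < 2 * H" for a
    unfolding g_def using lo[OF that] H(2) by (simp add: E distrib_right)
  moreover have "(\<Sum>a<2 * H. g a * star (g a)) = 1"
  proof -
    have "g a * star (g a) + g (a + H) * star (g (a + H)) = ?E a a + ?E (a + H) (a + H)" if a: "a < H" for a
    proof -
      let ?a = "a + H"
      have "g a * star (g a) + g ?a * star (g ?a)
          = (x a * x a + x ?a * x ?a) *\<^sub>R ?E a a + (x a * y a + x ?a * y ?a) *\<^sub>R ?E a ?a
            + (x a * y a + x ?a * y ?a) *\<^sub>R ?E ?a a + (y a * y a + y ?a * y ?a) *\<^sub>R ?E ?a ?a"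
        unfolding sg unfolding g_def using a
        by (simp add: lo_def E distrib_left distrib_right scaleR_add_left scaleR_add_right ac_simps)
      moreover have "x a * x a + x ?a * x ?a = 1" "x a * y a + x ?a * y ?a = 0" "y a * y a + y ?a * y ?a = 1"
        using a by (auto simp: x_def y_def d)
      ultimately show ?thesis by simp
    qed
    then have "(\<Sum>a<2 * H. g a * star (g a)) = (\<Sum>a<2 * H. ?E a a)"
      unfolding sum_lessThan_double by (intro sum.cong refl) auto
    then show ?thesis using unit_elem_sum[OF n] by (simp add: H)
  qed
  ultimately have "matrix_units {..<2 * H} (\<lambda>a b. g a * star (g b))"
    by (intro matrix_units_from_orthonormal_columns[where p = "?E 0 0"]) auto
  moreover have "beta (g s) = g (s + H)" if s: "1 \<le> s" "s < H" for s
  proof -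
    have "diag_sign n 0 = 1" "diag_sign n s = 1" "diag_sign n (s + H) = - 1"
      using s by (auto simp: diag_sign_def H_def)
    then have "beta (?E s 0) = ?E s 0" "beta (?E (s + H) 0) = - ?E (s + H) 0"
      using s H n by (simp_all add: beta_unit_elem)
    moreover have "lo s = s" "lo (s + H) = s" "x (s + H) = x s" "y (s + H) = - y s"
      using s by (auto simp: lo_def x_def y_def)
    ultimately show ?thesis by (simp add: g_def beta_scaleR beta_add)
  qed
  moreover have "g r * star (g s) * z = z * (g r * star (g s))"
    if z: "\<forall>a\<in>carrier_mat (2 ^ n) (2 ^ n). factor n a * z = z * factor n a" for z r s
  proof -
    have Ez: "?E t u * z = z * ?E t u" for t u unfolding unit_elem_def using z by simp
    have "g r * z = z * g r" by (simp add: g_def Ez distrib_left distrib_right)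
    moreover have "star (g s) * z = z * star (g s)" by (simp add: sg Ez distrib_left distrib_right)
    ultimately show ?thesis by (metis mult.assoc)
  qed
  ultimately show ?thesis
    by (intro exI[of _ "\<lambda>a b. g a * star (g b)"]) (simp add: beta_mult beta_star)
qed

lemma finite_set_almost_local:
  assumes "finite F" "\<epsilon> > 0"
  shows "\<exists>n. \<forall>a\<in>F. \<exists>b\<in>local_up_to n. norm (a - b) < \<epsilon>"
  using assms(1)
proof induction
  case (insert x F)
  then obtain n where n: "\<forall>a\<in>F. \<exists>b\<in>local_up_to n. norm (a - b) < \<epsilon>" by blast
  obtain m y where m: "y \<in> local_up_to m" "norm (x - y) < \<epsilon>"
    using local_elements_dense[OF assms(2)] by blast
  have "\<exists>b\<in>local_up_to (max m n). norm (a - b) < \<epsilon>" if "a \<in> insert x F" for a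
    using that n m local_up_to_mono[of _ _ "max m n"] by (metis insertE max.cobounded1 max.cobounded2)
  then show ?case by blast
qed simp

lemma commutator_bound:
  fixes a b e :: "'a::unital_cstar_algebra"
  assumes "norm e \<le> 1" "e * b = b * e" "norm (a - b) < \<epsilon> / 2"
  shows "norm (e * a - a * e) < \<epsilon>"
proof -
  have "e * a - a * e = e * (a - b) - (a - b) * e" using assms(2) by (simp add: algebra_simps)
  also have "norm \<dots> \<le> norm (e * (a - b)) + norm ((a - b) * e)" by (rule norm_triangle_ineq4)
  also have "\<dots> \<le> norm e * norm (a - b) + norm (a - b) * norm e" by (intro add_mono norm_mult_ineq)
  also have "\<dots> \<le> 1 * norm (a - b) + norm (a - b) * 1"
    using assms(1) by (intro add_mono mult_right_mono mult_left_mono) auto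
  finally show ?thesis using assms(3) by simp
qed

lemma many_copies_of_pair:
  assumes G: "matrix_units K G" and C: "s \<noteq> t" "s \<in> K" "t \<in> K" and B: "{b..<b + 2 * N} \<subseteq> B" "B \<subseteq> K"
  shows "\<exists>f :: nat \<Rightarrow> 'a::unital_cstar_algebra.
    (\<forall>i<N. projection (f i) \<and> cstar_le (f i) (diag_projection G B) \<and>
      mvn_equivalent (f i) (diag_projection G {s, t})) \<and>
    (\<forall>i<N. \<forall>l<N. i \<noteq> l \<longrightarrow> f i * f l = 0)"
proof (intro exI conjI allI impI)
  let ?f = "\<lambda>i. diag_projection G {b + 2 * i, b + 2 * i + 1}"
  fix i assume i: "i < N"
  have sub: "{b + 2 * i, b + 2 * i + 1} \<subseteq> B" if "i < N" for i
    using B(1) that by (auto simp: subset_iff)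
  note K = order_trans[OF sub B(2)]
  show "projection (?f i)" by (rule projection_diag_projection[OF G K[OF i]])
  show "cstar_le (?f i) (diag_projection G B)" by (rule diag_projection_mono[OF G sub[OF i] B(2)])
  let ?h = "\<lambda>u. if u = s then b + 2 * i else b + 2 * i + 1"
  have im: "?h ` {s, t} = {b + 2 * i, b + 2 * i + 1}" using C(1) by auto
  show "mvn_equivalent (?f i) (diag_projection G {s, t})"
    using diag_projection_mvn[OF G, of "{s, t}" ?h] C K[OF i] unfolding im by (auto simp: inj_on_def)
  fix l assume l: "l < N" "i \<noteq> l"
  then have "{b + 2 * i, b + 2 * i + 1} \<inter> {b + 2 * l, b + 2 * l + 1} = {}" by auto
  then show "?f i * ?f l = 0"
    unfolding diag_projection_mult[OF G K[OF i] K[OF l(1)]] by (simp add: diag_projection_def)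
qed

section \<open>The tracial Rokhlin property\<close>

theorem proposition12p4:
  shows "tracial_rokhlin_property 2 beta"
  unfolding tracial_rokhlin_property_def
proof (intro conjI allI impI)
  show "stably_finite TYPE(uhf)" by (rule stably_finite_uhf)
  show "simple_cstar TYPE(uhf)" by (rule simple_uhf)
  show "star_automorphism beta" by (rule star_automorphism_beta)
  show "beta ^^ 2 = id" by (simp add: fun_eq_iff numeral_2_eq_2 beta_beta)
  fix F :: "uhf set" and \<epsilon> :: real and N :: nat and x :: uhf
  assume "finite F \<and> \<epsilon> > 0 \<and> positive x \<and> x \<noteq> 0"
  then have F: "finite F" "\<epsilon> > 0" and x: "positive x" "x \<noteq> 0" by auto
  obtain n0 where n0: "\<forall>a\<in>F. \<exists>b\<in>local_up_to n0. norm (a - b) < \<epsilon> / 2"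
    using finite_set_almost_local[OF F(1), of "\<epsilon> / 2"] F(2) by auto
  obtain m I u where L: "local_units m I u"
    and ex: "\<exists>i\<in>I. \<exists>c. u i i * c = c \<and> star (x * c) * (x * c) = u i i"
    using excision[OF x(2)] local_units_exist by (metis order_refl)
  then obtain i c where i: "i \<in> I" "star (x * c) * (x * c) = u i i" by blast
  \<comment> \<open>The factor has to lie beyond the approximants of \<open>F\<close> and beyond the matrix units \<open>u\<close>, and to be
    large enough for \<open>N\<close> disjoint pairs in each \<open>B j\<close> and for one disjoint pair per element of \<open>I\<close>.\<close>
  define n where "n = Suc (n0 + m + card I + 2 * N + 1)"
  define H where "H = (2::nat) ^ (n - 1)"
  define K where "K = {..<2 * H}"
  have n: "n \<ge> 1" "n > n0" "n > m" by (auto simp: n_def)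
  have "n - 1 < H" unfolding H_def by (rule less_exp)
  then have H: "2 * N + 1 \<le> H" "card I \<le> H" by (auto simp: n_def)
  obtain G where G: "matrix_units K G"
    and swap: "\<And>s. 1 \<le> s \<Longrightarrow> s < H \<Longrightarrow> beta (G s s) = G (s + H) (s + H)"
    and comm: "\<And>z r s. \<forall>a\<in>carrier_mat (2 ^ n) (2 ^ n). factor n a * z = z * factor n a \<Longrightarrow>
      r \<in> K \<Longrightarrow> s \<in> K \<Longrightarrow> G r s * z = z * G r s"
    using swapped_matrix_units[OF n(1)] unfolding H_def[symmetric] K_def by auto
  \<comment> \<open>The indices \<open>0\<close> and \<open>H\<close> are left over, so \<open>1 - e 0 - e 1\<close> has rank two in this factor.\<close>
  define B where "B j = (if j = 0 then {1..<H} else {H + 1..<2 * H})" for j :: nat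
  define e where "e j = diag_projection G (B j)" for j
  have BK: "B j \<subseteq> K" for j by (auto simp: B_def K_def)
  have CK: "{0, H} \<subseteq> K" "0 \<noteq> H" using H(1) by (auto simp: K_def)
  have two: "{..<2::nat} = {0, 1}" by auto
  have rest: "1 - (\<Sum>j<2. e j) = diag_projection G {0, H}"
  proof -
    have "K = B 0 \<union> B 1 \<union> {0, H}" using H(1) by (auto simp: B_def K_def)
    moreover have "B 0 \<inter> B 1 = {}" "(B 0 \<union> B 1) \<inter> {0, H} = {}" by (auto simp: B_def)
    moreover have "finite (B 0)" "finite (B 1)" by (auto simp: B_def)
    ultimately have "(\<Sum>s\<in>K. G s s) = diag_projection G (B 0) + diag_projection G (B 1) + diag_projection G {0, H}"
      unfolding diag_projection_def by (simp only: sum.union_disjoint finite_Un finite.intros)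
    then show ?thesis by (simp add: matrix_units_sum[OF G] e_def two algebra_simps)
  qed
  have proj: "projection (e j)" for j unfolding e_def by (rule projection_diag_projection[OF G BK])
  show "\<exists>e :: nat \<Rightarrow> uhf. (\<forall>j<2. projection (e j)) \<and>
      (\<forall>i<2. \<forall>j<2. i \<noteq> j \<longrightarrow> e i * e j = 0) \<and>
      (\<forall>j. j + 1 < 2 \<longrightarrow> norm (beta (e j) - e (j + 1)) < \<epsilon>) \<and>
      (\<forall>j<2. \<forall>a\<in>F. norm (e j * a - a * e j) < \<epsilon>) \<and>
      (\<exists>q. projection q \<and> q \<in> hereditary_subalgebra_generated x \<and>
           mvn_equivalent (1 - (\<Sum>j<2. e j)) q) \<and>
      (\<forall>j<2. \<exists>f :: nat \<Rightarrow> uhf.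
         (\<forall>i<N. projection (f i) \<and> cstar_le (f i) (e j) \<and>
            mvn_equivalent (f i) (1 - (\<Sum>j<2. e j))) \<and>
         (\<forall>i<N. \<forall>l<N. i \<noteq> l \<longrightarrow> f i * f l = 0))"
  proof (rule exI[of _ e], unfold rest, intro conjI allI impI ballI)
    show "projection (e j)" for j by (rule proj)
    show "e j * e l = 0" if "j < 2" "l < 2" "j \<noteq> l" for j l
    proof -
      have "B j \<inter> B l = {}" using that by (auto simp: B_def)
      then show ?thesis
        unfolding e_def diag_projection_mult[OF G BK BK] by (simp add: diag_projection_def)
    qed
    show "norm (beta (e j) - e (j + 1)) < \<epsilon>" if "j + 1 < 2" for j
    proof -
      have j: "j = 0" using that by simp
      have "beta (e 0) = (\<Sum>s\<in>{1..<H}. G (s + H) (s + H))"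
        unfolding e_def B_def diag_projection_def beta_sum by (auto intro!: sum.cong swap)
      also have "\<dots> = (\<Sum>s\<in>{1 + H..<H + H}. G s s)" by (rule sum.shift_bounds_nat_ivl[symmetric])
      also have "\<dots> = e 1" by (simp add: e_def B_def diag_projection_def mult_2)
      finally show ?thesis using F(2) by (simp add: j)
    qed
    show "norm (e j * a - a * e j) < \<epsilon>" if a: "a \<in> F" for j a
    proof -
      obtain b where b: "b \<in> local_up_to n0" "norm (a - b) < \<epsilon> / 2" using n0 a by blast
      have "G r s * b = b * G r s" if "r \<in> K" "s \<in> K" for r s
        using local_up_to_commute[OF b(1) n(2)] that by (intro comm) auto
      then have "e j * b = b * e j"
        unfolding e_def diag_projection_def sum_distrib_left sum_distrib_right
        using BK[of j] by (intro sum.cong refl) auto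
      then show ?thesis by (rule commutator_bound[OF norm_projection_le_1[OF proj] _ b(2)])
    qed
    show "\<exists>q. projection q \<and> q \<in> hereditary_subalgebra_generated x \<and>
      mvn_equivalent (diag_projection G {0, H}) q"
    proof -
      have "G r s * u j k = u j k * G r s" if "j \<in> I" "k \<in> I" "r \<in> K" "s \<in> K" for j k r s
        using local_units_commute[OF L n(3) _ that(1,2)] that(3,4) by (intro comm) auto
      moreover have "card I * card {0, H} \<le> card K" using H by (simp add: K_def)
      ultimately obtain w where "u i i * w = w" "star w * w = diag_projection G {0, H}"
        using spread_partial_isometry[OF local_units_matrix_units[OF L] G i(1) _ CK(1)] by blast
      then show ?thesis
        by (rule subequivalent_to_hereditary[OF x(1) i(2) _ _ projection_diag_projection[OF G CK(1)]])
    qed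
    show "\<exists>f. (\<forall>i<N. projection (f i) \<and> cstar_le (f i) (e j) \<and>
        mvn_equivalent (f i) (diag_projection G {0, H})) \<and>
        (\<forall>i<N. \<forall>l<N. i \<noteq> l \<longrightarrow> f i * f l = 0)" for j
      unfolding e_def
    proof (rule many_copies_of_pair[OF G CK(2) _ _ _ BK])
      show "{(if j = 0 then 1 else H + 1)..<(if j = 0 then 1 else H + 1) + 2 * N} \<subseteq> B j"
        using H(1) by (auto simp: B_def)
    qed (use CK in auto)
  qed
qed

end
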